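(* Let $\mathcal L=\sqrt\pi(\mathbb Z+i\mathbb Z)$ and let $\Gamma=(\mu_\lambda)_{\lambda\in\mathcal L}$ be a labelled multiset such that, for some constant $C$ and some finite set $A_0\subset\mathcal L$, $|\mu_\lambda-\lambda|\le C/(1+|\lambda|)$ for all $\lambda\in\mathcal L\setminus A_0$. Enlarge the finite set $A_0$, if necessary, so that $\lambda\ne0$ and $\mu_\lambda\neq0$ for $\lambda\notin A_0$, and put $$B(r)=\sum_{\lambda\in\mathcal L\setminus A_0,\ |\lambda|\le r}\log|\mu_\lambda/\lambda|.$$ For any finite modification $\Xi$ of $\Gamma$ of net multiplicity $q$, $$\Xi\text{ is a zero set for }\mathcal F^2\iff\int_1^\infty r^{2q+1}e^{-2B(r)}\,dr<\infty .$$ Equivalently, the condition is $\int_1^\infty re^{2D_\Xi(r)}\,dr<\infty$. If the integral diverges, $\Xi$ is a uniqueness multiset.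
   Context: $dA$ is planar Lebesgue measure. The Bargmann–Fock space $\mathcal F^2$ is the space of entire functions $f$ with $\frac1\pi\int_{\mathbb C}|f|^2e^{-|z|^2}dA<\infty$. Multisets in $\mathbb C$ are locally finite with finite multiplicities; a labelled family defines the multiset counting each label once (distinct labels may represent the same point). A multiset is a zero set for $\mathcal F^2$ if it is the exact zero multiset (with multiplicities) of some nonzero $f\in\mathcal F^2$; it is a uniqueness multiset if $0$ is the only element of $\mathcal F^2$ vanishing on it with at least the prescribed multiplicities. A finite modification of $\Gamma$ is $\Xi=\Gamma-\nu_-+\nu_+$ with $\nu_\pm$ finite multisets, $0\le\nu_-\le\Gamma$; its net multiplicity is $q=|\nu_+|-|\nu_-|$. For a multiset $\Xi$ with multiplicities $m_\lambda$, $$J_\Xi(r)=m_0\log r+\sum_{0<|\lambda|\le r}m_\lambda\log\frac r{|\lambda|},\qquad D_\Xi(r)=J_\Xi(r)-\frac{r^2}2 .$$ *)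

theory Defs
  imports "HOL-Complex_Analysis.Complex_Analysis" "HOL-Library.Multiset"
begin

text \<open>
  Finite multisets of points are values of type \<^typ>\<open>complex multiset\<close>.  The infinite, locally
  finite ones are represented by their multiplicity functions.
\<close>

type_synonym mult = "complex \<Rightarrow> nat"

definition bargmann_fock :: "(complex \<Rightarrow> complex) set" where
  "bargmann_fock = {f. f holomorphic_on UNIV \<and>
     ennreal (1 / pi) * (\<integral>\<^sup>+ z. ennreal ((cmod (f z))\<^sup>2 * exp (- (cmod z)\<^sup>2)) \<partial>lborel) < \<infinity>}"

text \<open>
  For an entire function that is not identically zero, \<^const>\<open>zorder\<close> is the order of vanishing
  (and is 0 at points that are not zeros).  For the zero function it is unspecified, so that case
  is always treated separately below.
\<close>

definition fock_zero_set :: "mult \<Rightarrow> bool" where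
  "fock_zero_set m \<longleftrightarrow>
     (\<exists>f\<in>bargmann_fock. (\<exists>z. f z \<noteq> 0) \<and> (\<forall>z. zorder f z = int (m z)))"

definition vanishes_on :: "(complex \<Rightarrow> complex) \<Rightarrow> mult \<Rightarrow> bool" where
  "vanishes_on f m \<longleftrightarrow> (\<forall>z. f z = 0) \<or> (\<forall>z. zorder f z \<ge> int (m z))"

definition fock_uniqueness_multiset :: "mult \<Rightarrow> bool" where
  "fock_uniqueness_multiset m \<longleftrightarrow>
     (\<forall>f\<in>bargmann_fock. vanishes_on f m \<longrightarrow> (\<forall>z. f z = 0))"

definition sq_lattice :: "complex set" where
  "sq_lattice = {complex_of_real (sqrt pi) * (of_int a + \<i> * of_int b) | a b :: int. True}"

text \<open>
  The multiset of a family labelled by \<open>I\<close>, each label counted once.  The value is only meaningful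
  when each point carries finitely many labels.  For perturbed lattices this holds because
  \<open>\<mu> \<lambda>\<close> stays within bounded distance of \<open>\<lambda>\<close> off a finite set.
\<close>

definition labelled_multiset :: "complex set \<Rightarrow> (complex \<Rightarrow> complex) \<Rightarrow> mult" where
  "labelled_multiset I \<mu> z = card {l\<in>I. \<mu> l = z}"

definition finite_modification :: "mult \<Rightarrow> mult \<Rightarrow> int \<Rightarrow> bool" where
  "finite_modification \<Gamma> \<Xi> q \<longleftrightarrow>
     (\<exists>N P :: complex multiset.
        (\<forall>z. count N z \<le> \<Gamma> z) \<and>
        (\<forall>z. \<Xi> z = \<Gamma> z - count N z + count P z) \<and>
        q = int (size P) - int (size N))"

text \<open>The sum runs over the support of \<open>m\<close> only, which makes it a finite sum.\<close>

definition jensen_J :: "mult \<Rightarrow> real \<Rightarrow> real" where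
  "jensen_J m r = real (m 0) * ln r +
     (\<Sum>z\<in>{z. 0 < cmod z \<and> cmod z \<le> r \<and> m z > 0}. real (m z) * ln (r / cmod z))"

definition jensen_D :: "mult \<Rightarrow> real \<Rightarrow> real" where
  "jensen_D m r = jensen_J m r - r\<^sup>2 / 2"

definition log_displacement :: "complex set \<Rightarrow> (complex \<Rightarrow> complex) \<Rightarrow> real \<Rightarrow> real" where
  "log_displacement A \<mu> r =
     (\<Sum>l\<in>{l\<in>sq_lattice - A. cmod l \<le> r}. ln (cmod (\<mu> l / l)))"

end

theory Submission imports Defs "HOL-Real_Asymp.Real_Asymp" begin

text \<open>
  Write \<open>L\<close> for the lattice, \<open>B\<close> for the displacement sum, and \<open>J\<close>, \<open>D\<close> for the counting functions
  of a multiset.  Two one-sided estimates, both of which lose only bounded factors, close a circle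
  of implications.

  \<^emph>\<open>Every function pays for its zeros.\<close>  Let \<open>g\<close> be a nonzero element of the space that vanishes on
  \<open>m\<close>.  On each disc the zeros can be exchanged for Blaschke factors without changing
  \<open>\<bar>g\<bar>\<close> on the boundary circle, and the mean value property at the centre then bounds the circle
  integral of \<open>\<bar>g\<bar>\<^sup>2\<close> from below by a constant times \<open>exp (2 J)\<close> (\<open>jensen_inequality\<close>).  Integrating
  over the radii in polar coordinates shows that \<open>r exp (2 D)\<close> is integrable
  (\<open>jensen_integral_finite\<close>).

  \<^emph>\<open>A function with exactly these zeros.\<close>  The Weierstrass sigma function of \<open>L\<close>, normalised by
  summing over squares, satisfies \<open>\<bar>\<sigma>(z)\<bar> \<asymp> dist(z, L) exp (\<bar>z\<bar>\<^sup>2 / 2)\<close>, because the cell has area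
  \<open>\<pi>\<close> and the quotient of the two sides is doubly periodic (\<open>sigma_bounds\<close>).  Replacing each factor
  \<open>1 - z / \<lambda>\<close> by \<open>1 - z / \<mu>\<^sub>\<lambda>\<close> multiplies the upper bound by \<open>exp (- B (\<bar>z\<bar>))\<close> and a constant: a
  label with \<open>\<bar>\<lambda>\<bar> \<le> \<bar>z\<bar>\<close> contributes at most \<open>\<bar>\<lambda> / \<mu>\<^sub>\<lambda>\<bar>\<close> times \<open>1 + O(1 / (\<bar>\<lambda>\<bar> \<bar>\<lambda> - z\<bar>))\<close>, a label with
  \<open>\<bar>\<lambda>\<bar> > \<bar>z\<bar>\<close> contributes at most \<open>1 + O(\<bar>z\<bar> / (\<bar>\<lambda>\<bar>\<^sup>2 \<bar>\<lambda> - z\<bar>))\<close>, and both error sums are bounded uniformly in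
  \<open>z\<close> since the corresponding area integrals are invariant under scaling
  (\<open>canonical_product_bound\<close>).  The finitely many remaining factors give a power of \<open>z\<close>, so a
  suitable function with zero multiset \<open>\<Xi>\<close> is at most a constant times
  \<open>\<bar>z\<bar>\<^sup>q exp (\<bar>z\<bar>\<^sup>2 / 2 - B (\<bar>z\<bar>))\<close>, for large \<open>\<bar>z\<bar>\<close> off \<open>L\<close>, and finiteness
  of the \<open>B\<close>-integral puts it into the space.

  \<^emph>\<open>Closing the circle.\<close>  It remains to pass from the \<open>D\<close>-integral to the \<open>B\<close>-integral.  Pure counting
  gives \<open>J\<^sub>\<Xi>(r) \<ge> J\<^sub>L(r) - B(r) + q log r - O(1)\<close> (\<open>finite_modification_jensen_ge\<close>), and
  \<open>J\<^sub>L(r) \<ge> r\<^sup>2 / 2 - O(1)\<close> for almost every \<open>r\<close> (\<open>lattice_J_lower_bound\<close>): apply the mean value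
  inequality to the inverse square root of \<open>\<sigma>\<close> with its zeros reflected out of the disc, and use that
  \<open>dist(z, L)\<close> to the power \<open>-1/2\<close> has bounded circle means.  So zero set implies \<open>D\<close>-integral finite,
  which implies \<open>B\<close>-integral finite, which implies zero set; and a nonzero function vanishing on
  \<open>\<Xi>\<close> already forces the \<open>D\<close>-integral to be finite, which is the uniqueness statement.
\<close>

section \<open>Sums over the square lattice\<close>

definition gauss_pt :: "int \<times> int \<Rightarrow> complex" where
  "gauss_pt p = complex_of_real (sqrt pi) * (of_int (fst p) + \<i> * of_int (snd p))"

definition height :: "int \<times> int \<Rightarrow> nat" where
  "height p = nat (max \<bar>fst p\<bar> \<bar>snd p\<bar>)"

definition near_idx :: "complex \<Rightarrow> int \<times> int" where
  "near_idx z = (round (Re z / sqrt pi), round (Im z / sqrt pi))"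

definition near :: "complex \<Rightarrow> complex" where
  "near z = gauss_pt (near_idx z)"

lemma Re_gauss_pt: "Re (gauss_pt p) = sqrt pi * fst p"
  and Im_gauss_pt: "Im (gauss_pt p) = sqrt pi * snd p"
  by (simp_all add: gauss_pt_def)

lemma gauss_pt_0 [simp]: "gauss_pt (0,0) = 0"
  by (simp add: gauss_pt_def)

lemma sq_lattice_eq: "sq_lattice = range gauss_pt"
  unfolding sq_lattice_def gauss_pt_def
  by (auto simp: image_iff) (metis fst_conv snd_conv)

lemma gauss_pt_in [simp]: "gauss_pt p \<in> sq_lattice"
  by (simp add: sq_lattice_eq)

lemma near_in [simp]: "near z \<in> sq_lattice"
  by (simp add: near_def)

lemma inj_gauss_pt: "inj gauss_pt"
proof (rule injI)
  fix p q assume "gauss_pt p = gauss_pt q"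
  hence "Re (gauss_pt p) = Re (gauss_pt q)" "Im (gauss_pt p) = Im (gauss_pt q)" by auto
  thus "p = q" by (simp add: Re_gauss_pt Im_gauss_pt prod_eq_iff)
qed

lemma gauss_pt_diff: "gauss_pt p - gauss_pt q = gauss_pt (p - q)"
  by (simp add: gauss_pt_def algebra_simps)

lemma countable_sq_lattice: "countable sq_lattice"
  by (simp add: sq_lattice_eq)

lemma infinite_sq_lattice: "infinite sq_lattice"
  unfolding sq_lattice_eq using inj_gauss_pt finite_imageD infinite_UNIV_int
  by (metis finite_prod infinite_UNIV_char_0)

lemma height_le_iff: "{p. height p \<le> n} = {-int n..int n} \<times> {-int n..int n}"
  by (auto simp: height_def)

lemma finite_height_le: "finite {p. height p \<le> n}"
  by (simp add: height_le_iff)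

lemma card_height_eq:
  assumes "1 \<le> m" shows "card {p. height p = m} \<le> 12 * m"
proof -
  let ?I = "{-int m..int m}"
  have "{p. height p = m} \<subseteq> ({-int m, int m} \<times> ?I) \<union> (?I \<times> {-int m, int m})"
  proof
    fix p assume "p \<in> {p. height p = m}"
    hence "max \<bar>fst p\<bar> \<bar>snd p\<bar> = int m" by (simp add: height_def)
    hence "fst p \<in> {-int m, int m} \<and> snd p \<in> ?I \<or> fst p \<in> ?I \<and> snd p \<in> {-int m, int m}"
      unfolding insert_iff atLeastAtMost_iff by linarith
    thus "p \<in> ({-int m, int m} \<times> ?I) \<union> (?I \<times> {-int m, int m})"
      by (simp add: mem_Times_iff)
  qed
  hence "card {p. height p = m} \<le> card (({-int m, int m} \<times> ?I) \<union> (?I \<times> {-int m, int m}))"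
    by (intro card_mono) auto
  also have "\<dots> \<le> card ({-int m, int m} \<times> ?I) + card (?I \<times> {-int m, int m})"
    by (rule card_Un_le)
  also have "card {-int m, int m} \<le> 2" by (rule card_insert_le_m1) auto
  hence "card {-int m, int m} * (2*m+1) \<le> 2 * (2*m+1)" by (rule mult_right_mono) simp
  hence "card ({-int m, int m} \<times> ?I) + card (?I \<times> {-int m, int m}) \<le> 2 * (2*m+1) + (2*m+1) * 2"
    by (simp add: card_cartesian_product nat_add_distrib nat_mult_distrib algebra_simps)
  also have "\<dots> \<le> 12 * m" using assms by simp
  finally show ?thesis .
qed

text \<open>
  A ring of sup-norm radius \<open>m\<close> around \<open>p0\<close> carries at most \<open>12 m\<close> lattice points; this crude count
  replaces all comparisons of lattice sums with area integrals.
\<close>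

lemma sum_over_rings_le:
  fixes h :: "nat \<Rightarrow> real"
  assumes T: "finite T" "\<And>p. p \<in> T \<Longrightarrow> m0 \<le> height (p - p0) \<and> height (p - p0) \<le> M"
    and m0: "1 \<le> m0" and h: "\<And>m. 0 \<le> h m"
  shows "(\<Sum>p\<in>T. h (height (p - p0))) \<le> (\<Sum>m=m0..M. 12 * real m * h m)"
proof -
  have fib: "card {p\<in>T. height (p - p0) = m} \<le> 12 * m" if "1 \<le> m" for m
  proof -
    have "card {p\<in>T. height (p - p0) = m} \<le> card ((\<lambda>p. p + p0) ` {p. height p = m})"
    proof (rule card_mono)
      show "finite ((\<lambda>p. p + p0) ` {p. height p = m})"
        by (rule finite_imageI, rule finite_subset[OF _ finite_height_le[of m]]) auto
      show "{p\<in>T. height (p - p0) = m} \<subseteq> (\<lambda>p. p + p0) ` {p. height p = m}"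
      proof
        fix p assume "p \<in> {p\<in>T. height (p - p0) = m}"
        thus "p \<in> (\<lambda>p. p + p0) ` {p. height p = m}" by (intro image_eqI[of _ _ "p - p0"]) auto
      qed
    qed
    also have "\<dots> = card {p. height p = m}" by (rule card_image) (auto simp: inj_on_def)
    finally show ?thesis using card_height_eq[OF that] by simp
  qed
  have "(\<Sum>p\<in>T. h (height (p - p0))) = (\<Sum>m\<in>{m0..M}. \<Sum>p\<in>{p\<in>T. height (p - p0) = m}. h (height (p - p0)))"
    by (rule sum.group[symmetric]) (use T in auto)
  also have "\<dots> = (\<Sum>m=m0..M. real (card {p\<in>T. height (p - p0) = m}) * h m)"
    by (intro sum.cong refl) simp
  also have "\<dots> \<le> (\<Sum>m=m0..M. 12 * real m * h m)"
  proof (intro sum_mono mult_right_mono h)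
    fix m assume "m \<in> {m0..M}"
    hence "card {p\<in>T. height (p - p0) = m} \<le> 12 * m" using m0 by (intro fib) auto
    hence "real (card {p\<in>T. height (p - p0) = m}) \<le> real (12 * m)" by (simp only: of_nat_le_iff)
    thus "real (card {p\<in>T. height (p - p0) = m}) \<le> 12 * real m" by simp
  qed
  finally show ?thesis .
qed

lemma near_close: "\<bar>Re (z - near z)\<bar> \<le> sqrt pi / 2" "\<bar>Im (z - near z)\<bar> \<le> sqrt pi / 2"
proof -
  have *: "\<bar>x - sqrt pi * of_int (round (x / sqrt pi))\<bar> \<le> sqrt pi / 2" for x
  proof -
    have "\<bar>x - sqrt pi * of_int (round (x / sqrt pi))\<bar> = sqrt pi * \<bar>of_int (round (x / sqrt pi)) - x / sqrt pi\<bar>"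
      by (subst abs_minus_commute) (simp add: abs_mult_pos' right_diff_distrib)
    also have "\<dots> \<le> sqrt pi * (1/2)"
      by (intro mult_left_mono of_int_round_abs_le) auto
    finally show ?thesis by simp
  qed
  show "\<bar>Re (z - near z)\<bar> \<le> sqrt pi / 2" "\<bar>Im (z - near z)\<bar> \<le> sqrt pi / 2"
    using *[of "Re z"] *[of "Im z"]
    by (auto simp: near_def near_idx_def Re_gauss_pt Im_gauss_pt)
qed

lemma sqrt_pi_bounds: "1.7 < sqrt pi" "sqrt pi < 2"
proof -
  have "3 < pi" using pi_gt3 .
  show "1.7 < sqrt pi" by (rule real_less_rsqrt) (use pi_gt3 in \<open>simp add: power2_eq_square\<close>)
  show "sqrt pi < 2" by (rule real_less_lsqrt) (use pi_less_4 in auto)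
qed

lemma cmod_diff_near_le: "cmod (z - near z) \<le> 2"
proof -
  have "cmod (z - near z) \<le> \<bar>Re (z - near z)\<bar> + \<bar>Im (z - near z)\<bar>" by (rule cmod_le)
  thus ?thesis using near_close[of z] sqrt_pi_bounds by simp
qed

text \<open>
  The nearest lattice point is within half a cell in each coordinate, so at sup-norm distance \<open>k \<ge> 1\<close>
  from it a lattice point is still at distance at least \<open>(k - 1/2) \<surd>\<pi> \<ge> k \<surd>\<pi> / 2\<close> from \<open>z\<close>.
\<close>

lemma height_near_le: "sqrt pi / 2 * height (p - near_idx z) \<le> cmod (gauss_pt p - z)"
proof (cases "height (p - near_idx z) = 0")
  case False
  let ?d = "gauss_pt p - near z"
  have d: "?d = gauss_pt (p - near_idx z)" by (simp add: near_def gauss_pt_diff)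
  have Re: "\<bar>Re ?d\<bar> \<le> cmod (gauss_pt p - z) + sqrt pi / 2"
    using near_close(1)[of z] abs_Re_le_cmod[of "gauss_pt p - z"] unfolding minus_complex.sel by linarith
  have Im: "\<bar>Im ?d\<bar> \<le> cmod (gauss_pt p - z) + sqrt pi / 2"
    using near_close(2)[of z] abs_Im_le_cmod[of "gauss_pt p - z"] unfolding minus_complex.sel by linarith
  have "sqrt pi * height (p - near_idx z) = max \<bar>Re ?d\<bar> \<bar>Im ?d\<bar>"
    by (auto simp: d Re_gauss_pt Im_gauss_pt height_def abs_mult max_def)
  hence "sqrt pi * height (p - near_idx z) \<le> cmod (gauss_pt p - z) + sqrt pi / 2" using Re Im by auto
  moreover have "sqrt pi / 2 * 1 \<le> sqrt pi / 2 * height (p - near_idx z)"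
    using False by (intro mult_left_mono) auto
  ultimately show ?thesis by linarith
qed auto

text \<open>
  The discrete form of \<open>\<integral> dA / \<bar>w\<bar> = O(R) over \<bar>w\<bar> < R\<close>, uniform in the centre once the lattice point that may be
  arbitrarily close to it is left out: each ring contributes a bounded amount.
\<close>

lemma sum_inverse_dist_le:
  assumes T: "finite T" "T \<subseteq> sq_lattice - {near z}" "\<And>l. l \<in> T \<Longrightarrow> cmod (l - z) \<le> R" and R0: "0 \<le> R"
  shows "(\<Sum>l\<in>T. 1 / cmod (l - z)) \<le> 16 * R"
proof -
  have R: "0 \<le> R" using R0 .
  define T' where "T' = gauss_pt -` T"
  have TT: "T = gauss_pt ` T'" using T(2) by (auto simp: T'_def sq_lattice_eq)
  have fin: "finite T'" unfolding T'_def using T(1) inj_gauss_pt by (rule finite_vimageI)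
  have h1: "1 \<le> height (p - near_idx z)" if "p \<in> T'" for p
  proof -
    have "p \<noteq> near_idx z" using that T(2) by (auto simp: T'_def near_def)
    thus ?thesis by (auto simp: height_def prod_eq_iff)
  qed
  define M where "M = nat \<lfloor>2 * R / sqrt pi\<rfloor>"
  have h2: "height (p - near_idx z) \<le> M" if "p \<in> T'" for p
  proof -
    have "sqrt pi / 2 * height (p - near_idx z) \<le> R"
      using height_near_le[of p z] T(3)[of "gauss_pt p"] that by (simp add: T'_def)
    hence "real (height (p - near_idx z)) \<le> 2 * R / sqrt pi" by (simp add: field_simps)
    thus ?thesis unfolding M_def by linarith
  qed
  have "(\<Sum>l\<in>T. 1 / cmod (l - z)) = (\<Sum>p\<in>T'. 1 / cmod (gauss_pt p - z))"
    unfolding TT using inj_gauss_pt by (subst sum.reindex) (auto intro: inj_on_subset)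
  also have "\<dots> \<le> (\<Sum>p\<in>T'. 2 / (sqrt pi * height (p - near_idx z)))"
  proof (rule sum_mono)
    fix p assume p: "p \<in> T'"
    have "0 < sqrt pi / 2 * height (p - near_idx z)" using h1[OF p] by simp
    hence "1 / cmod (gauss_pt p - z) \<le> 1 / (sqrt pi / 2 * height (p - near_idx z))"
      using height_near_le[of p z] by (intro divide_left_mono mult_pos_pos[of "cmod (gauss_pt p - z)"]) linarith+
    thus "1 / cmod (gauss_pt p - z) \<le> 2 / (sqrt pi * height (p - near_idx z))" by simp
  qed
  also have "\<dots> \<le> (\<Sum>m=1..M. 12 * real m * (2 / (sqrt pi * m)))"
    by (rule sum_over_rings_le[OF fin]) (use h1 h2 in auto)
  also have "\<dots> = (\<Sum>m=1..M. 24 / sqrt pi)"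
    by (intro sum.cong refl) (simp add: field_simps)
  also have "\<dots> = M * (24 / sqrt pi)" by simp
  also have "\<dots> \<le> (2 * R / sqrt pi) * (24 / sqrt pi)"
    using R by (intro mult_right_mono) (auto simp: M_def)
  also have "\<dots> = R * (48 / pi)" by (simp add: field_simps)
  also have "\<dots> \<le> R * 16"
    using R pi_gt3 by (intro mult_left_mono) (auto simp: field_simps)
  finally show ?thesis by simp
qed

lemma near_0 [simp]: "near 0 = 0" "near_idx 0 = (0,0)"
  by (auto simp: near_def near_idx_def)

lemma cmod_gauss_pt_bounds: "sqrt pi * height p \<le> cmod (gauss_pt p)" "cmod (gauss_pt p) \<le> 2 * sqrt pi * height p"
proof -
  have ReIm: "\<bar>Re (gauss_pt p)\<bar> = sqrt pi * \<bar>fst p\<bar>" "\<bar>Im (gauss_pt p)\<bar> = sqrt pi * \<bar>snd p\<bar>"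
    by (auto simp: Re_gauss_pt Im_gauss_pt abs_mult)
  have h: "real (height p) = max \<bar>fst p\<bar> \<bar>snd p\<bar>" by (simp add: height_def)
  have "sqrt pi * height p = max \<bar>Re (gauss_pt p)\<bar> \<bar>Im (gauss_pt p)\<bar>" 
    unfolding ReIm h by (auto simp: max_def)
  thus "sqrt pi * height p \<le> cmod (gauss_pt p)"
    using abs_Re_le_cmod[of "gauss_pt p"] abs_Im_le_cmod[of "gauss_pt p"] by simp
  have "cmod (gauss_pt p) \<le> sqrt pi * \<bar>fst p\<bar> + sqrt pi * \<bar>snd p\<bar>"
    using cmod_le[of "gauss_pt p"] unfolding ReIm .
  also have "\<dots> \<le> sqrt pi * height p + sqrt pi * height p"
    unfolding h by (intro add_mono mult_left_mono) auto
  finally show "cmod (gauss_pt p) \<le> 2 * sqrt pi * height p" by simp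
qed

lemma sum_inverse_square_tail:
  assumes "1 \<le> m0" shows "(\<Sum>m=m0..M. 1 / (real m)\<^sup>2) \<le> 2 / m0"
proof (cases "m0 \<le> M")
  case True
  have "(\<Sum>m=m0..M. 1 / (real m)\<^sup>2) \<le> (\<Sum>m=m0..M. 2 / real m - 2 / real (Suc m))"
  proof (rule sum_mono)
    fix m assume "m \<in> {m0..M}"
    hence "1 \<le> real m" using assms by simp
    thus "1 / (real m)\<^sup>2 \<le> 2 / real m - 2 / real (Suc m)"
      using mult_pos_pos[of "real m" "real m"] add_pos_pos[of "real m" "real m * real m"]
      by (simp add: field_simps power2_eq_square)
  qed
  also have "\<dots> = 2 / m0 - 2 / real (Suc M)"
    using sum_Suc_diff[of m0 "Suc M" "\<lambda>m. - 2 / real m"] True by (simp add: atLeastLessThanSuc_atLeastAtMost sum_Suc_diff)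
  finally show ?thesis by (smt (verit) divide_nonneg_nonneg of_nat_0_le_iff)
qed auto

text \<open>
  The discrete form of \<open>\<integral> dA / \<bar>w\<bar>\<^sup>3 = O(1 / R)\<close> over \<open>\<bar>w\<bar> > R\<close>.
\<close>

lemma sum_inverse_cube_tail_le:
  assumes T: "finite T" "T \<subseteq> sq_lattice" "\<And>l. l \<in> T \<Longrightarrow> R < cmod l" and R: "0 < R"
  shows "(\<Sum>l\<in>T. 1 / cmod l ^ 3) \<le> 16 / R"
proof -
  define T' where "T' = gauss_pt -` T"
  have TT: "T = gauss_pt ` T'" using T(2) by (auto simp: T'_def sq_lattice_eq)
  have fin: "finite T'" unfolding T'_def using T(1) inj_gauss_pt by (rule finite_vimageI)
  \<comment> \<open>A lattice point of height \<open>h\<close> has modulus at most \<open>2 h \<surd>\<pi>\<close>, so heights below \<open>m0\<close> do not occur.\<close>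
  define m0 where "m0 = nat \<lceil>R / (2 * sqrt pi)\<rceil>"
  have m0: "1 \<le> m0" using R by (simp add: m0_def Suc_le_eq)
  have m0R: "R / (2 * sqrt pi) \<le> m0" unfolding m0_def by linarith
  have h1: "m0 \<le> height p" if "p \<in> T'" for p
  proof -
    have "R < 2 * sqrt pi * height p"
      using T(3)[of "gauss_pt p"] cmod_gauss_pt_bounds(2)[of p] that by (auto simp: T'_def)
    hence "R / (2 * sqrt pi) \<le> height p" by (simp add: field_simps)
    thus ?thesis unfolding m0_def by linarith
  qed
  define M where "M = Max (height ` T')"
  have h2: "height p \<le> M" if "p \<in> T'" for p unfolding M_def using that fin by auto
  have "(\<Sum>l\<in>T. 1 / cmod l ^ 3) = (\<Sum>p\<in>T'. 1 / cmod (gauss_pt p) ^ 3)"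
    unfolding TT using inj_gauss_pt by (subst sum.reindex) (auto intro: inj_on_subset)
  also have "\<dots> \<le> (\<Sum>p\<in>T'. 1 / (sqrt pi * height (p - (0,0))) ^ 3)"
  proof (rule sum_mono)
    fix p assume p: "p \<in> T'"
    have h: "0 < sqrt pi * height p" using h1[OF p] m0 by simp
    hence "(sqrt pi * height p)^3 \<le> cmod (gauss_pt p)^3"
      using cmod_gauss_pt_bounds(1)[of p] by (intro power_mono) auto
    hence "1 / cmod (gauss_pt p)^3 \<le> 1 / (sqrt pi * height p)^3"
      using h zero_less_power[OF h, of 3] by (intro divide_left_mono mult_pos_pos) auto
    thus "1 / cmod (gauss_pt p)^3 \<le> 1 / (sqrt pi * height (p - (0,0))) ^ 3"
      by (simp flip: zero_prod_def)
  qed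
  also have "\<dots> \<le> (\<Sum>m=m0..M. 12 * real m * (1 / (sqrt pi * m) ^ 3))"
    by (rule sum_over_rings_le[OF fin]) (use h1 h2 m0 in \<open>auto simp flip: zero_prod_def\<close>)
  also have "\<dots> = (\<Sum>m=m0..M. 12 / (sqrt pi)^3 * (1 / (real m)\<^sup>2))"
    by (intro sum.cong refl) (simp add: power3_eq_cube power2_eq_square)
  also have "\<dots> = 12 / (sqrt pi)^3 * (\<Sum>m=m0..M. 1 / (real m)\<^sup>2)"
    by (simp only: sum_distrib_left)
  also have "\<dots> \<le> 12 / (sqrt pi)^3 * (2 / m0)"
    by (intro mult_left_mono sum_inverse_square_tail m0) auto
  also have "\<dots> \<le> 12 / (sqrt pi)^3 * (2 / (R / (2 * sqrt pi)))"
    using R m0R m0 by (intro mult_left_mono divide_left_mono) auto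
  also have "\<dots> = 48 / pi / R"
    using real_sqrt_pow2[of pi] by (simp add: field_simps power3_eq_cube)
  also have "\<dots> \<le> 16 / R" using R pi_gt3 by (intro divide_right_mono) (auto simp: field_simps)
  finally show ?thesis .
qed

section \<open>Dividing an entire function by finitely many of its zeros\<close>

definition zpoly :: "complex set \<Rightarrow> (complex \<Rightarrow> nat) \<Rightarrow> complex \<Rightarrow> complex" where
  "zpoly S n w = (\<Prod>x\<in>S. (w - x) ^ n x)"

lemma zpoly_holomorphic [holomorphic_intros]: "zpoly S n holomorphic_on X"
  unfolding zpoly_def [abs_def] by (intro holomorphic_intros)

lemma zpoly_eq_0_iff: "finite S \<Longrightarrow> zpoly S n w = 0 \<longleftrightarrow> w \<in> S \<and> n w > 0"
  by (auto simp: zpoly_def)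

lemma entire_eventually_nonzero:
  assumes "g holomorphic_on UNIV" "\<exists>z. g z \<noteq> (0::complex)"
  shows "eventually (\<lambda>w. g w \<noteq> 0) (at z)"
proof -
  obtain b where "g b \<noteq> 0" using assms by auto
  show ?thesis
    using non_zero_neighbour_alt[OF assms(1) open_UNIV connected_UNIV _ _ \<open>g b \<noteq> 0\<close>, of z]
    by (auto elim: eventually_mono)
qed

lemma entire_analytic: "g holomorphic_on UNIV \<Longrightarrow> g analytic_on X"
  using analytic_on_open analytic_on_subset by blast

lemma zorder_linear_power: "zorder (\<lambda>w. (w - x) ^ n) z = (if z = x then int n else 0)"
proof (cases "z = x")
  case True
  have "zorder (\<lambda>w. (w - x) ^ n) x = int n"
    by (rule zorder_eqI[of UNIV _ "\<lambda>_. 1"]) (auto intro!: holomorphic_intros simp: power_int_def)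
  thus ?thesis using True by simp
next
  case False
  thus ?thesis by (auto intro!: zorder_eq_0I analytic_intros)
qed

lemma zorder_mult_entire:
  assumes "f holomorphic_on UNIV" "g holomorphic_on UNIV" "\<exists>z. f z \<noteq> 0" "\<exists>z. g z \<noteq> 0"
  shows "zorder (\<lambda>w. f w * g w) z = zorder f z + zorder g z"
proof (rule zorder_times_analytic)
  show "eventually (\<lambda>z. f z * g z \<noteq> 0) (at z)"
    using entire_eventually_nonzero[OF assms(1,3), of z] entire_eventually_nonzero[OF assms(2,4), of z]
    by eventually_elim auto
qed (use assms in \<open>auto intro: entire_analytic\<close>)

lemma zorder_zpoly:
  assumes "finite S"
  shows "zorder (zpoly S n) z = (if z \<in> S then int (n z) else 0)"
proof -
  have ent: "zpoly S n holomorphic_on UNIV" by (rule zpoly_holomorphic)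
  have nz: "\<exists>w. zpoly S n w \<noteq> 0"
    using assms ex_new_if_finite[OF infinite_UNIV_char_0 assms] by (auto simp: zpoly_eq_0_iff)
  have "zorder (\<lambda>w. \<Prod>x\<in>S. (w - x) ^ n x) z = (\<Sum>x\<in>S. zorder (\<lambda>w. (w - x) ^ n x) z)"
    by (rule zorder_prod_analytic)
       (use entire_eventually_nonzero[OF ent nz, of z] in \<open>auto intro!: analytic_intros simp: zpoly_def\<close>)
  also have "\<dots> = (\<Sum>x\<in>S. if z = x then int (n x) else 0)"
    by (simp add: zorder_linear_power)
  also have "\<dots> = (if z \<in> S then int (n z) else 0)"
    using assms by (simp add: sum.delta)
  finally show ?thesis by (simp add: zpoly_def [abs_def])
qed

lemma zorder_entire_nonneg:
  assumes "g holomorphic_on UNIV" "\<exists>z. g z \<noteq> 0"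
  shows "zorder g z \<ge> 0"
  by (intro zorder_ge_0 entire_analytic assms eventually_frequently entire_eventually_nonzero) auto

lemma entire_divide_power:
  assumes g: "g holomorphic_on UNIV" "\<exists>z. g z \<noteq> 0" and n: "int n \<le> zorder g x"
  shows "\<exists>h. h holomorphic_on UNIV \<and> (\<forall>w. g w = (w - x) ^ n * h w)"
  using n
proof (induction n)
  case 0
  thus ?case using g by (intro exI[of _ g]) auto
next
  case (Suc n)
  then obtain h where h: "h holomorphic_on UNIV" "\<And>w. g w = (w - x) ^ n * h w" by force
  have hnz: "\<exists>z. h z \<noteq> 0" using g(2) h(2) by auto
  have pnz: "\<exists>z. (z - x) ^ n \<noteq> 0" by (rule exI[of _ "x + 1"]) simp
  have "zorder g x = zorder (\<lambda>w. (w - x) ^ n * h w) x" using h(2) by presburger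
  also have "\<dots> = int n + zorder h x"
    using hnz pnz by (subst zorder_mult_entire) (auto intro!: holomorphic_intros h simp: zorder_linear_power)
  finally have "zorder h x > 0" using Suc.prems by simp
  hence hx: "h x = 0"
    using zorder_eq_0I[of h x] entire_analytic[OF h(1)] by force
  \<comment> \<open>Removing the singularity at \<open>x\<close>.\<close>
  define k where "k w = (if w = x then deriv h x else h w / (w - x))" for w
  have "k holomorphic_on UNIV"
    by (rule pole_theorem_open_0[OF h(1) open_UNIV]) (use hx in \<open>auto simp: k_def\<close>)
  moreover have "g w = (w - x) ^ Suc n * k w" for w
    using h(2)[of w] hx by (auto simp: k_def)
  ultimately show ?case by blast
qed

text \<open>
  Exact bookkeeping of orders under division; it serves both to remove prescribed zeros from the
  constructed function and to set up the Blaschke quotients.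
\<close>

lemma entire_divide_zeros:
  assumes g: "g holomorphic_on UNIV" "\<exists>z. g z \<noteq> 0"
    and S: "finite S" "\<And>x. x \<in> S \<Longrightarrow> int (n x) \<le> zorder g x"
  obtains h where "h holomorphic_on UNIV" "\<exists>z. h z \<noteq> 0" "\<And>w. g w = zpoly S n w * h w"
    "\<And>z. zorder h z = zorder g z - (if z \<in> S then int (n z) else 0)"
proof -
  have "\<exists>h. h holomorphic_on UNIV \<and> (\<forall>w. g w = zpoly S n w * h w)"
    using S
  proof (induction S)
    case empty
    thus ?case using g by (intro exI[of _ g]) (auto simp: zpoly_def)
  next
    case (insert x S)
    then obtain h where h: "h holomorphic_on UNIV" "\<And>w. g w = zpoly S n w * h w" by auto
    have hnz: "\<exists>z. h z \<noteq> 0" using g(2) h(2) by auto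
    have pnz: "\<exists>z. zpoly S n z \<noteq> 0" using g(2) h(2) by auto
    have "zorder g x = zorder (\<lambda>w. zpoly S n w * h w) x" using h(2) by presburger
    also have "\<dots> = zorder h x"
      using insert.hyps by (subst zorder_mult_entire[OF zpoly_holomorphic h(1) pnz hnz]) (simp add: zorder_zpoly)
    finally have "int (n x) \<le> zorder h x" using insert.prems[of x] by simp
    from entire_divide_power[OF h(1) hnz this]
    obtain k where k: "k holomorphic_on UNIV" "\<And>w. h w = (w - x) ^ n x * k w" by auto
    show ?case using insert.hyps k h
      by (intro exI[of _ k]) (auto simp: zpoly_def mult_ac)
  qed
  then obtain h where h: "h holomorphic_on UNIV" "\<And>w. g w = zpoly S n w * h w" by auto
  have hnz: "\<exists>z. h z \<noteq> 0" and pnz: "\<exists>z. zpoly S n z \<noteq> 0" using g(2) h(2) by auto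
  have "zorder h z = zorder g z - (if z \<in> S then int (n z) else 0)" for z
  proof -
    have "zorder g z = zorder (\<lambda>w. zpoly S n w * h w) z" using h(2) by presburger
    also have "\<dots> = (if z \<in> S then int (n z) else 0) + zorder h z"
      by (subst zorder_mult_entire[OF zpoly_holomorphic h(1) pnz hnz]) (simp add: zorder_zpoly S)
    finally show ?thesis by simp
  qed
  with h hnz that show ?thesis by blast
qed

lemma entire_zeros_finite:
  assumes "g holomorphic_on UNIV" "\<exists>z. g z \<noteq> (0::complex)" "\<And>z. (0::nat) < m z \<Longrightarrow> zorder g z \<ge> int (m z)"
  shows "finite {z. cmod z \<le> r \<and> m z > 0}"
proof -
  have "finite {z\<in>cball 0 r. g z = 0}"
  proof (cases "\<forall>z. g z \<noteq> 0")
    case False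
    show ?thesis
      by (rule holomorphic_compact_finite_zeros[OF assms(1)])
         (use assms(2) False in \<open>auto simp: constant_on_def\<close>, metis)
  qed auto
  moreover have "{z. cmod z \<le> r \<and> m z > 0} \<subseteq> {z\<in>cball 0 r. g z = 0}"
  proof safe
    fix z assume z: "cmod z \<le> r" "m z > 0"
    show "z \<in> cball 0 r" using z by simp
    show "g z = 0"
    proof (rule ccontr)
      assume "g z \<noteq> 0"
      hence "zorder g z = 0" by (intro zorder_eq_0I entire_analytic assms)
      thus False using assms(3)[OF z(2)] z(2) by simp
    qed
  qed
  ultimately show ?thesis using finite_subset by blast
qed

section \<open>Jensen's inequality\<close>

text \<open>
  The mean value inequality \<open>\<bar>h 0\<bar> \<le> mean \<bar>h\<bar>\<close> as a nonnegative integral, so that it can be compared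
  with circle means that are only known to be bounded by possibly infinite quantities.
\<close>

lemma circle_mean_ge:
  assumes h: "h holomorphic_on X" "open X" "cball 0 r \<subseteq> X" and r: "r > 0"
  shows "ennreal (2 * pi * cmod (h 0)) \<le> (\<integral>\<^sup>+t\<in>{0..2*pi}. ennreal (cmod (h (r * cis t))) \<partial>lborel)"
proof -
  have hol: "h holomorphic_on ball 0 r" "continuous_on (cball 0 r) h"
    using h by (auto intro!: holomorphic_on_subset[OF h(1)] continuous_on_subset[OF holomorphic_on_imp_continuous_on[OF h(1)]])
  have "((\<lambda>u. h u / (u - 0)) has_contour_integral (2 * of_real pi * \<i> * h 0)) (circlepath 0 r)"
    by (rule Cauchy_integral_circlepath) (use r hol in auto)
  hence "((\<lambda>t. h (r * cis t) / (r * cis t) * r * \<i> * cis t) has_integral (2 * of_real pi * \<i> * h 0)) {0..2*pi}"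
    unfolding circlepath_def by (subst (asm) has_contour_integral_part_circlepath_iff) auto
  moreover have "h (r * cis t) / (r * cis t) * r * \<i> * cis t = \<i> * h (r * cis t)" for t
    using r by (simp add: field_simps)
  ultimately have "((\<lambda>t. \<i> * h (r * cis t)) has_integral (2 * of_real pi * \<i> * h 0)) {0..2*pi}"
    by (simp only:)
  hence I: "integral {0..2*pi} (\<lambda>t. \<i> * h (r * cis t)) = 2 * of_real pi * \<i> * h 0"
    by (rule integral_unique)
  have mem: "r * cis t \<in> cball 0 r" for t using r by (simp add: norm_mult)
  have ch: "continuous_on {0..2*pi} (\<lambda>t. h (r * cis t))"
    by (rule continuous_on_compose2[OF hol(2)]) (use mem in \<open>auto intro!: continuous_intros\<close>)
  define F where "F t = cmod (h (r * cis t))" for t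
  have cF: "continuous_on {0..2*pi} F"
    unfolding F_def by (intro continuous_intros ch)
  have "2 * pi * cmod (h 0) = cmod (integral {0..2*pi} (\<lambda>t. \<i> * h (r * cis t)))"
    unfolding I by (simp add: norm_mult)
  also have "\<dots> \<le> integral {0..2*pi} F"
    by (rule integral_norm_bound_integral)
       (use ch cF in \<open>auto intro!: integrable_continuous_interval continuous_intros simp: F_def norm_mult\<close>)
  finally have "ennreal (2 * pi * cmod (h 0)) \<le> ennreal (integral {0..2*pi} F)"
    by (rule ennreal_leI)
  also have "\<dots> = (\<integral>\<^sup>+t\<in>{0..2*pi}. ennreal (F t) \<partial>lborel)"
    by (rule nn_integral_has_integral_lebesgue'[symmetric])
       (use cF in \<open>auto intro!: integrable_continuous_interval integrable_integral simp: F_def [abs_def]\<close>)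
  finally show ?thesis by (simp add: F_def)
qed

text \<open>
  The factors \<open>w - x\<close> reflected in the circle of radius \<open>r\<close>: they have the same modulus on the circle,
  but their zeros lie outside the open disc.
\<close>

definition blaschke :: "complex set \<Rightarrow> (complex \<Rightarrow> nat) \<Rightarrow> real \<Rightarrow> complex \<Rightarrow> complex" where
  "blaschke S n r w = (\<Prod>x\<in>S. ((of_real (r\<^sup>2) - cnj x * w) / of_real r) ^ n x)"

lemma blaschke_holomorphic [holomorphic_intros]: "r \<noteq> 0 \<Longrightarrow> blaschke S n r holomorphic_on X"
  unfolding blaschke_def [abs_def] by (intro holomorphic_intros) auto

lemma blaschke_on_circle:
  assumes "cmod w = r" "r > 0"
  shows "cmod (blaschke S n r w) = cmod (zpoly S n w)"
proof -
  have "cmod ((of_real (r\<^sup>2) - cnj x * w) / of_real r) = cmod (w - x)" for x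
  proof -
    have "complex_of_real (r\<^sup>2) = w * cnj w" using assms by (simp add: complex_norm_square[symmetric])
    hence "of_real (r\<^sup>2) - cnj x * w = w * cnj (w - x)" by (simp add: algebra_simps)
    hence "cmod (of_real (r\<^sup>2) - cnj x * w) = r * cmod (w - x)"
      using assms by (simp only: norm_mult complex_mod_cnj)
    thus ?thesis using assms by (simp add: norm_divide)
  qed
  thus ?thesis by (simp add: blaschke_def zpoly_def norm_power flip: prod_norm)
qed

text \<open>
  At the centre the exchange of \<open>w - x\<close> for its reflection multiplies the modulus by \<open>r / \<bar>x\<bar>\<close>.  This is
  how the Jensen sum enters.
\<close>

lemma blaschke_ratio_at_0:
  assumes "finite S" "0 \<notin> S" "r > 0"
  shows "cmod (blaschke S n r 0) = cmod (zpoly S n 0) * exp (\<Sum>x\<in>S. real (n x) * ln (r / cmod x))"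
proof -
  have "exp (\<Sum>x\<in>S. real (n x) * ln (r / cmod x)) = (\<Prod>x\<in>S. exp (real (n x) * ln (r / cmod x)))"
    by (rule exp_sum) fact
  also have "\<dots> = (\<Prod>x\<in>S. (r / cmod x) ^ n x)"
  proof (rule prod.cong)
    fix x assume "x \<in> S"
    hence "x \<noteq> 0" using assms(2) by auto
    hence "0 < r / cmod x" using assms(3) by simp
    thus "exp (real (n x) * ln (r / cmod x)) = (r / cmod x) ^ n x"
      by (simp add: exp_of_nat_mult)
  qed auto
  also have "cmod (zpoly S n 0) * \<dots> = (\<Prod>x\<in>S. cmod x ^ n x * (r / cmod x) ^ n x)"
    by (simp add: zpoly_def norm_power prod.distrib flip: prod_norm)
  also have "\<dots> = (\<Prod>x\<in>S. r ^ n x)"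
    using assms by (intro prod.cong refl) (auto simp flip: power_mult_distrib)
  also have "\<dots> = cmod (blaschke S n r 0)"
    using assms by (simp add: blaschke_def norm_power norm_divide power2_eq_square flip: prod_norm)
  finally show ?thesis by simp
qed

text \<open>
  Replace the zeros of \<open>g\<close> in the disc by Blaschke factors and apply the mean value inequality to the
  square of the resulting function; squaring in place of taking logarithms avoids all questions of
  integrability of \<open>log \<bar>g\<bar>\<close>.  A surplus of zeros over \<open>m\<close> only enlarges the circle
  integral when \<open>r \<ge> 1\<close>; the constant is built from the
  leading coefficient of \<open>g\<close> at the origin and hence independent of \<open>r\<close>.
\<close>

lemma jensen_inequality:
  assumes g: "g holomorphic_on UNIV" "\<exists>z. g z \<noteq> 0" and m: "\<And>z. int (m z) \<le> zorder g z"
  shows "\<exists>c>0. \<forall>r\<ge>1. ennreal (c * exp (2 * jensen_J m r))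
           \<le> (\<integral>\<^sup>+t\<in>{0..2*pi}. ennreal ((cmod (g (r * cis t)))\<^sup>2) \<partial>lborel)"
proof -
  define k where "k = nat (zorder g 0)"
  have k: "int k = zorder g 0" using zorder_entire_nonneg[OF g] by (simp add: k_def)
  obtain g1 where g1: "g1 holomorphic_on UNIV" "\<exists>z. g1 z \<noteq> 0" "\<And>w. g w = zpoly {0} (\<lambda>_. k) w * g1 w"
    "\<And>z. zorder g1 z = zorder g z - (if z \<in> {0} then int k else 0)"
  proof (rule entire_divide_zeros[OF g, of "{0}" "\<lambda>_. k"])
    show "int k \<le> zorder g x" if "x \<in> {0}" for x using that k by simp
  qed (simp, rule that)
  have g1_0: "g1 0 \<noteq> 0"
  proof
    assume "g1 0 = 0"
    hence "zorder g1 0 > 0"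
      using zorder_pos_iff[OF g1(1) open_UNIV, of 0] entire_eventually_nonzero[OF g1(1,2), of 0]
      by (simp add: eventually_frequently)
    thus False using g1(4)[of 0] k by simp
  qed
  define c where "c = 2 * pi * (cmod (g1 0))\<^sup>2"
  have "ennreal (c * exp (2 * jensen_J m r))
          \<le> (\<integral>\<^sup>+t\<in>{0..2*pi}. ennreal ((cmod (g (r * cis t)))\<^sup>2) \<partial>lborel)" if r: "r \<ge> 1" for r
  proof -
    define S where "S = {z. 0 < cmod z \<and> cmod z \<le> r \<and> m z > 0}"
    have S: "finite S" "0 \<notin> S"
      using entire_zeros_finite[OF g, of m r] m by (auto simp: S_def intro: finite_subset[rotated])
    obtain h where h: "h holomorphic_on UNIV" "\<And>w. g1 w = zpoly S m w * h w"
    proof (rule entire_divide_zeros[OF g1(1,2) S(1), of m])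
      show "int (m x) \<le> zorder g1 x" if "x \<in> S" for x using that S m[of x] by (auto simp: g1(4))
    qed auto
    \<comment> \<open>\<open>H\<close> has the modulus of \<open>g1\<close> on the circle, and at the centre it is larger by the factor \<open>exp\<close> of the Jensen sum.\<close>
    define H where "H w = h w * blaschke S m r w" for w
    have H: "H holomorphic_on UNIV" unfolding H_def [abs_def] using r h by (intro holomorphic_intros) auto
    define E where "E = exp (\<Sum>x\<in>S. real (m x) * ln (r / cmod x))"
    have H0: "cmod (H 0) = cmod (g1 0) * E"
      unfolding H_def h(2) norm_mult E_def using S r by (subst blaschke_ratio_at_0) auto
    have J: "exp (2 * jensen_J m r) = (r ^ m 0)\<^sup>2 * E\<^sup>2"
    proof -
      have "jensen_J m r = real (m 0) * ln r + (\<Sum>x\<in>S. real (m x) * ln (r / cmod x))"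
        by (simp add: jensen_J_def S_def)
      moreover have "exp (real (m 0) * ln r) = r ^ m 0" using r by (simp add: exp_of_nat_mult)
      ultimately show ?thesis by (simp only: exp_double exp_add power_mult_distrib E_def)
    qed
    have "ennreal (c * exp (2 * jensen_J m r)) = ennreal ((r ^ m 0)\<^sup>2) * ennreal (2 * pi * cmod ((\<lambda>w. (H w)\<^sup>2) 0))"
      unfolding J c_def H0 norm_power by (simp add: ennreal_mult[symmetric] power_mult_distrib mult_ac)
    also have "\<dots> \<le> ennreal ((r ^ m 0)\<^sup>2) * (\<integral>\<^sup>+t\<in>{0..2*pi}. ennreal (cmod ((H (r * cis t))\<^sup>2)) \<partial>lborel)"
      by (intro mult_left_mono circle_mean_ge[of _ UNIV] holomorphic_intros H) (use r in auto)
    also have "\<dots> = (\<integral>\<^sup>+t\<in>{0..2*pi}. ennreal ((r ^ m 0)\<^sup>2) * ennreal (cmod ((H (r * cis t))\<^sup>2)) \<partial>lborel)"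
    proof (subst nn_integral_cmult[symmetric])
      have "continuous_on UNIV (\<lambda>t. H (r * cis t))"
        by (rule continuous_on_compose2[OF holomorphic_on_imp_continuous_on[OF H]]) (auto intro!: continuous_intros)
      hence [measurable]: "(\<lambda>t. H (r * cis t)) \<in> borel_measurable borel"
        by (rule borel_measurable_continuous_onI)
      show "(\<lambda>t. ennreal (cmod ((H (r * cis t))\<^sup>2)) * indicator {0..2 * pi} t) \<in> borel_measurable lborel"
        by measurable
    qed (simp add: mult_ac)
    also have "\<dots> \<le> (\<integral>\<^sup>+t\<in>{0..2*pi}. ennreal ((cmod (g (r * cis t)))\<^sup>2) \<partial>lborel)"
    proof (intro nn_integral_mono mult_right_mono)
      fix t
      have n: "cmod (r * cis t) = r" using r by (simp add: norm_mult)
      have "cmod (H (r * cis t)) = cmod (g1 (r * cis t))"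
        unfolding H_def h(2) norm_mult using blaschke_on_circle[OF n] r by simp
      moreover have "m 0 \<le> k" using m[of 0] k by simp
      hence "r ^ m 0 \<le> r ^ k" using r by (intro power_increasing) auto
      ultimately have "r ^ m 0 * cmod (H (r * cis t)) \<le> cmod (g (r * cis t))"
        using r by (simp add: g1(3) zpoly_def norm_mult norm_power mult_right_mono)
      hence "(r ^ m 0 * cmod (H (r * cis t)))\<^sup>2 \<le> (cmod (g (r * cis t)))\<^sup>2"
        using r by (intro power_mono) auto
      thus "ennreal ((r ^ m 0)\<^sup>2) * ennreal (cmod ((H (r * cis t))\<^sup>2)) \<le> ennreal ((cmod (g (r * cis t)))\<^sup>2)"
        by (simp add: ennreal_mult[symmetric] power_mult_distrib norm_power ennreal_leI)
    qed auto
    finally show ?thesis .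
  qed
  moreover have "c > 0" using g1_0 by (simp add: c_def)
  ultimately show ?thesis by blast
qed

section \<open>Polar coordinates\<close>

lemma lborel_complex: "(lborel :: complex measure) = distr (lborel \<Otimes>\<^sub>M lborel) borel (\<lambda>(x,y). Complex x y)"
proof (rule lborel_eqI)
  have [measurable]: "(\<lambda>(x,y). Complex x y) \<in> borel_measurable (borel \<Otimes>\<^sub>M borel)"
    unfolding borel_prod by (rule borel_measurable_continuous_onI) (auto simp: case_prod_beta Complex_eq intro!: continuous_intros)
  fix l u :: complex
  assume le: "\<And>b. b \<in> Basis \<Longrightarrow> l \<bullet> b \<le> u \<bullet> b"
  have le': "Re l \<le> Re u" "Im l \<le> Im u" using le[of 1] le[of \<i>] by (auto simp: Basis_complex_def)
  have "emeasure (distr (lborel \<Otimes>\<^sub>M lborel) borel (\<lambda>(x,y). Complex x y)) (box l u)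
        = emeasure (lborel \<Otimes>\<^sub>M lborel) ((\<lambda>(x,y). Complex x y) -` box l u \<inter> space (lborel \<Otimes>\<^sub>M lborel))"
    by (rule emeasure_distr) auto
  also have "(\<lambda>(x,y). Complex x y) -` box l u \<inter> space (lborel \<Otimes>\<^sub>M lborel) = {Re l<..<Re u} \<times> {Im l<..<Im u}"
    by (auto simp: box_def Basis_complex_def space_pair_measure)
  also have "emeasure (lborel \<Otimes>\<^sub>M lborel) \<dots> = ennreal (Re u - Re l) * ennreal (Im u - Im l)"
    using le' by (subst lborel.emeasure_pair_measure_Times) auto
  also have "\<dots> = ennreal (\<Prod>b\<in>Basis. (u - l) \<bullet> b)"
    using le' by (simp add: Basis_complex_def ennreal_mult[symmetric])
  finally show "emeasure (distr (lborel \<Otimes>\<^sub>M lborel) borel (\<lambda>(x,y). Complex x y)) (box l u) = ennreal (\<Prod>b\<in>Basis. (u - l) \<bullet> b)" .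
qed auto

lemma nn_integral_complex:
  assumes [measurable]: "f \<in> borel_measurable borel"
  shows "(\<integral>\<^sup>+z. f z \<partial>(lborel :: complex measure)) = (\<integral>\<^sup>+x. \<integral>\<^sup>+y. f (Complex x y) \<partial>lborel \<partial>lborel)"
proof -
  have [measurable]: "(\<lambda>(x,y). Complex x y) \<in> borel_measurable (borel \<Otimes>\<^sub>M borel)"
    unfolding borel_prod by (rule borel_measurable_continuous_onI) (auto simp: case_prod_beta Complex_eq intro!: continuous_intros)
  show ?thesis
    unfolding lborel_complex
    by (subst nn_integral_distr) (auto simp: case_prod_beta' lborel.nn_integral_fst[symmetric])
qed

text \<open>
  The substitution \<open>\<theta> = arctan t\<close> on the whole line, by exhaustion with compact intervals.
\<close>

lemma nn_integral_arctan:
  assumes [measurable]: "\<phi> \<in> borel_measurable borel"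
  shows "(\<integral>\<^sup>+t. \<phi> (arctan t) * ennreal (1 / (1 + t\<^sup>2)) \<partial>lborel) = (\<integral>\<^sup>+\<theta>\<in>{-(pi/2)..pi/2}. \<phi> \<theta> \<partial>lborel)"
proof -
  have sub: "(\<integral>\<^sup>+\<theta>. \<phi> \<theta> * indicator {arctan (- real (Suc n))..arctan (real (Suc n))} \<theta> \<partial>lborel) =
        (\<integral>\<^sup>+t. \<phi> (arctan t) * ennreal (1 / (1 + t\<^sup>2)) * indicator {- real (Suc n)..real (Suc n)} t \<partial>lborel)" for n
    by (rule nn_integral_substitution_aux)
       (auto intro!: derivative_eq_intros continuous_intros simp: inverse_eq_divide add_nonneg_eq_0_iff)
  let ?A = "\<lambda>n. {- real (Suc n)..real (Suc n)}"
  let ?B = "\<lambda>n. {arctan (- real (Suc n))..arctan (real (Suc n))}"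
  have SUPA: "(SUP n. F t * indicator (?A n) t) = F t" for F :: "real \<Rightarrow> ennreal" and t
  proof (rule antisym)
    show "(SUP n. F t * indicator (?A n) t) \<le> F t"
      by (rule SUP_least) (auto simp: indicator_def)
    obtain n where "\<bar>t\<bar> \<le> real n" using real_arch_simple by blast
    hence "t \<in> ?A n" unfolding atLeastAtMost_iff of_nat_Suc by linarith
    hence "F t = F t * indicator (?A n) t" by (simp only: indicator_simps mult_1_right)
    thus "F t \<le> (SUP n. F t * indicator (?A n) t)" by (rule ord_eq_le_trans) (rule SUP_upper, rule UNIV_I)
  qed
  have SUPB: "(SUP n. \<phi> \<theta> * indicator (?B n) \<theta>) = \<phi> \<theta> * indicator {-(pi/2)<..<pi/2} \<theta>" for \<theta>
  proof (cases "\<theta> \<in> {-(pi/2)<..<pi/2}")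
    case True
    have *: "\<theta> \<in> ?B n \<longleftrightarrow> tan \<theta> \<in> ?A n" for n
    proof -
      have th: "\<theta> = arctan (tan \<theta>)" using True by (simp add: arctan_tan)
      show ?thesis by (subst th) (simp only: atLeastAtMost_iff arctan_le_iff)
    qed
    have "(SUP n. \<phi> \<theta> * indicator (?B n) \<theta>) = (SUP n. \<phi> \<theta> * indicator (?A n) (tan \<theta>))"
      unfolding indicator_def * ..
    also have "\<dots> = \<phi> \<theta>" using SUPA[of "\<lambda>_. \<phi> \<theta>" "tan \<theta>"] .
    finally show ?thesis using True by simp
  next
    case False
    have "\<theta> \<notin> ?B n" for n using arctan_lbound[of "- real (Suc n)"] arctan_ubound[of "real (Suc n)"] False by auto
    hence "indicator (?B n) \<theta> = (0::ennreal)" for n by (rule indicator_simps(2))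
    moreover have "indicator {-(pi/2)<..<pi/2} \<theta> = (0::ennreal)" using False by (rule indicator_simps(2))
    ultimately show ?thesis by (simp only: mult_zero_right SUP_const[OF UNIV_not_empty])
  qed
  have "(\<integral>\<^sup>+t. \<phi> (arctan t) * ennreal (1 / (1 + t\<^sup>2)) \<partial>lborel)
        = (\<integral>\<^sup>+t. (SUP n. \<phi> (arctan t) * ennreal (1 / (1 + t\<^sup>2)) * indicator (?A n) t) \<partial>lborel)"
    by (simp only: SUPA[of "\<lambda>t. \<phi> (arctan t) * ennreal (1 / (1 + t\<^sup>2))"])
  also have "\<dots> = (SUP n. \<integral>\<^sup>+t. \<phi> (arctan t) * ennreal (1 / (1 + t\<^sup>2)) * indicator (?A n) t \<partial>lborel)"
    by (rule nn_integral_monotone_convergence_SUP) (auto simp: incseq_def le_fun_def indicator_def)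
  also have "\<dots> = (SUP n. \<integral>\<^sup>+\<theta>. \<phi> \<theta> * indicator (?B n) \<theta> \<partial>lborel)"
    by (simp only: sub)
  also have "\<dots> = (\<integral>\<^sup>+\<theta>. (SUP n. \<phi> \<theta> * indicator (?B n) \<theta>) \<partial>lborel)"
  proof (rule nn_integral_monotone_convergence_SUP[symmetric])
    have "?B m \<subseteq> ?B n" if "m \<le> n" for m n
      using that arctan_monotone'[of "real (Suc m)" "real (Suc n)"] by (auto simp: arctan_minus simp del: of_nat_Suc)
    hence "indicator (?B m) \<theta> \<le> (indicator (?B n) \<theta> :: ennreal)" if "m \<le> n" for m n \<theta>
      using that by (intro indicator_leI) blast
    thus "incseq (\<lambda>n \<theta>. \<phi> \<theta> * indicator (?B n) \<theta>)"
      unfolding incseq_def le_fun_def by (intro allI impI mult_left_mono) auto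
  qed auto
  also have "\<dots> = (\<integral>\<^sup>+\<theta>. \<phi> \<theta> * indicator {-(pi/2)<..<pi/2} \<theta> \<partial>lborel)" by (simp only: SUPB)
  also have "\<dots> = (\<integral>\<^sup>+\<theta>\<in>{-(pi/2)..pi/2}. \<phi> \<theta> \<partial>lborel)"
  proof (rule nn_integral_cong_AE)
    show "AE x in lborel. \<phi> x * indicator {-(pi/2)<..<pi/2} x = \<phi> x * indicator {-(pi/2)..pi/2} x"
      using AE_lborel_singleton[of "pi/2"] AE_lborel_singleton[of "-(pi/2)"]
      by eventually_elim (auto simp: indicator_def)
  qed
  finally show ?thesis .
qed

lemma nn_integral_interval_shift:
  fixes a b c :: real
  assumes [measurable]: "\<phi> \<in> borel_measurable borel"
  shows "(\<integral>\<^sup>+t\<in>{a..b}. \<phi> (c + t) \<partial>lborel) = (\<integral>\<^sup>+t\<in>{c+a..c+b}. \<phi> t \<partial>lborel)"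
  by (subst (2) nn_integral_real_affine[where c=1 and t=c])
     (auto simp: indicator_def intro!: nn_integral_cong)

lemma nn_integral_interval_concat:
  fixes a b c :: real
  assumes [measurable]: "\<phi> \<in> borel_measurable borel" and "a \<le> b" "b \<le> (c::real)"
  shows "(\<integral>\<^sup>+t\<in>{a..b}. \<phi> t \<partial>lborel) + (\<integral>\<^sup>+t\<in>{b..c}. \<phi> t \<partial>lborel) = (\<integral>\<^sup>+t\<in>{a..c}. \<phi> t \<partial>lborel)"
proof (subst nn_integral_add[symmetric])
  show "(\<integral>\<^sup>+t. \<phi> t * indicator {a..b} t + \<phi> t * indicator {b..c} t \<partial>lborel) = (\<integral>\<^sup>+t\<in>{a..c}. \<phi> t \<partial>lborel)"
  proof (rule nn_integral_cong_AE)
    show "AE t in lborel. \<phi> t * indicator {a..b} t + \<phi> t * indicator {b..c} t = \<phi> t * indicator {a..c} t"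
      using AE_lborel_singleton[of b] by eventually_elim (use assms in \<open>auto simp: indicator_def\<close>)
  qed
qed auto

lemma circle_integral_quadrants:
  assumes [measurable]: "f \<in> borel_measurable borel"
  shows "(\<integral>\<^sup>+t\<in>{0..2*pi}. f (r * cis t) \<partial>lborel) =
         (\<Sum>k<4. \<integral>\<^sup>+t\<in>{0..pi/2}. f (r * (\<i> ^ k * cis t)) \<partial>lborel)"
proof -
  have [measurable]: "(\<lambda>t. f (r * cis t)) \<in> borel_measurable borel"
    by (intro measurable_compose[OF _ assms] borel_measurable_continuous_onI continuous_intros)
  have q: "(\<integral>\<^sup>+t\<in>{0..pi/2}. f (r * (\<i> ^ k * cis t)) \<partial>lborel) = (\<integral>\<^sup>+t\<in>{k*pi/2..Suc k*pi/2}. f (r * cis t) \<partial>lborel)" for k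
  proof -
    have "\<i> ^ k = cis (k * pi/2)" using Complex.DeMoivre[of "pi/2" k] by simp
    hence "\<i> ^ k * cis t = cis (k * pi/2 + t)" for t by (simp add: cis_mult)
    hence "(\<integral>\<^sup>+t\<in>{0..pi/2}. f (r * (\<i> ^ k * cis t)) \<partial>lborel) = (\<integral>\<^sup>+t\<in>{0..pi/2}. f (r * cis (k*pi/2 + t)) \<partial>lborel)"
      by (simp only:)
    also have "\<dots> = (\<integral>\<^sup>+t\<in>{k*pi/2+0..k*pi/2+pi/2}. f (r * cis t) \<partial>lborel)"
      by (rule nn_integral_interval_shift) measurable
    also have "k*pi/2+pi/2 = Suc k*pi/2" by (simp add: field_simps)
    finally show ?thesis by simp
  qed
  have "(\<integral>\<^sup>+t\<in>{0..n*pi/2}. f (r * cis t) \<partial>lborel) =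
        (\<Sum>k<n. \<integral>\<^sup>+t\<in>{0..pi/2}. f (r * (\<i> ^ k * cis t)) \<partial>lborel)" for n :: nat
  proof (induction n)
    case 0
    have "(\<integral>\<^sup>+t\<in>{0..(0::real)}. f (r * cis t) \<partial>lborel) = (\<integral>\<^sup>+t. 0 \<partial>(lborel :: real measure))"
      by (rule nn_integral_cong_AE, use AE_lborel_singleton[of "0::real"] in eventually_elim) auto
    thus ?case by simp
  next
    case (Suc n)
    have "(\<integral>\<^sup>+t\<in>{0..Suc n*pi/2}. f (r * cis t) \<partial>lborel) =
       (\<integral>\<^sup>+t\<in>{0..n*pi/2}. f (r * cis t) \<partial>lborel) + (\<integral>\<^sup>+t\<in>{n*pi/2..Suc n*pi/2}. f (r * cis t) \<partial>lborel)"
      by (rule nn_integral_interval_concat[symmetric])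
         (fact \<open>(\<lambda>t. f (r * cis t)) \<in> borel_measurable borel\<close>, auto simp: field_simps)
    thus ?case by (simp only: Suc q sum.lessThan_Suc)
  qed
  from this[of 4] show ?thesis by simp
qed

text \<open>
  Parametrise the plane by slope: \<open>y = x t\<close>, then \<open>x = r / \<surd>(1 + t\<^sup>2)\<close>, then \<open>t = tan \<theta>\<close>.  Each step is a
  one-dimensional substitution inside an iterated integral.  The result first comes with signed radii and
  half a circle of directions; splitting into quadrants folds the negative radii onto the other half.
\<close>

lemma nn_integral_polar:
  assumes [measurable]: "f \<in> borel_measurable borel"
  shows "(\<integral>\<^sup>+z. f z \<partial>(lborel :: complex measure)) =
    (\<integral>\<^sup>+r\<in>{0<..}. ennreal r * (\<integral>\<^sup>+t\<in>{0..2*pi}. f (of_real r * cis t) \<partial>lborel) \<partial>lborel)"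
proof -
  have "(\<integral>\<^sup>+z. f z \<partial>lborel) = (\<integral>\<^sup>+x. \<integral>\<^sup>+y. f (Complex x y) \<partial>lborel \<partial>lborel)"
    by (rule nn_integral_complex) fact
  also have "\<dots> = (\<integral>\<^sup>+x. \<integral>\<^sup>+t. ennreal \<bar>x\<bar> * f (of_real x * Complex 1 t) \<partial>lborel \<partial>lborel)"
  proof (rule nn_integral_cong_AE)
    have [measurable]: "(\<lambda>y. f (Complex x y)) \<in> borel_measurable borel" for x
      by (intro measurable_compose[OF _ assms] borel_measurable_continuous_onI) (auto simp: Complex_eq intro!: continuous_intros)
    have [measurable]: "(\<lambda>y. f (of_real x * Complex 1 y)) \<in> borel_measurable borel" for x
      by (intro measurable_compose[OF _ assms] borel_measurable_continuous_onI) (auto simp: Complex_eq intro!: continuous_intros)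
    show "AE x in lborel. (\<integral>\<^sup>+y. f (Complex x y) \<partial>lborel) = (\<integral>\<^sup>+t. ennreal \<bar>x\<bar> * f (of_real x * Complex 1 t) \<partial>lborel)"
      using AE_lborel_singleton[of "0::real"]
    proof eventually_elim
      fix x :: real assume "x \<noteq> 0"
      have "Complex x (0 + x * t) = of_real x * Complex 1 t" for t by (simp add: complex_eq_iff)
      thus "(\<integral>\<^sup>+y. f (Complex x y) \<partial>lborel) = (\<integral>\<^sup>+t. ennreal \<bar>x\<bar> * f (of_real x * Complex 1 t) \<partial>lborel)"
        using \<open>x \<noteq> 0\<close> by (subst nn_integral_real_affine[where c=x and t=0]) (auto simp: nn_integral_cmult)
    qed
  qed
  also have "\<dots> = (\<integral>\<^sup>+t. \<integral>\<^sup>+x. ennreal \<bar>x\<bar> * f (of_real x * Complex 1 t) \<partial>lborel \<partial>lborel)"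
  proof (rule lborel_pair.Fubini'[symmetric])
    have [measurable]: "(\<lambda>p. f (of_real (fst p) * Complex 1 (snd p))) \<in> borel_measurable (borel \<Otimes>\<^sub>M borel)"
      unfolding borel_prod by (intro measurable_compose[OF _ assms] borel_measurable_continuous_onI) (auto simp: Complex_eq intro!: continuous_intros)
    show "(\<lambda>(x, t). ennreal \<bar>x\<bar> * f (of_real x * Complex 1 t)) \<in> borel_measurable (lborel \<Otimes>\<^sub>M lborel)"
      unfolding case_prod_beta' by measurable
  qed
  also have "\<dots> = (\<integral>\<^sup>+t. \<integral>\<^sup>+r. ennreal \<bar>r\<bar> * (f (of_real r * cis (arctan t)) * ennreal (1 / (1 + t\<^sup>2))) \<partial>lborel \<partial>lborel)"
  proof (rule nn_integral_cong)
    fix t :: real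
    have [measurable]: "(\<lambda>x. f (of_real x * w)) \<in> borel_measurable borel" for w
      by (intro measurable_compose[OF _ assms] borel_measurable_continuous_onI) (auto intro!: continuous_intros)
    define s where "s = sqrt (1 + t\<^sup>2)"
    have s: "s > 0" "s * s = 1 + t\<^sup>2" unfolding s_def by (auto simp: add_pos_nonneg)
    have c: "of_real (0 + (1/s) * r) * Complex 1 t = of_real r * cis (arctan t)" for r
      using s(1) by (simp add: complex_eq_iff cos_arctan sin_arctan s_def[symmetric])
    have "(\<integral>\<^sup>+x. ennreal \<bar>x\<bar> * f (of_real x * Complex 1 t) \<partial>lborel)
       = ennreal \<bar>1/s\<bar> * (\<integral>\<^sup>+r. ennreal \<bar>0 + (1/s) * r\<bar> * f (of_real (0 + (1/s) * r) * Complex 1 t) \<partial>lborel)"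
      by (rule nn_integral_real_affine) (use s in auto)
    also have "\<dots> = (\<integral>\<^sup>+r. ennreal \<bar>1/s\<bar> * (ennreal \<bar>0 + (1/s) * r\<bar> * f (of_real r * cis (arctan t))) \<partial>lborel)"
      unfolding c by (rule nn_integral_cmult[symmetric]) measurable
    also have "\<dots> = (\<integral>\<^sup>+r. ennreal \<bar>r\<bar> * (f (of_real r * cis (arctan t)) * ennreal (1 / (1 + t\<^sup>2))) \<partial>lborel)"
    proof (rule nn_integral_cong)
      fix r
      have "ennreal \<bar>1/s\<bar> * ennreal \<bar>0 + (1/s) * r\<bar> = ennreal \<bar>r\<bar> * ennreal (1 / (1 + t\<^sup>2))"
        using s by (simp add: ennreal_mult[symmetric] abs_mult s(2)[symmetric])
      thus "ennreal \<bar>1/s\<bar> * (ennreal \<bar>0 + (1/s) * r\<bar> * f (of_real r * cis (arctan t))) =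
         ennreal \<bar>r\<bar> * (f (of_real r * cis (arctan t)) * ennreal (1 / (1 + t\<^sup>2)))"
        by (metis mult.assoc mult.commute)
    qed
    finally show "(\<integral>\<^sup>+x. ennreal \<bar>x\<bar> * f (of_real x * Complex 1 t) \<partial>lborel) =
      (\<integral>\<^sup>+r. ennreal \<bar>r\<bar> * (f (of_real r * cis (arctan t)) * ennreal (1 / (1 + t\<^sup>2))) \<partial>lborel)" .
  qed
  also have "\<dots> = (\<integral>\<^sup>+r. \<integral>\<^sup>+t. ennreal \<bar>r\<bar> * (f (of_real r * cis (arctan t)) * ennreal (1 / (1 + t\<^sup>2))) \<partial>lborel \<partial>lborel)"
  proof (rule lborel_pair.Fubini')
    have [measurable]: "(\<lambda>p. f (of_real (fst p) * cis (arctan (snd p)))) \<in> borel_measurable (borel \<Otimes>\<^sub>M borel)"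
      unfolding borel_prod by (intro measurable_compose[OF _ assms] borel_measurable_continuous_onI) (auto intro!: continuous_intros)
    show "(\<lambda>(r, t). ennreal \<bar>r\<bar> * (f (of_real r * cis (arctan t)) * ennreal (1 / (1 + t\<^sup>2)))) \<in> borel_measurable (lborel \<Otimes>\<^sub>M lborel)"
      unfolding case_prod_beta' by measurable
  qed
  also have "\<dots> = (\<integral>\<^sup>+r. ennreal \<bar>r\<bar> * (\<integral>\<^sup>+\<theta>\<in>{-(pi/2)..pi/2}. f (of_real r * cis \<theta>) \<partial>lborel) \<partial>lborel)"
  proof (rule nn_integral_cong)
    fix r
    have [measurable]: "(\<lambda>t. f (of_real r * cis t)) \<in> borel_measurable borel"
      by (intro measurable_compose[OF _ assms] borel_measurable_continuous_onI continuous_intros)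
    have [measurable]: "(\<lambda>t. f (of_real r * cis (arctan t))) \<in> borel_measurable borel"
      by (intro measurable_compose[OF _ assms] borel_measurable_continuous_onI continuous_intros)
    show "(\<integral>\<^sup>+t. ennreal \<bar>r\<bar> * (f (of_real r * cis (arctan t)) * ennreal (1 / (1 + t\<^sup>2))) \<partial>lborel)
       = ennreal \<bar>r\<bar> * (\<integral>\<^sup>+\<theta>\<in>{-(pi/2)..pi/2}. f (of_real r * cis \<theta>) \<partial>lborel)"
      using nn_integral_arctan[of "\<lambda>\<theta>. f (of_real r * cis \<theta>)"] by (subst nn_integral_cmult) auto
  qed
  also have "\<dots> = (\<integral>\<^sup>+r\<in>{0<..}. ennreal r * (\<integral>\<^sup>+t\<in>{0..2*pi}. f (of_real r * cis t) \<partial>lborel) \<partial>lborel)"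
  proof -
    \<comment> \<open>Quadrant by quadrant.  A negative radius in quadrant 3 or 0 is a positive radius in quadrant 1 or 2.\<close>
    define Q where "Q k r = (\<integral>\<^sup>+t\<in>{0..pi/2}. f (complex_of_real r * (\<i> ^ k * cis t)) \<partial>lborel)" for k :: nat and r
    have [measurable]: "(\<lambda>p. f (complex_of_real (fst p) * (\<i> ^ k * cis (snd p)))) \<in> borel_measurable (borel \<Otimes>\<^sub>M borel)" for k
      unfolding borel_prod by (intro measurable_compose[OF _ assms] borel_measurable_continuous_onI) (auto intro!: continuous_intros)
    have [measurable]: "Q k \<in> borel_measurable borel" for k
      unfolding Q_def by measurable
    define G where "G r = ennreal \<bar>r\<bar> * (Q 3 r + Q 0 r)" for r
    have [measurable]: "G \<in> borel_measurable borel" unfolding G_def by measurable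
    have half: "(\<integral>\<^sup>+\<theta>\<in>{-(pi/2)..pi/2}. f (of_real r * cis \<theta>) \<partial>lborel) = Q 3 r + Q 0 r" for r
    proof -
      have [measurable]: "(\<lambda>t. f (of_real r * cis t)) \<in> borel_measurable borel"
        by (intro measurable_compose[OF _ assms] borel_measurable_continuous_onI continuous_intros)
      have rot: "\<i> ^ 3 * cis t = cis (-(pi/2) + t)" for t
        unfolding cis_mult[symmetric] by (simp add: complex_eq_iff power3_eq_cube)
      have "Q 3 r = (\<integral>\<^sup>+\<theta>\<in>{-(pi/2)+0..-(pi/2)+pi/2}. f (of_real r * cis \<theta>) \<partial>lborel)"
        unfolding Q_def rot by (rule nn_integral_interval_shift) measurable
      moreover have "Q 0 r = (\<integral>\<^sup>+\<theta>\<in>{0..pi/2}. f (of_real r * cis \<theta>) \<partial>lborel)"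
        by (simp add: Q_def)
      ultimately show ?thesis
        using nn_integral_interval_concat[of "\<lambda>t. f (r * cis t)" "-(pi/2)" 0 "pi/2"] by simp
    qed
    have sum4: "(\<Sum>k<4. F k) = F 0 + F 1 + F 2 + F (3::nat)" for F :: "nat \<Rightarrow> ennreal"
      by (simp add: eval_nat_numeral add_ac)
    have full: "(\<integral>\<^sup>+t\<in>{0..2*pi}. f (of_real r * cis t) \<partial>lborel) = Q 0 r + Q 1 r + Q 2 r + Q 3 r" for r
      unfolding circle_integral_quadrants[OF assms] Q_def[symmetric] sum4 ..
    have refl: "Q 3 (-r) = Q 1 r" "Q 0 (-r) = Q 2 r" for r
    proof -
      have "complex_of_real (-r) * (\<i> ^ 3 * w) = of_real r * (\<i> ^ 1 * w)"
           "complex_of_real (-r) * (\<i> ^ 0 * w) = of_real r * (\<i> ^ 2 * w)" for w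
        by (simp_all add: power3_eq_cube power2_eq_square)
      thus "Q 3 (-r) = Q 1 r" "Q 0 (-r) = Q 2 r" unfolding Q_def by (simp_all only:)
    qed
    have "(\<integral>\<^sup>+r. G r \<partial>lborel) = (\<integral>\<^sup>+r. G r * indicator {0<..} r + G r * indicator {..<0} r \<partial>lborel)"
    proof (rule nn_integral_cong_AE)
      show "AE r in lborel. G r = G r * indicator {0<..} r + G r * indicator {..<0} r"
        using AE_lborel_singleton[of "0::real"] by eventually_elim (auto simp: indicator_def)
    qed
    also have "\<dots> = (\<integral>\<^sup>+r. G r * indicator {0<..} r \<partial>lborel) + (\<integral>\<^sup>+r. G r * indicator {..<0} r \<partial>lborel)"
      by (rule nn_integral_add) auto
    also have "(\<integral>\<^sup>+r. G r * indicator {..<0} r \<partial>lborel) = (\<integral>\<^sup>+r. G (-r) * indicator {0<..} r \<partial>lborel)"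
      by (subst nn_integral_real_affine[where c="-1" and t=0]) (auto intro!: nn_integral_cong simp: indicator_def)
    also have "(\<integral>\<^sup>+r. G r * indicator {0<..} r \<partial>lborel) + \<dots> = (\<integral>\<^sup>+r. G r * indicator {0<..} r + G (-r) * indicator {0<..} r \<partial>lborel)"
      by (rule nn_integral_add[symmetric]) auto
    also have "\<dots> = (\<integral>\<^sup>+r\<in>{0<..}. ennreal r * (Q 0 r + Q 1 r + Q 2 r + Q 3 r) \<partial>lborel)"
      by (intro nn_integral_cong) (auto simp: indicator_def G_def refl distrib_left add_ac)
    finally show ?thesis unfolding half full G_def .
  qed
  finally show ?thesis .
qed

section \<open>The canonical product of a perturbed lattice\<close>

text \<open>
  Squares in place of discs: they are invariant under the rotation by \<open>\<i>\<close>, and shifting one by a period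
  exchanges a boundary column for the next one on the other side.
\<close>

definition lat_box :: "nat \<Rightarrow> complex set" where
  "lat_box N = gauss_pt ` {p. height p \<le> N}"

lemma finite_lat_box [simp]: "finite (lat_box N)"
  unfolding lat_box_def by (intro finite_imageI finite_height_le)

lemma lat_box_subset: "lat_box N \<subseteq> sq_lattice"
  by (auto simp: lat_box_def)

lemma eventually_in_lat_box:
  assumes "finite X" "X \<subseteq> sq_lattice"
  shows "eventually (\<lambda>N. X \<subseteq> lat_box N) sequentially"
proof -
  have "\<forall>l\<in>X. eventually (\<lambda>N. l \<in> lat_box N) sequentially"
  proof
    fix l assume "l \<in> X"
    then obtain p where p: "l = gauss_pt p" using assms by (auto simp: sq_lattice_eq)
    show "eventually (\<lambda>N. l \<in> lat_box N) sequentially"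
      using eventually_ge_at_top[of "height p"] by eventually_elim (auto simp: p lat_box_def)
  qed
  hence "eventually (\<lambda>N. \<forall>l\<in>X. l \<in> lat_box N) sequentially"
    using assms(1) by (simp add: eventually_ball_finite)
  thus ?thesis by (rule eventually_mono) auto
qed

lemma finite_lattice_disc: "finite {l\<in>sq_lattice. cmod l \<le> R}"
proof -
  have "{l\<in>sq_lattice. cmod l \<le> R} \<subseteq> lat_box (nat \<lceil>R\<rceil>)"
  proof safe
    fix l assume "l \<in> sq_lattice" "cmod l \<le> R"
    then obtain p where p: "l = gauss_pt p" by (auto simp: sq_lattice_eq)
    have "1 * real (height p) \<le> sqrt pi * real (height p)" using sqrt_pi_bounds(1) by (intro mult_right_mono) linarith+
    also have "\<dots> \<le> R" using cmod_gauss_pt_bounds(1)[of p] \<open>cmod l \<le> R\<close> p by simp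
    finally have "height p \<le> nat \<lceil>R\<rceil>" by linarith
    thus "l \<in> lat_box (nat \<lceil>R\<rceil>)" by (auto simp: lat_box_def p)
  qed
  thus ?thesis by (rule finite_subset) simp
qed

lemma box_times_i: "(\<lambda>l. \<i> * l) ` lat_box N = lat_box N" and box_uminus: "uminus ` lat_box N = lat_box N"
proof -
  have i: "\<i> * gauss_pt p = gauss_pt (- snd p, fst p)" for p
    by (simp add: gauss_pt_def algebra_simps)
  have sub: "(\<lambda>l. \<i> * l) ` lat_box N \<subseteq> lat_box N"
    by (auto simp: lat_box_def i height_def max.commute)
  show 1: "(\<lambda>l. \<i> * l) ` lat_box N = lat_box N"
    by (rule card_subset_eq[OF finite_lat_box sub]) (rule card_image, simp add: inj_on_def)
  have "uminus ` lat_box N = (\<lambda>l. \<i> * l) ` (\<lambda>l. \<i> * l) ` lat_box N"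
    by (simp add: image_image flip: mult.assoc)
  thus "uminus ` lat_box N = lat_box N" by (simp only: 1)
qed

lemma box_sum_inverse_eq_0: "(\<Sum>l\<in>lat_box N - {0}. 1 / l) = 0"
proof -
  have "(\<Sum>l\<in>lat_box N - {0}. 1 / l) = (\<Sum>l\<in>uminus ` (lat_box N - {0}). 1 / l)"
    by (subst image_set_diff) (auto simp: inj_on_def box_uminus)
  also have "\<dots> = (\<Sum>l\<in>lat_box N - {0}. 1 / (-l))" by (subst sum.reindex) (auto simp: inj_on_def)
  also have "\<dots> = - (\<Sum>l\<in>lat_box N - {0}. 1 / l)" by (simp add: sum_negf)
  finally show ?thesis by simp
qed

text \<open>
  The rotation by \<open>\<i>\<close> turns \<open>1 / l\<^sup>2\<close> into its negative.  This symmetry removes the quadratic term from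
  the convergence factors and is what makes the square summation of \<open>\<sigma>\<close> the right normalisation.
\<close>

lemma box_sum_inverse_square_eq_0: "(\<Sum>l\<in>lat_box N - {0}. 1 / l\<^sup>2) = 0"
proof -
  have "(\<Sum>l\<in>lat_box N - {0}. 1 / l\<^sup>2) = (\<Sum>l\<in>(\<lambda>l. \<i> * l) ` (lat_box N - {0}). 1 / l\<^sup>2)"
    by (subst image_set_diff) (auto simp: inj_on_def box_times_i)
  also have "\<dots> = (\<Sum>l\<in>lat_box N - {0}. 1 / (\<i> * l)\<^sup>2)" by (subst sum.reindex) (auto simp: inj_on_def)
  also have "\<dots> = - (\<Sum>l\<in>lat_box N - {0}. 1 / l\<^sup>2)" by (simp add: sum_negf power_mult_distrib)
  finally show ?thesis by simp
qed

lemma cmod_lattice_ge: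
  assumes "l \<in> sq_lattice" "l \<noteq> 0" shows "1.7 < cmod l"
proof -
  obtain p where p: "l = gauss_pt p" using assms by (auto simp: sq_lattice_eq)
  have "p \<noteq> (0,0)" using assms p by auto
  hence "1 \<le> height p" by (cases p) (auto simp: height_def)
  hence "sqrt pi * 1 \<le> sqrt pi * real (height p)" by (intro mult_left_mono) auto
  thus ?thesis using cmod_gauss_pt_bounds(1)[of p] sqrt_pi_bounds(1) unfolding p by linarith
qed

lemma inverse_cube_summable_on: "(\<lambda>l. 1 / cmod l ^ 3) summable_on (sq_lattice - {0})"
proof (rule nonneg_bdd_above_summable_on)
  show "bdd_above (sum (\<lambda>l. 1 / cmod l ^ 3) ` {F. F \<subseteq> sq_lattice - {0} \<and> finite F})"
  proof (rule bdd_aboveI2)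
    fix T assume "T \<in> {F. F \<subseteq> sq_lattice - {0} \<and> finite F}"
    thus "(\<Sum>l\<in>T. 1 / cmod l ^ 3) \<le> 16 / 1"
      using cmod_lattice_ge by (intro sum_inverse_cube_tail_le) force+
  qed
qed auto

lemma prod_minus_one_le_exp:
  fixes f :: "'a \<Rightarrow> complex"
  assumes "finite X"
  shows "cmod ((\<Prod>k\<in>X. f k) - 1) \<le> exp (\<Sum>k\<in>X. cmod (f k - 1)) - 1"
  using assms
proof (induction X)
  case (insert x X)
  let ?P = "\<Prod>k\<in>X. f k" and ?E = "exp (\<Sum>k\<in>X. cmod (f k - 1))" and ?d = "cmod (f x - 1)"
  have P: "cmod ?P \<le> ?E"
    using norm_triangle_ineq[of "?P - 1" 1] insert.IH by simp
  have "cmod (f x * ?P - 1) = cmod ((f x - 1) * ?P + (?P - 1))" by (simp add: algebra_simps)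
  also have "\<dots> \<le> ?d * cmod ?P + cmod (?P - 1)"
    using norm_triangle_ineq[of "(f x - 1) * ?P" "?P - 1"] by (simp add: norm_mult)
  also have "\<dots> \<le> ?d * ?E + (?E - 1)"
    using P insert.IH by (intro add_mono mult_left_mono) auto
  also have "\<dots> = (1 + ?d) * ?E - 1" by (simp add: algebra_simps)
  also have "\<dots> \<le> exp ?d * ?E - 1" by (intro diff_right_mono mult_right_mono) auto
  finally show ?case using insert.hyps by (simp add: exp_add)
qed auto

text \<open>
  Absolutely convergent products may be evaluated along any exhaustion by finite sets: beyond a fixed
  initial segment the remaining factors multiply to \<open>1\<close> up to the exponential of a tail.
\<close>

lemma abs_convergent_prod_tendsto_exhaustion:
  fixes f :: "nat \<Rightarrow> complex"
  assumes f: "summable (\<lambda>k. cmod (f k - 1))" "f has_prod P"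
    and X: "\<And>N. finite (X N)" "\<And>k. eventually (\<lambda>N. k \<in> X N) sequentially"
  shows "(\<lambda>N. \<Prod>k\<in>X N. f k) \<longlonglongrightarrow> P"
proof -
  have lim: "(\<lambda>n. \<Prod>k<n. f k) \<longlonglongrightarrow> P"
    using has_prod_imp_tendsto'[OF f(2)] .
  have "(\<lambda>N. (\<Prod>k\<in>X N. f k) - P) \<longlonglongrightarrow> 0"
  proof (rule LIMSEQ_I)
    fix \<epsilon> :: real assume \<epsilon>: "\<epsilon> > 0"
    define T where "T n = (\<Sum>k. cmod (f (k + n) - 1))" for n
    have T: "T \<longlonglongrightarrow> 0" unfolding T_def using suminf_exist_split2[OF f(1)] .
    have "(\<lambda>n. cmod (\<Prod>k<n. f k) * (exp (T n) - 1)) \<longlonglongrightarrow> cmod P * (exp 0 - 1)"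
      by (intro tendsto_intros lim T)
    hence "eventually (\<lambda>n. cmod (\<Prod>k<n. f k) * (exp (T n) - 1) < \<epsilon> / 2) sequentially"
      using \<epsilon> by (intro order_tendstoD(2)[where y="cmod P * (exp 0 - 1)"]) auto
    moreover have "eventually (\<lambda>n. cmod ((\<Prod>k<n. f k) - P) < \<epsilon> / 2) sequentially"
      using \<epsilon> tendstoD[OF lim, of "\<epsilon>/2"] by (auto simp: dist_norm)
    ultimately have "eventually (\<lambda>n. cmod (\<Prod>k<n. f k) * (exp (T n) - 1) < \<epsilon> / 2 \<and> cmod ((\<Prod>k<n. f k) - P) < \<epsilon> / 2) sequentially"
      by eventually_elim auto
    then obtain n where n: "cmod (\<Prod>k<n. f k) * (exp (T n) - 1) < \<epsilon> / 2" "cmod ((\<Prod>k<n. f k) - P) < \<epsilon> / 2"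
      by (auto simp: eventually_sequentially)
    have "eventually (\<lambda>N. \<forall>k\<in>{..<n}. k \<in> X N) sequentially"
      using X(2) by (intro eventually_ball_finite) auto
    hence "eventually (\<lambda>N. norm ((\<Prod>k\<in>X N. f k) - P - 0) < \<epsilon>) sequentially"
    proof eventually_elim
      case (elim N)
      hence sub: "{..<n} \<subseteq> X N" by auto
      let ?Y = "X N - {..<n}"
      have "(\<Prod>k\<in>X N. f k) = (\<Prod>k\<in>?Y. f k) * (\<Prod>k<n. f k)"
        using prod.subset_diff[OF sub X(1)] .
      hence "(\<Prod>k\<in>X N. f k) - (\<Prod>k<n. f k) = (\<Prod>k<n. f k) * ((\<Prod>k\<in>?Y. f k) - 1)"
        by (simp add: algebra_simps)
      hence "cmod ((\<Prod>k\<in>X N. f k) - (\<Prod>k<n. f k)) = cmod (\<Prod>k<n. f k) * cmod ((\<Prod>k\<in>?Y. f k) - 1)"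
        by (simp only: norm_mult)
      also have "\<dots> \<le> cmod (\<Prod>k<n. f k) * (exp (T n) - 1)"
      proof (rule mult_left_mono)
        have "(\<Sum>k\<in>?Y. cmod (f k - 1)) = (\<Sum>k\<in>(\<lambda>k. k - n) ` ?Y. cmod (f (k + n) - 1))"
          by (subst sum.reindex) (auto simp: inj_on_def intro!: sum.cong)
        also have "\<dots> \<le> T n"
          unfolding T_def using X(1) f(1)
          by (intro sum_le_suminf) (auto simp: summable_iff_shift[of "\<lambda>k. cmod (f k - 1)"])
        finally show "cmod ((\<Prod>k\<in>?Y. f k) - 1) \<le> exp (T n) - 1"
          using prod_minus_one_le_exp[of ?Y f] X(1) by (smt (verit) exp_le_cancel_iff finite_Diff)
      qed auto
      finally have "cmod ((\<Prod>k\<in>X N. f k) - (\<Prod>k<n. f k)) < \<epsilon> / 2" using n by simp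
      moreover have "(\<Prod>k\<in>X N. f k) - P - 0 = ((\<Prod>k\<in>X N. f k) - (\<Prod>k<n. f k)) + ((\<Prod>k<n. f k) - P)" by simp
      ultimately show ?case
        using n(2) norm_triangle_ineq[of "(\<Prod>k\<in>X N. f k) - (\<Prod>k<n. f k)" "(\<Prod>k<n. f k) - P"] by (simp only:)
    qed
    thus "\<exists>n0. \<forall>n\<ge>n0. norm ((\<Prod>k\<in>X n. f k) - P - 0) < \<epsilon>" by (simp add: eventually_sequentially)
  qed
  thus ?thesis by (simp add: LIM_zero_iff)
qed

lemma box_sum_tendsto:
  fixes f :: "complex \<Rightarrow> complex"
  assumes "f summable_on (sq_lattice - A)"
  shows "(\<lambda>N. \<Sum>l\<in>lat_box N - A. f l) \<longlonglongrightarrow> infsum f (sq_lattice - A)"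
proof -
  have "(sum f \<longlongrightarrow> infsum f (sq_lattice - A)) (finite_subsets_at_top (sq_lattice - A))"
    using has_sum_infsum[OF assms] by (simp add: has_sum_def)
  moreover have "filterlim (\<lambda>N. lat_box N - A) (finite_subsets_at_top (sq_lattice - A)) sequentially"
    unfolding filterlim_finite_subsets_at_top
  proof safe
    fix X assume X: "finite X" "X \<subseteq> sq_lattice - A"
    hence "eventually (\<lambda>N. X \<subseteq> lat_box N) sequentially" by (intro eventually_in_lat_box) auto
    thus "eventually (\<lambda>N. finite (lat_box N - A) \<and> X \<subseteq> lat_box N - A \<and> lat_box N - A \<subseteq> sq_lattice - A) sequentially"
      by eventually_elim (use X lat_box_subset in auto)
  qed
  ultimately show ?thesis by (rule filterlim_compose)
qed

text \<open>
  The situation of the theorem with all exceptional labels collected in \<open>A\<close>.  The unperturbed lattice is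
  the instance with \<open>A = {0}\<close> and \<open>C = 0\<close>, so the sigma function is a special case of the product below.
\<close>

locale perturbed_lattice =
  fixes A :: "complex set" and \<mu> :: "complex \<Rightarrow> complex" and C :: real
  assumes A: "finite A" "A \<subseteq> sq_lattice" "0 \<in> A"
    and C: "0 \<le> C"
    and close: "\<And>l. l \<in> sq_lattice - A \<Longrightarrow> cmod (\<mu> l - l) \<le> C / (1 + cmod l)"
    and nonzero: "\<And>l. l \<in> sq_lattice - A \<Longrightarrow> \<mu> l \<noteq> 0"
begin

lemma close': assumes "l \<in> sq_lattice - A" shows "cmod (\<mu> l - l) \<le> C" "cmod (\<mu> l - l) \<le> C / cmod l"
proof -
  have l: "0 < 1 + cmod l" by (rule add_pos_nonneg) auto
  hence "C / (1 + cmod l) \<le> C / 1" using C by (intro divide_left_mono) auto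
  thus "cmod (\<mu> l - l) \<le> C" using close[OF assms] by simp
  have "l \<noteq> 0" using assms A by auto
  hence "C / (1 + cmod l) \<le> C / cmod l" using C l by (intro divide_left_mono) auto
  thus "cmod (\<mu> l - l) \<le> C / cmod l" using close[OF assms] by simp
qed

text \<open>
  Far out the perturbation is small compared with \<open>\<bar>l\<bar>\<close>; only finitely many labels remain, and for them
  the ratio is positive.
\<close>

lemma ex_lower_bound: "\<exists>\<delta>>0. \<forall>l\<in>sq_lattice - A. \<delta> * cmod l \<le> cmod (\<mu> l)"
proof -
  define E where "E = {l\<in>sq_lattice. cmod l \<le> 2 * C} - A"
  define \<delta> where "\<delta> = Min (insert (1/2) ((\<lambda>l. cmod (\<mu> l) / cmod l) ` E))"
  have finE: "finite E" unfolding E_def using finite_lattice_disc by auto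
  have E0: "l \<noteq> 0" if "l \<in> E" for l using that A by (auto simp: E_def)
  have pos: "\<delta> > 0" unfolding \<delta>_def using finE E0 nonzero by (subst Min_gr_iff) (auto simp: E_def)
  have "\<delta> * cmod l \<le> cmod (\<mu> l)" if l: "l \<in> sq_lattice - A" for l
  proof (cases "l \<in> E")
    case True
    hence "\<delta> \<le> cmod (\<mu> l) / cmod l" unfolding \<delta>_def using finE by (intro Min_le) auto
    thus ?thesis using E0[OF True] by (simp add: field_simps)
  next
    case False
    hence "2 * C < cmod l" using l by (auto simp: E_def)
    moreover have "cmod l \<le> cmod (\<mu> l) + cmod (\<mu> l - l)" by norm
    moreover have "\<delta> \<le> 1/2" unfolding \<delta>_def using finE by (intro Min_le) auto
    hence "\<delta> * cmod l \<le> 1/2 * cmod l" by (intro mult_right_mono) auto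
    ultimately show ?thesis using close'(1)[OF l] by linarith
  qed
  with pos show ?thesis by blast
qed

definition \<delta> :: real where "\<delta> = (SOME d. d > 0 \<and> (\<forall>l\<in>sq_lattice - A. d * cmod l \<le> cmod (\<mu> l)))"

lemma \<delta>: "\<delta> > 0" "\<And>l. l \<in> sq_lattice - A \<Longrightarrow> \<delta> * cmod l \<le> cmod (\<mu> l)"
  using someI_ex[OF ex_lower_bound[unfolded Bex_def]] unfolding \<delta>_def by auto

lemma lattice_nonzero: "l \<in> sq_lattice - A \<Longrightarrow> l \<noteq> 0"
  using A by auto

lemma inverse_diff_bound:
  assumes l: "l \<in> sq_lattice - A"
  shows "cmod (1 / \<mu> l - 1 / l) \<le> C / \<delta> * (1 / cmod l ^ 3)"
    and "cmod (1 / (\<mu> l)\<^sup>2 - 1 / l\<^sup>2) \<le> C / \<delta> * (1 / \<delta> + 1) * (1 / cmod l ^ 3)"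
proof -
  have l0: "cmod l > 0" using lattice_nonzero[OF l] by simp
  have l1: "1 \<le> cmod l" using cmod_lattice_ge[of l] l lattice_nonzero[OF l] by simp
  have m0: "cmod (\<mu> l) > 0" using nonzero[OF l] by simp
  have inv: "1 / cmod (\<mu> l) \<le> 1 / (\<delta> * cmod l)"
    using \<delta>(1) \<delta>(2)[OF l] l0 m0 by (intro divide_left_mono) auto
  have eq: "1 / \<mu> l - 1 / l = - (\<mu> l - l) * (1 / \<mu> l) * (1 / l)"
    using l0 m0 by (simp add: field_simps)
  have "cmod (1 / \<mu> l - 1 / l) = cmod (\<mu> l - l) * (1 / cmod (\<mu> l)) * (1 / cmod l)"
    unfolding eq by (simp only: norm_mult norm_divide norm_minus_cancel norm_one)
  also have "\<dots> \<le> (C / cmod l) * (1 / (\<delta> * cmod l)) * (1 / cmod l)"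
    using close'(2)[OF l] inv C \<delta>(1) by (intro mult_right_mono mult_mono) auto
  also have "\<dots> = C / \<delta> * (1 / cmod l ^ 3)" by (simp add: power3_eq_cube)
  finally show 1: "cmod (1 / \<mu> l - 1 / l) \<le> C / \<delta> * (1 / cmod l ^ 3)" .
  have "cmod (1 / \<mu> l + 1 / l) \<le> 1 / cmod (\<mu> l) + 1 / cmod l"
    by (rule norm_triangle_le) (simp add: norm_divide)
  also have "1 / cmod (\<mu> l) \<le> 1 / \<delta>"
  proof (rule order_trans[OF inv], rule divide_left_mono)
    show "\<delta> \<le> \<delta> * cmod l" using mult_left_mono[OF l1, of \<delta>] \<delta>(1) by simp
  qed (use \<delta>(1) l0 in auto)
  also have "1 / cmod l \<le> 1" using l1 l0 by (simp add: divide_le_eq)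
  finally have 2: "cmod (1 / \<mu> l + 1 / l) \<le> 1 / \<delta> + 1" by simp
  have "1 / (\<mu> l)\<^sup>2 - 1 / l\<^sup>2 = (1 / \<mu> l - 1 / l) * (1 / \<mu> l + 1 / l)"
    by (simp add: algebra_simps power2_eq_square)
  hence "cmod (1 / (\<mu> l)\<^sup>2 - 1 / l\<^sup>2) = cmod (1 / \<mu> l - 1 / l) * cmod (1 / \<mu> l + 1 / l)"
    by (simp only: norm_mult)
  also have "\<dots> \<le> C / \<delta> * (1 / cmod l ^ 3) * (1 / \<delta> + 1)"
    using 1 2 C \<delta>(1) by (intro mult_mono) auto
  finally show "cmod (1 / (\<mu> l)\<^sup>2 - 1 / l\<^sup>2) \<le> C / \<delta> * (1 / \<delta> + 1) * (1 / cmod l ^ 3)" by (simp add: mult_ac)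
qed

lemma summable_on_cube_bound:
  fixes f :: "complex \<Rightarrow> complex"
  assumes "\<And>l. l \<in> sq_lattice - A \<Longrightarrow> cmod (f l) \<le> K * (1 / cmod l ^ 3)"
  shows "f summable_on (sq_lattice - A)"
proof (rule abs_summable_summable, rule summable_on_comparison_test)
  show "(\<lambda>l. K * (1 / cmod l ^ 3)) summable_on (sq_lattice - A)"
    by (rule summable_on_subset_banach[OF summable_on_cmult_right[OF inverse_cube_summable_on]]) (use A in auto)
qed (use assms in auto)

text \<open>
  Neither sum converges absolutely.  The differences to the unperturbed sums do, by the cubic decay of
  the perturbation, and the unperturbed sums over squares vanish by symmetry.
\<close>

lemma box_sum_inverse_convergent:
  "convergent (\<lambda>N. \<Sum>l\<in>lat_box N - A. 1 / \<mu> l)" "convergent (\<lambda>N. \<Sum>l\<in>lat_box N - A. 1 / (\<mu> l)\<^sup>2)"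
proof -
  have gen: "convergent (\<lambda>N. \<Sum>l\<in>lat_box N - A. f (\<mu> l))"
    if f: "\<And>l. l \<in> sq_lattice - A \<Longrightarrow> cmod (f (\<mu> l) - f l) \<le> K * (1 / cmod l ^ 3)"
      and f0: "\<And>N. (\<Sum>l\<in>lat_box N - {0}. f l) = 0" for f :: "complex \<Rightarrow> complex" and K
  proof -
    have "(\<lambda>N. (\<Sum>l\<in>lat_box N - A. f (\<mu> l) - f l) - (\<Sum>l\<in>A - {0}. f l))
            \<longlonglongrightarrow> infsum (\<lambda>l. f (\<mu> l) - f l) (sq_lattice - A) - (\<Sum>l\<in>A - {0}. f l)"
      by (intro tendsto_intros box_sum_tendsto summable_on_cube_bound[of "\<lambda>l. f (\<mu> l) - f l" K] f)
    moreover have "eventually (\<lambda>N. (\<Sum>l\<in>lat_box N - A. f (\<mu> l) - f l) - (\<Sum>l\<in>A - {0}. f l) = (\<Sum>l\<in>lat_box N - A. f (\<mu> l))) sequentially"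
      using eventually_in_lat_box[OF A(1,2)]
    proof eventually_elim
      case (elim N)
      have "0 = (\<Sum>l\<in>(lat_box N - A) \<union> (A - {0}). f l)"
      proof -
        have "(lat_box N - A) \<union> (A - {0}) = lat_box N - {0}" using elim A(3) by auto
        thus ?thesis using f0[of N] by simp
      qed
      also have "\<dots> = (\<Sum>l\<in>lat_box N - A. f l) + (\<Sum>l\<in>A - {0}. f l)"
        by (rule sum.union_disjoint) (use A in auto)
      finally show ?case by (simp add: sum_subtractf algebra_simps)
    qed
    ultimately have "(\<lambda>N. \<Sum>l\<in>lat_box N - A. f (\<mu> l)) \<longlonglongrightarrow> infsum (\<lambda>l. f (\<mu> l) - f l) (sq_lattice - A) - (\<Sum>l\<in>A - {0}. f l)"
      by (rule Lim_transform_eventually)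
    thus ?thesis by (rule convergentI)
  qed
  show "convergent (\<lambda>N. \<Sum>l\<in>lat_box N - A. 1 / \<mu> l)"
    by (rule gen[of "\<lambda>w. 1 / w", OF inverse_diff_bound(1) box_sum_inverse_eq_0])
  show "convergent (\<lambda>N. \<Sum>l\<in>lat_box N - A. 1 / (\<mu> l)\<^sup>2)"
    by (rule gen[of "\<lambda>w. 1 / w\<^sup>2", OF inverse_diff_bound(2) box_sum_inverse_square_eq_0])
qed

text \<open>
  Start from the genus-two Weierstrass product, which supplies holomorphy and the orders of the zeros, and
  strip its convergence factors: their exponents converge along squares, so a single exponential
  of a quadratic polynomial remains.
\<close>

theorem canonical_product:
  obtains F where "F holomorphic_on UNIV" "\<And>z. zorder F z = int (card {l\<in>sq_lattice - A. \<mu> l = z})"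
    "\<And>z. (\<lambda>N. \<Prod>l\<in>lat_box N - A. 1 - z / \<mu> l) \<longlonglongrightarrow> F z"
proof -
  let ?I = "sq_lattice - A"
  have "infinite ?I" "countable ?I"
    using infinite_sq_lattice A(1) countable_sq_lattice by auto
  then obtain e where e: "bij_betw e (UNIV :: nat set) ?I"
    using bij_betw_from_nat_into by blast
  have eI: "e n \<in> ?I" for n using e by (auto simp: bij_betw_def)
  define a where "a n = \<mu> (e n)" for n
  have sum3: "summable (\<lambda>n. (r / cmod (a n)) ^ 3)" if "r > 0" for r
  proof -
    have "(\<lambda>l. (r / \<delta>) ^ 3 * (1 / cmod l ^ 3)) summable_on ?I"
      by (rule summable_on_subset_banach[OF summable_on_cmult_right[OF inverse_cube_summable_on]]) (use A in auto)
    hence "(\<lambda>n. (r / \<delta>) ^ 3 * (1 / cmod (e n) ^ 3)) summable_on UNIV"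
      using summable_on_reindex_bij_betw[OF e, of "\<lambda>l. (r / \<delta>) ^ 3 * (1 / cmod l ^ 3)"] by simp
    hence s: "summable (\<lambda>n. (r / \<delta>) ^ 3 * (1 / cmod (e n) ^ 3))"
      using that \<delta>(1) by (subst (asm) summable_on_UNIV_nonneg_real_iff) auto
    show ?thesis
    proof (rule summable_comparison_test_ev[OF always_eventually s], rule allI)
      fix n
      have "r / cmod (a n) \<le> r / (\<delta> * cmod (e n))"
        using that \<delta>(1) \<delta>(2)[OF eI[of n]] nonzero[OF eI[of n]] lattice_nonzero[OF eI[of n]] unfolding a_def
        by (intro divide_left_mono mult_pos_pos) auto
      hence "(r / cmod (a n)) ^ 3 \<le> (r / (\<delta> * cmod (e n))) ^ 3"
        using that by (intro power_mono) auto
      thus "norm ((r / cmod (a n)) ^ 3) \<le> (r / \<delta>) ^ 3 * (1 / cmod (e n) ^ 3)"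
        using that by (simp add: power_divide power_mult_distrib)
    qed
  qed
  have a0: "a n \<noteq> 0" for n using nonzero[OF eI] by (simp add: a_def)
  interpret W: weierstrass_product a "\<lambda>_. 2"
  proof
    show "a n \<noteq> 0" for n by (rule a0)
    show "summable (\<lambda>n. (r / norm (a n)) ^ Suc 2)" if "r > 0" for r
      using sum3[OF that] by (simp add: numeral_3_eq_3)
    show "filterlim a at_infinity sequentially"
      unfolding filterlim_at_infinity[OF order_refl]
    proof safe
      fix r :: real assume r: "r > 0"
      have "(\<lambda>n. (r / cmod (a n)) ^ 3) \<longlonglongrightarrow> 0" by (rule summable_LIMSEQ_zero[OF sum3[OF r]])
      hence "eventually (\<lambda>n. (r / cmod (a n)) ^ 3 < 1) sequentially" by (rule order_tendstoD) auto
      thus "eventually (\<lambda>n. r \<le> cmod (a n)) sequentially"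
      proof eventually_elim
        case (elim n)
        show ?case
        proof (rule ccontr)
          assume "\<not> r \<le> cmod (a n)"
          hence "1 \<le> r / cmod (a n)" using a0[of n] by (simp add: field_simps)
          hence "1 \<le> (r / cmod (a n)) ^ 3" by (rule one_le_power)
          thus False using elim by simp
        qed
      qed
    qed
  qed
  obtain \<alpha> \<beta> where \<alpha>: "(\<lambda>N. \<Sum>l\<in>lat_box N - A. 1 / \<mu> l) \<longlonglongrightarrow> \<alpha>" and \<beta>: "(\<lambda>N. \<Sum>l\<in>lat_box N - A. 1 / (\<mu> l)\<^sup>2) \<longlonglongrightarrow> \<beta>"
    using box_sum_inverse_convergent by (auto simp: convergent_def)
  define F where "F z = W.f z * exp (- (z * \<alpha> + z\<^sup>2 / 2 * \<beta>))" for z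
  have hol: "F holomorphic_on UNIV"
    unfolding F_def [abs_def] by (intro holomorphic_intros) auto
  have ord: "zorder F z = int (card {l\<in>?I. \<mu> l = z})" for z
  proof -
    have ev: "eventually (\<lambda>w. W.f w * exp (- (w * \<alpha> + w\<^sup>2 / 2 * \<beta>)) \<noteq> 0) (at z)"
    proof -
      have "eventually (\<lambda>w. w \<notin> range a) (at z)"
        using W.not_islimpt_range_a[of z] by (simp add: islimpt_iff_eventually)
      thus ?thesis by eventually_elim (simp add: W.zero)
    qed
    have "zorder F z = zorder W.f z + zorder (\<lambda>z. exp (- (z * \<alpha> + z\<^sup>2 / 2 * \<beta>))) z"
      unfolding F_def [abs_def] by (rule zorder_times_analytic) (use ev in \<open>auto intro!: analytic_intros W.analytic\<close>)
    also have "zorder (\<lambda>z. exp (- (z * \<alpha> + z\<^sup>2 / 2 * \<beta>))) z = 0"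
      by (rule zorder_eq_0I) (auto intro!: analytic_intros)
    also have "zorder W.f z = int (card (a -` {z}))" by (rule W.zorder)
    also have "card (a -` {z}) = card (e ` (a -` {z}))"
      using e by (intro card_image[symmetric]) (auto simp: bij_betw_def intro: inj_on_subset)
    also have "e ` (a -` {z}) = {l\<in>?I. \<mu> l = z}"
    proof
      show "{l\<in>?I. \<mu> l = z} \<subseteq> e ` (a -` {z})"
      proof safe
        fix l assume l: "l \<in> sq_lattice" "l \<notin> A"
        then obtain n where "l = e n" using e by (auto simp: bij_betw_def)
        thus "l \<in> e ` (a -` {\<mu> l})" by (auto simp: a_def)
      qed
    qed (use e in \<open>auto simp: a_def bij_betw_def\<close>)
    finally show ?thesis by simp
  qed
  have lim: "(\<lambda>N. \<Prod>l\<in>lat_box N - A. 1 - z / \<mu> l) \<longlonglongrightarrow> F z" for z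
  proof -
    define X where "X N = e -` (lat_box N - A)" for N
    have inje: "inj e" using e by (simp add: bij_betw_def)
    have eX: "e ` X N = lat_box N - A" for N
      using e lat_box_subset by (auto simp: X_def bij_betw_def image_vimage_eq)
    have fX: "finite (X N)" for N unfolding X_def by (rule finite_vimageI[OF _ inje]) simp
    have "(\<lambda>N. \<Prod>n\<in>X N. weierstrass_factor 2 (z / a n)) \<longlonglongrightarrow> W.f z"
    proof (rule abs_convergent_prod_tendsto_exhaustion[OF _ _ fX])
      show "summable (\<lambda>n. cmod (weierstrass_factor 2 (z / a n) - 1))"
        using W.abs_convergent[of z] by (simp add: abs_convergent_prod_conv_summable)
      show "(\<lambda>n. weierstrass_factor 2 (z / a n)) has_prod W.f z" by (rule W.has_prod)
      show "eventually (\<lambda>N. k \<in> X N) sequentially" for k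
        using eventually_in_lat_box[of "{e k}"] eI[of k] by (auto simp: X_def elim: eventually_mono)
    qed
    moreover have "(\<Prod>n\<in>X N. weierstrass_factor 2 (z / a n)) =
        (\<Prod>l\<in>lat_box N - A. 1 - z / \<mu> l) * exp (z * (\<Sum>l\<in>lat_box N - A. 1 / \<mu> l) + z\<^sup>2 / 2 * (\<Sum>l\<in>lat_box N - A. 1 / (\<mu> l)\<^sup>2))" for N
    proof -
      have "(\<Prod>n\<in>X N. weierstrass_factor 2 (z / a n)) = (\<Prod>l\<in>e ` X N. weierstrass_factor 2 (z / \<mu> l))"
        by (subst prod.reindex) (auto intro: inj_on_subset[OF inje] simp: a_def)
      also have "\<dots> = (\<Prod>l\<in>lat_box N - A. (1 - z / \<mu> l) * exp (z * (1 / \<mu> l) + z\<^sup>2 / 2 * (1 / (\<mu> l)\<^sup>2)))"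
        unfolding eX by (intro prod.cong refl) (simp add: weierstrass_factor_def numeral_2_eq_2 power_divide mult_ac)
      also have "\<dots> = (\<Prod>l\<in>lat_box N - A. 1 - z / \<mu> l) * exp (\<Sum>l\<in>lat_box N - A. z * (1 / \<mu> l) + z\<^sup>2 / 2 * (1 / (\<mu> l)\<^sup>2))"
        by (simp add: prod.distrib exp_sum)
      finally show ?thesis by (simp only: sum.distrib sum_distrib_left)
    qed
    ultimately have L: "(\<lambda>N. (\<Prod>l\<in>lat_box N - A. 1 - z / \<mu> l) * exp (z * (\<Sum>l\<in>lat_box N - A. 1 / \<mu> l) + z\<^sup>2 / 2 * (\<Sum>l\<in>lat_box N - A. 1 / (\<mu> l)\<^sup>2))) \<longlonglongrightarrow> W.f z"
      by simp
    have "(\<lambda>N. (\<Prod>l\<in>lat_box N - A. 1 - z / \<mu> l) * exp (z * (\<Sum>l\<in>lat_box N - A. 1 / \<mu> l) + z\<^sup>2 / 2 * (\<Sum>l\<in>lat_box N - A. 1 / (\<mu> l)\<^sup>2))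
            * exp (- (z * (\<Sum>l\<in>lat_box N - A. 1 / \<mu> l) + z\<^sup>2 / 2 * (\<Sum>l\<in>lat_box N - A. 1 / (\<mu> l)\<^sup>2)))) \<longlonglongrightarrow> F z"
      unfolding F_def by (intro tendsto_intros L \<alpha> \<beta>)
    thus ?thesis by (simp add: mult.assoc flip: exp_add)
  qed
  from that[OF hol ord lim] show ?thesis .
qed

end

section \<open>The Weierstrass sigma function of the square lattice\<close>

lemma perturbed_lattice_id: "perturbed_lattice {0} (\<lambda>l. l) 0"
  by unfold_locales (auto simp: sq_lattice_eq intro: exI[of _ "(0,0)"] range_eqI[of _ _ "(0,0)"])

definition is_sigma0 :: "(complex \<Rightarrow> complex) \<Rightarrow> bool" where
  "is_sigma0 S \<longleftrightarrow> S holomorphic_on UNIV \<and> (\<forall>z. zorder S z = (if z \<in> sq_lattice - {0} then 1 else 0)) \<and>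
     (\<forall>z. (\<lambda>N. \<Prod>l\<in>lat_box N - {0}. 1 - z / l) \<longlonglongrightarrow> S z)"

text \<open>
  The sigma function divided by \<open>z\<close>.  The limit of the partial products determines it uniquely.
\<close>

definition sigma0 :: "complex \<Rightarrow> complex" where "sigma0 = (SOME S. is_sigma0 S)"

lemma is_sigma0: "is_sigma0 sigma0"
proof -
  interpret perturbed_lattice "{0}" "\<lambda>l. l" 0 by (rule perturbed_lattice_id)
  obtain S where S: "S holomorphic_on UNIV" "\<And>z. zorder S z = int (card {l\<in>sq_lattice - {0}. l = z})"
    "\<And>z. (\<lambda>N. \<Prod>l\<in>lat_box N - {0}. 1 - z / l) \<longlonglongrightarrow> S z"
    by (rule canonical_product) (rule that, assumption+)
  have "{l\<in>sq_lattice - {0}. l = z} = (if z \<in> sq_lattice - {0} then {z} else {})" for z by auto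
  hence "is_sigma0 S" unfolding is_sigma0_def using S by auto
  thus ?thesis unfolding sigma0_def by (rule someI[of is_sigma0])
qed

lemma sigma0_holomorphic: "sigma0 holomorphic_on X"
  and zorder_sigma0: "zorder sigma0 z = (if z \<in> sq_lattice - {0} then 1 else 0)"
  and sigma0_lim: "(\<lambda>N. \<Prod>l\<in>lat_box N - {0}. 1 - z / l) \<longlonglongrightarrow> sigma0 z"
  using is_sigma0 by (auto simp: is_sigma0_def intro: holomorphic_on_subset)

lemma sigma0_0: "sigma0 0 = 1"
  using LIMSEQ_unique[OF sigma0_lim[of 0]] by simp

lemma sigma0_eq_0_iff: "sigma0 z = 0 \<longleftrightarrow> z \<in> sq_lattice - {0}"
proof -
  have "eventually (\<lambda>w. sigma0 w \<noteq> 0) (at z)"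
    using non_zero_neighbour_alt[OF sigma0_holomorphic open_UNIV connected_UNIV, of z 0] sigma0_0
    by (auto elim: eventually_mono)
  thus ?thesis
    using zorder_pos_iff[OF sigma0_holomorphic open_UNIV, of z] zorder_sigma0[of z]
    by (auto simp: eventually_frequently split: if_splits)
qed

definition wsigma :: "complex \<Rightarrow> complex" where "wsigma z = z * sigma0 z"

lemma sigma_eq_0_iff: "wsigma z = 0 \<longleftrightarrow> z \<in> sq_lattice"
  using gauss_pt_in[of "(0,0)"] by (auto simp: wsigma_def sigma0_eq_0_iff simp del: gauss_pt_in)

lemma sigma_lim: "(\<lambda>N. z * (\<Prod>l\<in>lat_box N - {0}. 1 - z / l)) \<longlonglongrightarrow> wsigma z"
  unfolding wsigma_def by (intro tendsto_intros sigma0_lim)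

lemma sigma0_times_i: "sigma0 (\<i> * z) = sigma0 z"
proof -
  have "(\<Prod>l\<in>lat_box N - {0}. 1 - z / l) = (\<Prod>l\<in>lat_box N - {0}. 1 - (\<i> * z) / l)" for N
  proof -
    have "(\<Prod>l\<in>lat_box N - {0}. 1 - (\<i> * z) / l) = (\<Prod>l\<in>(\<lambda>l. \<i> * l) ` (lat_box N - {0}). 1 - (\<i> * z) / l)"
      by (subst image_set_diff) (auto simp: inj_on_def box_times_i)
    also have "\<dots> = (\<Prod>l\<in>lat_box N - {0}. 1 - (\<i> * z) / (\<i> * l))"
      by (subst prod.reindex) (auto simp: inj_on_def)
    finally show ?thesis by simp
  qed
  thus ?thesis using LIMSEQ_unique[OF sigma0_lim[of z]] sigma0_lim[of "\<i> * z"] by simp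
qed

text \<open>
  A Riemann sum for the integral of \<open>1 / (1 + x\<^sup>2)\<close> over \<open>[0, 1]\<close>, squeezed between two telescoping sums
  of arctangent differences.  The limit \<open>\<pi> / 4\<close> determines the constant in the
  quasi-periodicity of \<open>\<sigma>\<close>.
\<close>

lemma sum_recip_square_limit: "(\<lambda>N. \<Sum>b=1..N. real N / ((real N)\<^sup>2 + (real b)\<^sup>2)) \<longlonglongrightarrow> pi / 4"
proof (rule tendsto_sandwich)
  have step: "arctan (real (Suc b) / N) - arctan (real b / N) \<le> real N / ((real N)\<^sup>2 + (real b)\<^sup>2) \<and>
     real N / ((real N)\<^sup>2 + (real (Suc b))\<^sup>2) \<le> arctan (real (Suc b) / N) - arctan (real b / N)" if N: "N \<ge> 1" for N b :: nat
  proof -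
    have lt: "real b / N < real (Suc b) / N" using N by (simp add: divide_strict_right_mono)
    have "\<exists>z>real b / N. z < real (Suc b) / N \<and> arctan (real (Suc b) / N) - arctan (real b / N)
         = (real (Suc b) / N - real b / N) * (inverse (1 + z\<^sup>2))"
      by (rule MVT2[OF lt]) (rule DERIV_arctan)
    then obtain z where z: "real b / N < z" "z < real (Suc b) / N"
      "arctan (real (Suc b) / N) - arctan (real b / N) = (real (Suc b) / N - real b / N) * (inverse (1 + z\<^sup>2))" by blast
    have eq: "arctan (real (Suc b) / N) - arctan (real b / N) = 1 / (N * (1 + z\<^sup>2))"
      unfolding z(3) using N by (simp add: field_simps)
    have cmp: "real N / ((real N)\<^sup>2 + c\<^sup>2) = 1 / (N * (1 + (c / N)\<^sup>2))" for c :: real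
    proof -
      have "N * (1 + (c / N)\<^sup>2) = ((real N)\<^sup>2 + c\<^sup>2) / N"
        using N by (simp add: field_simps power2_eq_square)
      thus ?thesis by simp
    qed
    have z0: "0 \<le> z" using z(1) by (meson divide_nonneg_nonneg less_eq_real_def of_nat_0_le_iff order_trans)
    have "(real b / N)\<^sup>2 \<le> z\<^sup>2" "z\<^sup>2 \<le> (real (Suc b) / N)\<^sup>2"
      using z z0 by (intro power_mono; simp)+
    thus ?thesis unfolding eq cmp using N
      by (intro conjI divide_left_mono mult_left_mono mult_pos_pos add_pos_nonneg) auto
  qed
  have tele: "(\<Sum>b=1..N. arctan (real (Suc b) / N) - arctan (real b / N)) = arctan (real (Suc N) / N) - arctan (1 / N)" for N :: nat
  proof (cases "N = 0")
    case False
    thus ?thesis using sum_Suc_diff[of 1 N "\<lambda>b. arctan (real b / N)"] by simp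
  qed auto
  have tele2: "(\<Sum>b=1..N. arctan (real b / N) - arctan (real (b - 1) / N)) = arctan (real N / N)" for N :: nat
  proof -
    have "(\<Sum>b=1..M. arctan (real b / N) - arctan (real (b - 1) / N)) = arctan (real M / N)" for M
      by (induction M) (auto simp: atLeastAtMostSuc_conv)
    thus ?thesis .
  qed
  show "eventually (\<lambda>N. arctan (real (Suc N) / N) - arctan (1 / N) \<le> (\<Sum>b=1..N. real N / ((real N)\<^sup>2 + (real b)\<^sup>2))) sequentially"
    using eventually_ge_at_top[of 1]
  proof eventually_elim
    case (elim N)
    show ?case unfolding tele[symmetric] using step[OF elim] by (intro sum_mono) blast
  qed
  show "eventually (\<lambda>N. (\<Sum>b=1..N. real N / ((real N)\<^sup>2 + (real b)\<^sup>2)) \<le> arctan (real N / N)) sequentially"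
    using eventually_ge_at_top[of 1]
  proof eventually_elim
    case (elim N)
    show ?case unfolding tele2[symmetric]
    proof (rule sum_mono)
      fix b assume "b \<in> {1..N}"
      thus "real N / ((real N)\<^sup>2 + (real b)\<^sup>2) \<le> arctan (real b / N) - arctan (real (b - 1) / N)"
        using step[OF elim, of "b - 1"] by simp
    qed
  qed
  have "(\<lambda>N. arctan (1 + 1 / real N) - arctan (1 / real N)) \<longlonglongrightarrow> arctan (1 + 0) - arctan 0"
    by (intro tendsto_intros lim_1_over_n)
  moreover have "eventually (\<lambda>N. arctan (1 + 1 / real N) - arctan (1 / real N) = arctan (real (Suc N) / N) - arctan (1 / N)) sequentially"
    using eventually_ge_at_top[of 1] by eventually_elim (simp add: field_simps)
  ultimately have "(\<lambda>N. arctan (real (Suc N) / N) - arctan (1 / N)) \<longlonglongrightarrow> arctan (1 + 0) - arctan 0"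
    by (rule Lim_transform_eventually)
  thus "(\<lambda>N. arctan (real (Suc N) / N) - arctan (1 / N)) \<longlonglongrightarrow> pi / 4"
    by (simp only: add_0_right arctan_one arctan_zero_zero diff_0_right)
  show "(\<lambda>N. arctan (real N / real N)) \<longlonglongrightarrow> pi / 4"
    by (rule tendsto_eventually) (use eventually_ge_at_top[of 1] in eventually_elim, simp add: arctan_one)
qed

lemma one_add_times_exp_bound:
  assumes "cmod u \<le> 1/2"
  shows "cmod ((1 + u) * exp (-u) - 1) \<le> 3 * (cmod u)\<^sup>2"
  using weierstrass_factor_bound[of "-u" 1] assms by (simp add: weierstrass_factor_def numeral_2_eq_2)

lemma column_sum_limit:
  "(\<lambda>N. \<Sum>b\<in>{-int N..int N}. 1 / (of_real (sqrt pi) * (of_nat N + \<i> * of_int b))) \<longlonglongrightarrow> of_real (sqrt pi / 2)"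
proof -
  have eq: "(\<Sum>b\<in>{-int N..int N}. 1 / (of_real (sqrt pi) * (of_nat N + \<i> * of_int b)))
     = of_real (1 / sqrt pi * (2 * (\<Sum>b=1..N. real N / ((real N)\<^sup>2 + (real b)\<^sup>2)) + 1 / real N))" if N: "N \<ge> 1" for N
  proof -
    let ?g = "\<lambda>b::int. real N / ((real N)\<^sup>2 + (of_int b)\<^sup>2)"
    have t: "1 / (of_nat N + \<i> * of_int b) + 1 / (of_nat N + \<i> * of_int (-b)) = complex_of_real (2 * ?g b)" for b
    proof -
      have nz: "of_nat N + \<i> * of_int b \<noteq> (0::complex)" "of_nat N - \<i> * of_int b \<noteq> (0::complex)"
        using N by (auto simp: complex_eq_iff)
      have p: "(of_nat N + \<i> * of_int b) * (of_nat N - \<i> * of_int b) = complex_of_real ((real N)\<^sup>2 + (of_int b)\<^sup>2)"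
        by (simp add: algebra_simps power2_eq_square)
      have "1 / (of_nat N + \<i> * of_int b) + 1 / (of_nat N + \<i> * of_int (-b)) =
         (2 * of_nat N) / ((of_nat N + \<i> * of_int b) * (of_nat N - \<i> * of_int b))"
        using nz by (simp add: add_divide_eq_iff divide_add_eq_iff)
      thus ?thesis unfolding p by simp
    qed
    define F where "F b = 1 / (of_nat N + \<i> * of_int b)" for b :: int
    have split: "{-int N..int N} = {0} \<union> int ` {1..N} \<union> (\<lambda>b. - int b) ` {1..N}"
    proof -
      have "x \<in> {0} \<union> int ` {1..N} \<union> (\<lambda>b. - int b) ` {1..N}" if "x \<in> {-int N..int N}" for x
      proof (cases "x \<ge> 0")
        case True
        thus ?thesis using that by (cases "x = 0") (auto intro!: image_eqI[of _ int "nat x"])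
      next
        case False
        thus ?thesis using that by (auto intro!: image_eqI[of _ "\<lambda>b. - int b" "nat (-x)"])
      qed
      moreover have "{0} \<union> int ` {1..N} \<union> (\<lambda>b. - int b) ` {1..N} \<subseteq> {-int N..int N}" by auto
      ultimately show ?thesis by blast
    qed
    have "(\<Sum>b\<in>{-int N..int N}. F b) = F 0 + (\<Sum>b=1..N. F (int b)) + (\<Sum>b=1..N. F (- int b))"
    proof -
      have "(\<Sum>b\<in>{-int N..int N}. F b) = sum F ({0} \<union> int ` {1..N}) + sum F ((\<lambda>b. - int b) ` {1..N})"
        unfolding split by (rule sum.union_disjoint) auto
      also have "sum F ({0} \<union> int ` {1..N}) = F 0 + sum F (int ` {1..N})"
        by (subst sum.union_disjoint) auto
      finally show ?thesis by (simp add: sum.reindex inj_on_def)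
    qed
    also have "\<dots> = F 0 + (\<Sum>b=1..N. F (int b) + F (- int b))" by (simp add: sum.distrib)
    also have "(\<Sum>b=1..N. F (int b) + F (- int b)) = (\<Sum>b=1..N. complex_of_real (2 * (real N / ((real N)\<^sup>2 + (real b)\<^sup>2))))"
      unfolding F_def t by simp
    also have "F 0 = of_real (1 / real N)" by (simp add: F_def)
    finally have "(\<Sum>b\<in>{-int N..int N}. F b) = of_real (2 * (\<Sum>b=1..N. real N / ((real N)\<^sup>2 + (real b)\<^sup>2)) + 1 / real N)"
      by (simp add: sum_distrib_left)
    moreover have "(\<Sum>b\<in>{-int N..int N}. 1 / (of_real (sqrt pi) * (of_nat N + \<i> * of_int b))) = of_real (1 / sqrt pi) * (\<Sum>b\<in>{-int N..int N}. F b)"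
      unfolding sum_distrib_left by (intro sum.cong refl) (simp add: F_def)
    ultimately show ?thesis by simp
  qed
  have lim: "(\<lambda>N. complex_of_real (1 / sqrt pi * (2 * (\<Sum>b=1..N. real N / ((real N)\<^sup>2 + (real b)\<^sup>2)) + 1 / real N)))
     \<longlonglongrightarrow> of_real (1 / sqrt pi * (2 * (pi / 4) + 0))"
    by (intro tendsto_intros sum_recip_square_limit lim_1_over_n)
  have val: "1 / sqrt pi * (2 * (pi / 4) + 0) = sqrt pi / 2"
    by (simp add: field_simps flip: power2_eq_square)
  have "eventually (\<lambda>N. complex_of_real (1 / sqrt pi * (2 * (\<Sum>b=1..N. real N / ((real N)\<^sup>2 + (real b)\<^sup>2)) + 1 / real N))
     = (\<Sum>b\<in>{-int N..int N}. 1 / (of_real (sqrt pi) * (of_nat N + \<i> * of_int b)))) sequentially"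
    using eventually_ge_at_top[of 1] by eventually_elim (rule eq[symmetric])
  thus ?thesis by (rule Lim_transform_eventually[OF lim[unfolded val]])
qed

text \<open>
  The effect on the partial products of moving the square by one period: a boundary column is replaced
  by the opposite one.  The \<open>2 N + 1\<close> factors are \<open>1 + O(1 / N)\<close>, so their product is the exponential of
  the sum of the increments up to an error \<open>O(1 / N)\<close>.
\<close>

lemma column_ratio_limit:
  fixes z c :: complex
  shows "(\<lambda>N. \<Prod>b\<in>{-int N..int N}. 1 + c / (of_real (sqrt pi) * (of_nat N + \<i> * of_int b) - z))
            \<longlonglongrightarrow> exp (c * of_real (sqrt pi / 2))"
proof -
  define w where "w N b = complex_of_real (sqrt pi) * (of_nat N + \<i> * of_int b)" for N :: nat and b :: int
  define u where "u N b = c / (w N b - z)" for N b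
  define I where "I N = {-int N..int N}" for N :: nat
  have cardI: "card (I N) = 2 * N + 1" for N by (simp add: I_def nat_add_distrib nat_mult_distrib)
  have w: "real N \<le> cmod (w N b)" for N b
  proof -
    have "1 * real N \<le> sqrt pi * real N" using sqrt_pi_bounds(1) by (intro mult_right_mono) linarith+
    also have "\<dots> = \<bar>Re (w N b)\<bar>" by (simp add: w_def abs_mult)
    also have "\<dots> \<le> cmod (w N b)" by (rule abs_Re_le_cmod)
    finally show ?thesis by simp
  qed
  have ev: "eventually (\<lambda>N. 2 * cmod z + 4 * cmod c + 1 \<le> real N) sequentially"
    by (rule filterlim_real_sequentially[unfolded filterlim_at_top, rule_format])
  have wz: "real N / 2 \<le> cmod (w N b - z)" if "2 * cmod z + 4 * cmod c + 1 \<le> real N" for N b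
    using w[of N b] norm_triangle_ineq2[of "w N b" z] that norm_ge_zero[of c] norm_ge_zero[of z] by linarith
  have ub: "cmod (u N b) \<le> 2 * cmod c / real N" if N: "2 * cmod z + 4 * cmod c + 1 \<le> real N" for N b
  proof -
    have "real N > 0" using N norm_ge_zero[of c] norm_ge_zero[of z] by linarith
    hence "cmod c / cmod (w N b - z) \<le> cmod c / (real N / 2)"
      using wz[OF N, of b] by (intro divide_left_mono mult_pos_pos) auto
    thus ?thesis by (simp add: u_def norm_divide mult.commute)
  qed
  have sq: "(\<lambda>N. real (2 * N + 1) * (K / (real N)\<^sup>2)) \<longlonglongrightarrow> 0" for K
    by real_asymp
  have E: "(\<lambda>N. \<Prod>b\<in>I N. (1 + u N b) * exp (- u N b)) \<longlonglongrightarrow> 1"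
  proof -
    have "(\<lambda>N. (\<Prod>b\<in>I N. (1 + u N b) * exp (- u N b)) - 1) \<longlonglongrightarrow> 0"
    proof (rule Lim_null_comparison)
      show "eventually (\<lambda>N. norm ((\<Prod>b\<in>I N. (1 + u N b) * exp (- u N b)) - 1)
           \<le> exp (real (2 * N + 1) * ((12 * (cmod c)\<^sup>2) / (real N)\<^sup>2)) - 1) sequentially"
        using ev
      proof eventually_elim
        case (elim N)
        have N0: "real N > 0" using elim norm_ge_zero[of c] norm_ge_zero[of z] by linarith
        have b: "cmod ((1 + u N b) * exp (- u N b) - 1) \<le> (12 * (cmod c)\<^sup>2) / (real N)\<^sup>2" for b
        proof -
          have "4 * cmod c \<le> real N" using elim norm_ge_zero[of z] by linarith
          hence "2 * cmod c / real N \<le> 1 / 2" using N0 by (simp add: field_simps)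
          hence "cmod ((1 + u N b) * exp (- u N b) - 1) \<le> 3 * (cmod (u N b))\<^sup>2"
            using ub[OF elim, of b] by (intro one_add_times_exp_bound) simp
          also have "\<dots> \<le> 3 * (2 * cmod c / real N)\<^sup>2"
            using ub[OF elim, of b] by (intro mult_left_mono power_mono) auto
          finally show ?thesis by (simp add: power_divide power_mult_distrib)
        qed
        have "(\<Sum>b\<in>I N. cmod ((1 + u N b) * exp (- u N b) - 1)) \<le> real (card (I N)) * ((12 * (cmod c)\<^sup>2) / (real N)\<^sup>2)"
          using b by (rule sum_bounded_above)
        thus ?case
          using prod_minus_one_le_exp[of "I N" "\<lambda>b. (1 + u N b) * exp (- u N b)"] unfolding cardI
          by (simp add: I_def) (smt (verit) exp_le_cancel_iff)
      qed
      have "(\<lambda>N. exp (real (2 * N + 1) * ((12 * (cmod c)\<^sup>2) / (real N)\<^sup>2)) - 1) \<longlonglongrightarrow> exp 0 - 1"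
        by (intro tendsto_intros sq)
      thus "(\<lambda>N. exp (real (2 * N + 1) * ((12 * (cmod c)\<^sup>2) / (real N)\<^sup>2)) - 1) \<longlonglongrightarrow> 0" by simp
    qed
    thus ?thesis by (simp add: LIM_zero_iff)
  qed
  have D: "(\<lambda>N. \<Sum>b\<in>I N. u N b - c * (1 / w N b)) \<longlonglongrightarrow> 0"
  proof (rule Lim_null_comparison[OF _ sq[of "2 * cmod c * cmod z"]])
    show "eventually (\<lambda>N. norm (\<Sum>b\<in>I N. u N b - c * (1 / w N b)) \<le> real (2 * N + 1) * (2 * cmod c * cmod z / (real N)\<^sup>2)) sequentially"
      using ev
    proof eventually_elim
      case (elim N)
      have N0: "real N > 0" using elim norm_ge_zero[of c] norm_ge_zero[of z] by linarith
      have "cmod (u N b - c * (1 / w N b)) \<le> 2 * cmod c * cmod z / (real N)\<^sup>2" for b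
      proof -
        have p: "0 < cmod (w N b)" "0 < cmod (w N b - z)" using w[of N b] wz[OF elim, of b] N0 by linarith+
        have "u N b - c * (1 / w N b) = c * z / ((w N b - z) * w N b)"
          using p by (simp add: u_def field_simps)
        hence "cmod (u N b - c * (1 / w N b)) = cmod c * cmod z / (cmod (w N b - z) * cmod (w N b))"
          by (simp add: norm_mult norm_divide)
        also have "\<dots> \<le> cmod c * cmod z / (real N / 2 * real N)"
          using p N0 w[of N b] wz[OF elim, of b] by (intro divide_left_mono mult_mono mult_pos_pos) auto
        finally show ?thesis by (simp add: power2_eq_square mult_ac)
      qed
      hence "norm (\<Sum>b\<in>I N. u N b - c * (1 / w N b)) \<le> (\<Sum>b\<in>I N. 2 * cmod c * cmod z / (real N)\<^sup>2)"
        by (intro sum_norm_le) auto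
      thus ?case by (simp add: cardI)
    qed
  qed
  have "(\<lambda>N. (\<Sum>b\<in>I N. u N b - c * (1 / w N b)) + c * (\<Sum>b\<in>I N. 1 / w N b)) \<longlonglongrightarrow> 0 + c * of_real (sqrt pi / 2)"
    unfolding I_def w_def by (intro tendsto_intros column_sum_limit D[unfolded I_def w_def])
  hence "(\<lambda>N. \<Sum>b\<in>I N. u N b) \<longlonglongrightarrow> c * of_real (sqrt pi / 2)"
    by (simp add: sum_subtractf sum_distrib_left)
  hence "(\<lambda>N. (\<Prod>b\<in>I N. (1 + u N b) * exp (- u N b)) * exp (\<Sum>b\<in>I N. u N b)) \<longlonglongrightarrow> 1 * exp (c * of_real (sqrt pi / 2))"
    by (intro tendsto_intros E)
  moreover have "(\<Prod>b\<in>I N. (1 + u N b) * exp (- u N b)) * exp (\<Sum>b\<in>I N. u N b) = (\<Prod>b\<in>I N. 1 + u N b)" for N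
  proof -
    have "exp (\<Sum>b\<in>I N. u N b) = (\<Prod>b\<in>I N. exp (u N b))" by (rule exp_sum) (simp add: I_def)
    hence "(\<Prod>b\<in>I N. (1 + u N b) * exp (- u N b)) * exp (\<Sum>b\<in>I N. u N b) = (\<Prod>b\<in>I N. (1 + u N b) * exp (- u N b) * exp (u N b))"
      by (simp only: prod.distrib)
    also have "\<dots> = (\<Prod>b\<in>I N. 1 + u N b)"
      by (intro prod.cong refl) (simp add: mult.assoc flip: exp_add)
    finally show ?thesis .
  qed
  ultimately show ?thesis by (simp add: I_def u_def w_def)
qed

lemma prod_shift_telescope:
  fixes g :: "int \<Rightarrow> complex"
  shows "(\<Prod>a\<in>{-int N..int N}. g (a - 1)) * g (int N) = (\<Prod>a\<in>{-int N..int N}. g a) * g (- int N - 1)"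
proof -
  have "(\<Prod>a\<in>{-int N..int N}. g (a - 1)) = (\<Prod>a\<in>{-int N - 1..int N - 1}. g a)"
    by (rule prod.reindex_bij_witness[of _ "\<lambda>a. a + 1" "\<lambda>a. a - 1"]) auto
  hence "(\<Prod>a\<in>{-int N..int N}. g (a - 1)) * g (int N) = (\<Prod>a\<in>insert (int N) {-int N - 1..int N - 1}. g a)"
    by simp
  also have "insert (int N) {-int N - 1..int N - 1} = insert (-int N - 1) {-int N..int N}" by auto
  also have "(\<Prod>a\<in>insert (-int N - 1) {-int N..int N}. g a) = (\<Prod>a\<in>{-int N..int N}. g a) * g (- int N - 1)"
    by simp
  finally show ?thesis .
qed

lemma lat_box_prod: "(\<Prod>l\<in>lat_box N. f l) = (\<Prod>b\<in>{-int N..int N}. \<Prod>a\<in>{-int N..int N}. f (gauss_pt (a, b)))"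
proof -
  have "(\<Prod>l\<in>lat_box N. f l) = (\<Prod>p\<in>{-int N..int N} \<times> {-int N..int N}. f (gauss_pt p))"
    unfolding lat_box_def height_le_iff by (subst prod.reindex) (auto intro: inj_on_subset[OF inj_gauss_pt])
  also have "\<dots> = (\<Prod>a\<in>{-int N..int N}. \<Prod>b\<in>{-int N..int N}. f (gauss_pt (a, b)))"
    by (simp add: prod.cartesian_product)
  also have "\<dots> = (\<Prod>b\<in>{-int N..int N}. \<Prod>a\<in>{-int N..int N}. f (gauss_pt (a, b)))"
    by (rule prod.swap)
  finally show ?thesis .
qed

lemma sigma_partial_eq: "z * (\<Prod>l\<in>lat_box N - {0}. 1 - z / l) * (\<Prod>l\<in>lat_box N - {0}. - l) = (\<Prod>l\<in>lat_box N. z - l)"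
proof -
  have 0: "0 \<in> lat_box N" using image_eqI[of 0 gauss_pt "(0,0)"] by (auto simp: lat_box_def height_def)
  have "(\<Prod>l\<in>lat_box N. z - l) = (z - 0) * (\<Prod>l\<in>lat_box N - {0}. z - l)"
    by (rule prod.remove) (use 0 in auto)
  also have "(\<Prod>l\<in>lat_box N - {0}. z - l) = (\<Prod>l\<in>lat_box N - {0}. (1 - z / l) * (- l))"
    by (intro prod.cong refl) (auto simp: algebra_simps)
  finally show ?thesis by (simp only: prod.distrib mult.assoc diff_0_right)
qed

text \<open>
  Shifting by a period permutes the linear factors of the partial product except for the two boundary
  columns, whose ratio converges by the previous limit.
\<close>

lemma sigma_quasi_periodic: "wsigma (z + of_real (sqrt pi)) = - wsigma z * exp (of_real (sqrt pi) * z + of_real pi / 2)"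
proof (cases "z \<in> sq_lattice")
  case True
  then obtain p where p: "z = gauss_pt p" by (auto simp: sq_lattice_eq)
  have "z + of_real (sqrt pi) = gauss_pt (p + (1, 0))" unfolding p by (simp add: gauss_pt_def algebra_simps)
  hence "z + of_real (sqrt pi) \<in> sq_lattice" by simp
  thus ?thesis using True by (simp add: sigma_eq_0_iff[THEN iffD2])
next
  case False
  define s where "s = complex_of_real (sqrt pi)"
  define c where "c = s + 2 * z"
  define J where "J N = {-int N..int N}" for N :: nat
  define P where "P w N = w * (\<Prod>l\<in>lat_box N - {0}. 1 - w / l)" for w and N
  define R where "R N = (\<Prod>b\<in>J N. 1 + c / (s * (of_nat N + \<i> * of_int b) - z))" for N :: nat
  have PR: "P (z + s) N = - P z N * R N" for N
  proof -
    define g where "g b a = z - gauss_pt (a, b)" for a b :: int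
    have nz: "g b a \<noteq> 0" for a b using False by (auto simp: g_def)
    have sh: "z + s - gauss_pt (a, b) = g b (a - 1)" for a b
      by (simp add: g_def gauss_pt_def s_def algebra_simps)
    have "(\<Prod>l\<in>lat_box N. z + s - l) * (\<Prod>b\<in>J N. g b (int N)) = (\<Prod>b\<in>J N. (\<Prod>a\<in>J N. g b (a - 1)) * g b (int N))"
      unfolding lat_box_prod sh J_def by (simp add: prod.distrib)
    also have "\<dots> = (\<Prod>b\<in>J N. (\<Prod>a\<in>J N. g b a) * g b (- int N - 1))"
      unfolding J_def prod_shift_telescope ..
    also have "\<dots> = (\<Prod>l\<in>lat_box N. z - l) * (\<Prod>b\<in>J N. g b (- int N - 1))"
      unfolding lat_box_prod by (simp add: J_def prod.distrib g_def)
    also have "(\<Prod>b\<in>J N. g b (- int N - 1)) = (\<Prod>b\<in>J N. g (- b) (- int N - 1))"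
      by (rule prod.reindex_bij_witness[of _ uminus uminus]) (auto simp: J_def)
    also have "\<dots> = (\<Prod>b\<in>J N. g b (int N) * (- (1 + c / (s * (of_nat N + \<i> * of_int b) - z))))"
    proof (rule prod.cong)
      fix b assume "b \<in> J N"
      have g: "g b (int N) = z - s * (of_nat N + \<i> * of_int b)" by (simp add: g_def gauss_pt_def s_def)
      hence "s * (of_nat N + \<i> * of_int b) - z \<noteq> 0" using nz[of b "int N"] by auto
      hence "g b (int N) * (- (1 + c / (s * (of_nat N + \<i> * of_int b) - z))) = (s * (of_nat N + \<i> * of_int b) - z) + c"
        unfolding g by (simp add: field_simps)
      also have "\<dots> = g (- b) (- int N - 1)" by (simp add: c_def g_def gauss_pt_def s_def algebra_simps)
      finally show "g (- b) (- int N - 1) = g b (int N) * (- (1 + c / (s * (of_nat N + \<i> * of_int b) - z)))" ..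
    qed auto
    also have "\<dots> = (\<Prod>b\<in>J N. g b (int N)) * ((-1) ^ card (J N) * R N)"
      by (simp only: prod.distrib R_def prod_uminus)
    also have "(-1 :: complex) ^ card (J N) = -1"
      by (simp add: J_def nat_add_distrib nat_mult_distrib)
    finally have "(\<Prod>l\<in>lat_box N. z + s - l) * (\<Prod>b\<in>J N. g b (int N))
        = (- (\<Prod>l\<in>lat_box N. z - l) * R N) * (\<Prod>b\<in>J N. g b (int N))" by (simp add: mult_ac)
    moreover have "(\<Prod>b\<in>J N. g b (int N)) \<noteq> 0" using nz by (simp add: J_def)
    ultimately have "(\<Prod>l\<in>lat_box N. z + s - l) = - (\<Prod>l\<in>lat_box N. z - l) * R N"
      using mult_right_cancel by blast
    hence "P (z + s) N * (\<Prod>l\<in>lat_box N - {0}. - l) = (- P z N * R N) * (\<Prod>l\<in>lat_box N - {0}. - l)"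
      unfolding P_def sigma_partial_eq by (simp only: sigma_partial_eq[symmetric] mult_ac mult_minus_left mult_minus_right)
    moreover have "(\<Prod>l\<in>lat_box N - {0}. - l) \<noteq> 0" by simp
    ultimately show ?thesis using mult_right_cancel by blast
  qed
  have lim1: "(\<lambda>N. - P z N * R N) \<longlonglongrightarrow> - wsigma z * exp (c * of_real (sqrt pi / 2))"
    unfolding P_def R_def J_def s_def by (intro tendsto_intros sigma_lim column_ratio_limit)
  have "(\<lambda>N. P (z + s) N) \<longlonglongrightarrow> wsigma (z + s)"
    unfolding P_def by (rule sigma_lim)
  hence "wsigma (z + s) = - wsigma z * exp (c * of_real (sqrt pi / 2))"
    unfolding PR by (rule LIMSEQ_unique[OF _ lim1])
  moreover have "c * of_real (sqrt pi / 2) = s * z + of_real pi / 2"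
  proof -
    have "s * s = of_real pi" by (simp add: s_def flip: of_real_mult)
    thus ?thesis by (simp add: c_def s_def field_simps)
  qed
  ultimately show ?thesis by (simp only: s_def)
qed

definition sigma_weight :: "complex \<Rightarrow> real" where
  "sigma_weight z = cmod (wsigma z) * exp (- (cmod z)\<^sup>2 / 2)"

lemma sigma_weight_add_real: "sigma_weight (z + of_real (sqrt pi)) = sigma_weight z"
proof -
  have "(cmod (z + of_real (sqrt pi)))\<^sup>2 = (cmod z)\<^sup>2 + 2 * sqrt pi * Re z + pi"
    by (simp add: cmod_power2 power2_sum algebra_simps)
  hence "- (cmod (z + of_real (sqrt pi)))\<^sup>2 / 2 = - (cmod z)\<^sup>2 / 2 - (sqrt pi * Re z + pi / 2)"
    by (simp add: field_simps)
  thus ?thesis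
    by (simp add: sigma_weight_def sigma_quasi_periodic norm_mult norm_exp_eq_Re exp_diff)
qed

lemma sigma_weight_times_i: "sigma_weight (\<i> * z) = sigma_weight z"
  by (simp add: sigma_weight_def wsigma_def sigma0_times_i norm_mult)

text \<open>
  Conjugating the real translation with the rotation by \<open>\<i>\<close>.
\<close>

lemma sigma_weight_add_imag: "sigma_weight (z + \<i> * of_real (sqrt pi)) = sigma_weight z"
proof -
  have "z + \<i> * of_real (sqrt pi) = \<i> * (- (\<i> * z) + of_real (sqrt pi))" by (simp add: algebra_simps)
  hence "sigma_weight (z + \<i> * of_real (sqrt pi)) = sigma_weight (- (\<i> * z))"
    by (simp only: sigma_weight_times_i sigma_weight_add_real)
  also have "\<dots> = sigma_weight (\<i> * (- (\<i> * z)))" by (simp only: sigma_weight_times_i)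
  finally show ?thesis by simp
qed

lemma periodic_int:
  fixes f :: "complex \<Rightarrow> real"
  assumes "\<And>z. f (z + w) = f z"
  shows "f (z + of_int n * w) = f z"
proof -
  have nat: "f (z + of_nat k * w) = f z" for z k
  proof (induction k)
    case (Suc k)
    have "z + of_nat (Suc k) * w = (z + of_nat k * w) + w" by (simp add: algebra_simps)
    thus ?case using assms Suc by (simp only:)
  qed simp
  show ?thesis
  proof (cases "n \<ge> 0")
    case True
    thus ?thesis using nat[of z "nat n"] by simp
  next
    case False
    thus ?thesis using nat[of "z + of_int n * w" "nat (-n)"] by (simp add: algebra_simps)
  qed
qed

lemma sigma_weight_add_lattice: "sigma_weight (z + gauss_pt p) = sigma_weight z"
proof -
  have "z + gauss_pt p = (z + of_int (fst p) * of_real (sqrt pi)) + of_int (snd p) * (\<i> * of_real (sqrt pi))"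
    by (simp add: gauss_pt_def algebra_simps)
  thus ?thesis
    by (simp only: periodic_int[of sigma_weight, OF sigma_weight_add_imag] periodic_int[of sigma_weight, OF sigma_weight_add_real])
qed

text \<open>
  The weighted modulus is doubly periodic, so it suffices to look at one cell, where \<open>\<sigma>\<close> has only the
  simple zero at its centre.
\<close>

theorem sigma_bounds:
  obtains c K where "0 < c" "0 < K"
    "\<And>z. c * cmod (z - near z) * exp ((cmod z)\<^sup>2 / 2) \<le> cmod (wsigma z)"
    "\<And>z. cmod (wsigma z) \<le> K * cmod (z - near z) * exp ((cmod z)\<^sup>2 / 2)"
proof -
  let ?s = "sqrt pi / 2"
  define Q where "Q = cbox (Complex (- ?s) (- ?s)) (Complex ?s ?s)"
  define h where "h w = cmod (sigma0 w) * exp (- (cmod w)\<^sup>2 / 2)" for w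
  have Q: "w \<in> Q \<longleftrightarrow> \<bar>Re w\<bar> \<le> ?s \<and> \<bar>Im w\<bar> \<le> ?s" for w
    by (auto simp: Q_def in_cbox_complex_iff)
  have cont: "continuous_on Q h" unfolding h_def
    by (intro continuous_intros holomorphic_on_imp_continuous_on[OF sigma0_holomorphic]) auto
  have Q0: "Q \<noteq> {}" using Q[of 0] by auto
  have cQ: "compact Q" unfolding Q_def by (rule compact_cbox)
  obtain w1 where w1: "w1 \<in> Q" "\<And>w. w \<in> Q \<Longrightarrow> h w1 \<le> h w"
    using continuous_attains_inf[OF cQ Q0 cont] by auto
  obtain w2 where w2: "w2 \<in> Q" "\<And>w. w \<in> Q \<Longrightarrow> h w \<le> h w2"
    using continuous_attains_sup[OF cQ Q0 cont] by auto
  have "h w1 > 0"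
  proof -
    have "w1 \<notin> sq_lattice - {0}"
    proof
      assume "w1 \<in> sq_lattice - {0}"
      then obtain p where p1: "w1 = gauss_pt p" "w1 \<noteq> 0" by (auto simp: sq_lattice_eq)
      have p: "w1 = gauss_pt p" "p \<noteq> (0,0)" using p1 by auto
      have "\<bar>Re w1\<bar> = sqrt pi * \<bar>fst p\<bar>" "\<bar>Im w1\<bar> = sqrt pi * \<bar>snd p\<bar>"
        by (auto simp: p Re_gauss_pt Im_gauss_pt abs_mult)
      hence "sqrt pi * \<bar>fst p\<bar> \<le> sqrt pi * (1/2)" "sqrt pi * \<bar>snd p\<bar> \<le> sqrt pi * (1/2)"
        using w1(1) Q[of w1] by auto
      hence "real_of_int \<bar>fst p\<bar> \<le> 1/2" "real_of_int \<bar>snd p\<bar> \<le> 1/2" by (simp_all only: mult_le_cancel_left_pos real_sqrt_gt_zero pi_gt_zero)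
      hence "fst p = 0" "snd p = 0" by linarith+
      thus False using p by (simp add: prod_eq_iff)
    qed
    thus ?thesis by (simp add: h_def sigma0_eq_0_iff)
  qed
  have key: "cmod (wsigma z) = h (z - near z) * cmod (z - near z) * exp ((cmod z)\<^sup>2 / 2)" for z
  proof -
    have "sigma_weight z = sigma_weight (z - near z)"
      using sigma_weight_add_lattice[of "z - near z" "near_idx z"] by (simp add: near_def)
    hence "sigma_weight z = h (z - near z) * cmod (z - near z)"
      by (simp add: sigma_weight_def wsigma_def h_def norm_mult)
    moreover have "cmod (wsigma z) = sigma_weight z * exp ((cmod z)\<^sup>2 / 2)"
      by (simp add: sigma_weight_def mult.assoc flip: exp_add)
    ultimately show ?thesis by simp
  qed
  have inQ: "z - near z \<in> Q" for z using near_close[of z] by (simp add: Q)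
  show ?thesis
  proof (rule that[of "h w1" "h w2"])
    show "0 < h w2" using \<open>h w1 > 0\<close> w2(2)[OF w1(1)] by simp
    show "h w1 * cmod (z - near z) * exp ((cmod z)\<^sup>2 / 2) \<le> cmod (wsigma z)" for z
      unfolding key using w1(2)[OF inQ] by (intro mult_right_mono) auto
    show "cmod (wsigma z) \<le> h w2 * cmod (z - near z) * exp ((cmod z)\<^sup>2 / 2)" for z
      unfolding key using w2(2)[OF inQ] by (intro mult_right_mono) auto
  qed fact
qed

section \<open>Pointwise growth of the canonical product\<close>

context perturbed_lattice
begin

abbreviation B :: "real \<Rightarrow> real" where "B \<equiv> log_displacement A \<mu>"

text \<open>
  For labels inside the circle through \<open>z\<close> the displacement is compared with the distance to \<open>z\<close>; the
  factor \<open>\<bar>l / \<mu>\<^sub>l\<bar>\<close> is kept, and these factors make up \<open>exp (- B)\<close>.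
\<close>

lemma factor_le_inner:
  assumes l: "l \<in> sq_lattice - A" and z: "z \<noteq> l"
  shows "cmod (1 - z / \<mu> l) \<le> cmod (1 - z / l) * exp (- ln (cmod (\<mu> l / l))) * exp (C * (1 / (cmod l * cmod (l - z))))"
proof -
  have l0: "cmod l > 0" using lattice_nonzero[OF l] by simp
  have m0: "cmod (\<mu> l) > 0" using nonzero[OF l] by simp
  have d: "cmod (l - z) > 0" using z by simp
  have "cmod (\<mu> l - z) \<le> cmod (l - z) + cmod (\<mu> l - l)" by norm
  also have "\<dots> \<le> cmod (l - z) + C / cmod l" using close'(2)[OF l] by simp
  also have "\<dots> = cmod (l - z) * (1 + C * (1 / (cmod l * cmod (l - z))))"
    using d by (simp add: field_simps)
  also have "\<dots> \<le> cmod (l - z) * exp (C * (1 / (cmod l * cmod (l - z))))"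
    by (intro mult_left_mono exp_ge_add_one_self) auto
  finally have 1: "cmod (\<mu> l - z) \<le> cmod (l - z) * exp (C * (1 / (cmod l * cmod (l - z))))" .
  have e: "exp (- ln (cmod (\<mu> l / l))) = cmod l / cmod (\<mu> l)"
    using l0 m0 by (simp add: exp_minus norm_divide)
  have "cmod (1 - z / \<mu> l) = cmod (\<mu> l - z) / cmod (\<mu> l)" "cmod (1 - z / l) = cmod (l - z) / cmod l"
    using l0 m0 by (simp_all add: norm_divide[symmetric] diff_divide_distrib)
  thus ?thesis using 1 l0 m0 by (simp add: e divide_right_mono mult_ac)
qed

text \<open>
  For labels outside, the two factors are both close to \<open>1 - z / l\<close>, and the ratio itself can be estimated.
\<close>

lemma factor_le_outer:
  assumes l: "l \<in> sq_lattice - A" and z: "z \<noteq> l"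
  shows "cmod (1 - z / \<mu> l) \<le> cmod (1 - z / l) * exp (C / \<delta> * (cmod z / ((cmod l)\<^sup>2 * cmod (l - z))))"
proof -
  have l0: "cmod l > 0" using lattice_nonzero[OF l] by simp
  have m0: "cmod (\<mu> l) > 0" using nonzero[OF l] by simp
  have d: "cmod (l - z) > 0" using z by simp
  have "1 - z / \<mu> l = (1 - z / l) - z * (1 / \<mu> l - 1 / l)" by (simp add: algebra_simps)
  hence "cmod (1 - z / \<mu> l) \<le> cmod (1 - z / l) + cmod z * cmod (1 / \<mu> l - 1 / l)"
    by (metis norm_mult norm_triangle_ineq4)
  also have "\<dots> \<le> cmod (1 - z / l) + cmod z * (C / \<delta> * (1 / cmod l ^ 3))"
    using inverse_diff_bound(1)[OF l] by (intro add_left_mono mult_left_mono) auto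
  also have "cmod (1 - z / l) = cmod (l - z) / cmod l"
    using l0 by (simp add: norm_divide[symmetric] diff_divide_distrib)
  also have "cmod (l - z) / cmod l + cmod z * (C / \<delta> * (1 / cmod l ^ 3)) =
      cmod (l - z) / cmod l * (1 + C / \<delta> * (cmod z / ((cmod l)\<^sup>2 * cmod (l - z))))"
    using d l0 \<delta>(1) by (simp add: field_simps power2_eq_square power3_eq_cube)
  also have "\<dots> \<le> cmod (l - z) / cmod l * exp (C / \<delta> * (cmod z / ((cmod l)\<^sup>2 * cmod (l - z))))"
    by (intro mult_left_mono exp_ge_add_one_self) auto
  finally show ?thesis using l0 by (simp add: norm_divide[symmetric] diff_divide_distrib)
qed

text \<open>
  Since \<open>\<bar>l\<bar> + \<bar>l - z\<bar> \<ge> \<bar>z\<bar>\<close>, the summand is at most \<open>(1 / \<bar>l\<bar> + 1 / \<bar>l - z\<bar>) / \<bar>z\<bar>\<close>, and each of the two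
  sums of reciprocal distances is \<open>O(\<bar>z\<bar>)\<close>.
\<close>

lemma inner_sum_le:
  assumes T: "finite T" "T \<subseteq> sq_lattice - {0} - {near z}" "\<And>l. l \<in> T \<Longrightarrow> cmod l \<le> cmod z" and z: "z \<notin> sq_lattice" "cmod z \<ge> 1"
  shows "(\<Sum>l\<in>T. 1 / (cmod l * cmod (l - z))) \<le> 48"
proof -
  let ?r = "cmod z"
  have "(\<Sum>l\<in>T. 1 / (cmod l * cmod (l - z))) \<le> (\<Sum>l\<in>T. (1 / ?r) * (1 / cmod (l - 0) + 1 / cmod (l - z)))"
  proof (rule sum_mono)
    fix l assume l: "l \<in> T"
    have p: "0 < cmod l" "0 < cmod (l - z)" using l T(2) z(1) by auto
    have "?r \<le> cmod l + cmod (l - z)" by norm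
    hence "?r * (1 / (cmod l * cmod (l - z))) \<le> (cmod l + cmod (l - z)) * (1 / (cmod l * cmod (l - z)))"
      by (rule mult_right_mono) auto
    also have "\<dots> = 1 / cmod (l - 0) + 1 / cmod (l - z)" using p by (simp add: field_simps)
    finally have "1 / (cmod l * cmod (l - z)) * ?r \<le> 1 / cmod (l - 0) + 1 / cmod (l - z)"
      by (simp only: mult.commute)
    moreover have "0 < ?r" using z(2) by linarith
    ultimately have "1 / (cmod l * cmod (l - z)) \<le> (1 / cmod (l - 0) + 1 / cmod (l - z)) / ?r"
      by (simp only: pos_le_divide_eq)
    thus "1 / (cmod l * cmod (l - z)) \<le> (1 / ?r) * (1 / cmod (l - 0) + 1 / cmod (l - z))"
      by simp
  qed
  also have "\<dots> = (1 / ?r) * ((\<Sum>l\<in>T. 1 / cmod (l - 0)) + (\<Sum>l\<in>T. 1 / cmod (l - z)))"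
    by (simp only: sum_distrib_left[symmetric] sum.distrib)
  also have "\<dots> \<le> (1 / ?r) * (16 * ?r + 16 * (2 * ?r))"
  proof (intro mult_left_mono add_mono)
    show "(\<Sum>l\<in>T. 1 / cmod (l - 0)) \<le> 16 * ?r"
      by (rule sum_inverse_dist_le[OF T(1)]) (use T in auto)
    show "(\<Sum>l\<in>T. 1 / cmod (l - z)) \<le> 16 * (2 * ?r)"
    proof (rule sum_inverse_dist_le[OF T(1)])
      show "cmod (l - z) \<le> 2 * ?r" if "l \<in> T" for l
        using T(3)[OF that] norm_triangle_ineq4[of l z] by linarith
    qed (use T in auto)
  qed auto
  also have "\<dots> = 48 * (?r / ?r)" by (simp add: field_simps)
  also have "?r / ?r = 1" using z(2) by (intro divide_self) auto
  also have "48 * (1::real) = 48" by simp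
  finally show ?thesis .
qed

text \<open>
  Up to \<open>\<bar>l\<bar> \<le> 2 \<bar>z\<bar>\<close> the singularity at \<open>z\<close> matters and the sum of reciprocal distances is used; beyond,
  \<open>\<bar>l - z\<bar> \<ge> \<bar>l\<bar> / 2\<close> and the cubic tail decides.
\<close>

lemma outer_sum_le:
  assumes T: "finite T" "T \<subseteq> sq_lattice - {near z}" "\<And>l. l \<in> T \<Longrightarrow> cmod z < cmod l" and z: "z \<notin> sq_lattice" "cmod z \<ge> 1"
  shows "(\<Sum>l\<in>T. cmod z / ((cmod l)\<^sup>2 * cmod (l - z))) \<le> 64"
proof -
  let ?r = "cmod z" and ?f = "\<lambda>l. cmod z / ((cmod l)\<^sup>2 * cmod (l - z))"
  define T1 where "T1 = {l\<in>T. cmod l \<le> 2 * ?r}"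
  define T2 where "T2 = {l\<in>T. 2 * ?r < cmod l}"
  have r: "0 < ?r" using z by linarith
  have "(\<Sum>l\<in>T. ?f l) = (\<Sum>l\<in>T1 \<union> T2. ?f l)"
    by (rule sum.cong) (auto simp: T1_def T2_def)
  also have "\<dots> = (\<Sum>l\<in>T1. ?f l) + (\<Sum>l\<in>T2. ?f l)"
    using T(1) by (intro sum.union_disjoint) (auto simp: T1_def T2_def)
  also have "(\<Sum>l\<in>T1. ?f l) \<le> (\<Sum>l\<in>T1. (1 / ?r) * (1 / cmod (l - z)))"
  proof (rule sum_mono)
    fix l assume "l \<in> T1"
    hence l: "l \<in> T" by (simp add: T1_def)
    have d: "0 < cmod (l - z)" using l T(2) z(1) by auto
    have "0 < cmod l" using T(3)[OF l] r by linarith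
    hence "?r / (cmod l)\<^sup>2 \<le> ?r / ?r\<^sup>2"
      using T(3)[OF l] r by (intro divide_left_mono power_mono mult_pos_pos zero_less_power) auto
    hence "?r / (cmod l)\<^sup>2 \<le> 1 / ?r" using r by (simp add: power2_eq_square)
    hence "?r / (cmod l)\<^sup>2 * (1 / cmod (l - z)) \<le> 1 / ?r * (1 / cmod (l - z))" by (rule mult_right_mono) auto
    thus "?f l \<le> (1 / ?r) * (1 / cmod (l - z))" by simp
  qed
  also have "\<dots> = (1 / ?r) * (\<Sum>l\<in>T1. 1 / cmod (l - z))" by (simp only: sum_distrib_left)
  also have "\<dots> \<le> (1 / ?r) * (16 * (3 * ?r))"
  proof (intro mult_left_mono sum_inverse_dist_le)
    show "cmod (l - z) \<le> 3 * ?r" if "l \<in> T1" for l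
      using that norm_triangle_ineq4[of l z] by (simp add: T1_def)
  qed (use T in \<open>auto simp: T1_def\<close>)
  also have "\<dots> = 48" using r by simp
  also have "(\<Sum>l\<in>T2. ?f l) \<le> (\<Sum>l\<in>T2. 2 * ?r * (1 / cmod l ^ 3))"
  proof (rule sum_mono)
    fix l assume "l \<in> T2"
    hence l: "2 * ?r < cmod l" by (simp add: T2_def)
    have "cmod l / 2 \<le> cmod (l - z)" using l norm_triangle_ineq2[of l z] by linarith
    hence "?f l \<le> ?r / ((cmod l)\<^sup>2 * (cmod l / 2))"
      using l r by (intro divide_left_mono mult_left_mono mult_pos_pos) (auto intro: order_less_le_trans)
    also have "\<dots> = 2 * ?r * (1 / cmod l ^ 3)" using l r by (simp add: power2_eq_square power3_eq_cube)
    finally show "?f l \<le> 2 * ?r * (1 / cmod l ^ 3)" .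
  qed
  also have "\<dots> = 2 * ?r * (\<Sum>l\<in>T2. 1 / cmod l ^ 3)" by (simp only: sum_distrib_left)
  also have "\<dots> \<le> 2 * ?r * (16 / (2 * ?r))"
    using T r by (intro mult_left_mono sum_inverse_cube_tail_le) (auto simp: T2_def)
  also have "\<dots> = 16" using r by simp
  finally show ?thesis by simp
qed

lemma finite_prod_le:
  assumes T: "finite T" "T \<subseteq> sq_lattice - A - {near z}" and z: "z \<notin> sq_lattice" "cmod z \<ge> 1"
  shows "(\<Prod>l\<in>T. cmod (1 - z / \<mu> l)) \<le> (\<Prod>l\<in>T. cmod (1 - z / l))
     * exp (- (\<Sum>l\<in>{l\<in>T. cmod l \<le> cmod z}. ln (cmod (\<mu> l / l)))) * exp (48 * C + 64 * (C / \<delta>))"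
proof -
  define T1 where "T1 = {l\<in>T. cmod l \<le> cmod z}"
  define T2 where "T2 = {l\<in>T. cmod z < cmod l}"
  have fin: "finite T1" "finite T2" and disj: "T1 \<inter> T2 = {}" and un: "T = T1 \<union> T2"
    using T(1) by (auto simp: T1_def T2_def)
  have zl: "z \<noteq> l" if "l \<in> T" for l using that T z by auto
  let ?e1 = "\<Sum>l\<in>T1. C * (1 / (cmod l * cmod (l - z)))"
  let ?e2 = "\<Sum>l\<in>T2. C / \<delta> * (cmod z / ((cmod l)\<^sup>2 * cmod (l - z)))"
  have "(\<Prod>l\<in>T1. cmod (1 - z / \<mu> l)) \<le> (\<Prod>l\<in>T1. cmod (1 - z / l) * exp (- ln (cmod (\<mu> l / l))) * exp (C * (1 / (cmod l * cmod (l - z)))))"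
    using T zl by (intro prod_mono conjI factor_le_inner) (auto simp: T1_def)
  also have "\<dots> = (\<Prod>l\<in>T1. cmod (1 - z / l)) * exp (- (\<Sum>l\<in>T1. ln (cmod (\<mu> l / l)))) * exp ?e1"
    by (simp only: prod.distrib exp_sum[OF fin(1)] sum_negf[symmetric])
  finally have 1: "(\<Prod>l\<in>T1. cmod (1 - z / \<mu> l)) \<le> (\<Prod>l\<in>T1. cmod (1 - z / l)) * exp (- (\<Sum>l\<in>T1. ln (cmod (\<mu> l / l)))) * exp ?e1" .
  have "(\<Prod>l\<in>T2. cmod (1 - z / \<mu> l)) \<le> (\<Prod>l\<in>T2. cmod (1 - z / l) * exp (C / \<delta> * (cmod z / ((cmod l)\<^sup>2 * cmod (l - z)))))"
    using T zl by (intro prod_mono conjI factor_le_outer) (auto simp: T2_def)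
  also have "\<dots> = (\<Prod>l\<in>T2. cmod (1 - z / l)) * exp ?e2"
    by (simp only: prod.distrib exp_sum[OF fin(2)])
  finally have 2: "(\<Prod>l\<in>T2. cmod (1 - z / \<mu> l)) \<le> (\<Prod>l\<in>T2. cmod (1 - z / l)) * exp ?e2" .
  have "?e1 = C * (\<Sum>l\<in>T1. 1 / (cmod l * cmod (l - z)))" by (simp only: sum_distrib_left)
  also have "\<dots> \<le> C * 48" using C T A z fin by (intro mult_left_mono inner_sum_le) (auto simp: T1_def)
  finally have e1: "?e1 \<le> 48 * C" by simp
  have "?e2 = C / \<delta> * (\<Sum>l\<in>T2. cmod z / ((cmod l)\<^sup>2 * cmod (l - z)))" by (simp only: sum_distrib_left)
  also have "\<dots> \<le> C / \<delta> * 64" using C T A z fin \<delta>(1) by (intro mult_left_mono outer_sum_le) (auto simp: T2_def)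
  also have "C / \<delta> * 64 = 64 * (C / \<delta>)" by simp
  finally have e2: "?e2 \<le> 64 * (C / \<delta>)" .
  have "(\<Prod>l\<in>T. cmod (1 - z / \<mu> l)) = (\<Prod>l\<in>T1. cmod (1 - z / \<mu> l)) * (\<Prod>l\<in>T2. cmod (1 - z / \<mu> l))"
    unfolding un by (rule prod.union_disjoint[OF fin disj])
  also have "\<dots> \<le> ((\<Prod>l\<in>T1. cmod (1 - z / l)) * exp (- (\<Sum>l\<in>T1. ln (cmod (\<mu> l / l)))) * exp ?e1) * ((\<Prod>l\<in>T2. cmod (1 - z / l)) * exp ?e2)"
    by (intro mult_mono 1 2 prod_nonneg mult_nonneg_nonneg) auto
  also have "\<dots> = (\<Prod>l\<in>T. cmod (1 - z / l)) * exp (- (\<Sum>l\<in>T1. ln (cmod (\<mu> l / l)))) * exp (?e1 + ?e2)"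
    unfolding un by (subst prod.union_disjoint[OF fin disj]) (simp only: exp_add mult_ac)
  also have "\<dots> \<le> (\<Prod>l\<in>T. cmod (1 - z / l)) * exp (- (\<Sum>l\<in>T1. ln (cmod (\<mu> l / l)))) * exp (48 * C + 64 * (C / \<delta>))"
    using e1 e2 by (intro mult_left_mono mult_nonneg_nonneg prod_nonneg) auto
  finally show ?thesis unfolding T1_def .
qed

lemma ln_ratio_le:
  assumes l: "l \<in> sq_lattice - A" shows "ln (cmod (\<mu> l / l)) \<le> ln (1 + C)"
proof -
  have l1: "1 \<le> cmod l" using cmod_lattice_ge[of l] l lattice_nonzero[OF l] by simp
  have "cmod (\<mu> l) \<le> cmod l + cmod (\<mu> l - l)" by norm
  also have "\<dots> \<le> cmod l + C * cmod l"
    using close'(1)[OF l] mult_left_mono[OF l1 C] by simp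
  finally have "cmod (\<mu> l) \<le> (1 + C) * cmod l" by (simp add: algebra_simps)
  moreover have "0 < cmod l" using l1 by linarith
  ultimately have "cmod (\<mu> l / l) \<le> 1 + C" by (simp add: norm_divide pos_divide_le_eq)
  thus ?thesis using nonzero[OF l] lattice_nonzero[OF l] by (intro ln_mono) auto
qed

text \<open>
  The factors of the sigma product that belong to the exceptional labels.
\<close>

definition A_poly :: "complex \<Rightarrow> real" where "A_poly z = cmod z * (\<Prod>l\<in>A - {0}. cmod (1 - z / l))"

lemma A_poly_ge:
  assumes "cmod z \<ge> 2 * (\<Sum>a\<in>A. cmod a)"
  shows "cmod z ^ card A * (\<Prod>l\<in>A - {0}. 1 / (2 * cmod l)) \<le> A_poly z"
proof -
  have "(\<Prod>l\<in>A - {0}. cmod z * (1 / (2 * cmod l))) \<le> (\<Prod>l\<in>A - {0}. cmod (1 - z / l))"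
  proof (intro prod_mono conjI)
    fix l assume l: "l \<in> A - {0}"
    have "cmod l \<le> (\<Sum>a\<in>A. cmod a)" using l A(1) by (intro member_le_sum) auto
    hence "2 * cmod l \<le> cmod z" using assms by simp
    moreover have "cmod (z / l) \<le> 1 + cmod (1 - z / l)"
      using norm_triangle_ineq4[of 1 "1 - z / l"] by simp
    moreover have "0 < cmod l" using l by simp
    ultimately show "cmod z * (1 / (2 * cmod l)) \<le> cmod (1 - z / l)"
      by (simp add: norm_divide field_simps)
  qed auto
  hence "cmod z * (\<Prod>l\<in>A - {0}. cmod z * (1 / (2 * cmod l))) \<le> A_poly z"
    unfolding A_poly_def by (rule mult_left_mono) auto
  moreover have "cmod z * (\<Prod>l\<in>A - {0}. cmod z * (1 / (2 * cmod l))) = cmod z ^ card A * (\<Prod>l\<in>A - {0}. 1 / (2 * cmod l))"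
    unfolding prod.distrib prod_constant card.remove[OF A(1) A(3)] power_Suc by (simp only: mult.assoc)
  ultimately show ?thesis by simp
qed

text \<open>
  Compare the partial products with those of \<open>\<sigma>\<close>, factor by factor, and pass to the limit.  The lattice
  point nearest to \<open>z\<close> is treated apart: there \<open>\<sigma>\<close> supplies a factor \<open>\<bar>z - p\<bar>\<close>, which cancels the small
  denominator, and \<open>\<bar>z - \<mu>\<^sub>p\<bar>\<close> is bounded.  Lattice points \<open>z\<close> themselves form a null set and are left out.
\<close>

theorem canonical_product_bound:
  assumes F: "\<And>z. (\<lambda>N. \<Prod>l\<in>lat_box N - A. 1 - z / \<mu> l) \<longlonglongrightarrow> F z"
  shows "\<exists>K>0. \<exists>R\<ge>1. \<forall>z. z \<notin> sq_lattice \<longrightarrow> R \<le> cmod z \<longrightarrow>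
           cmod (F z) * cmod z ^ card A \<le> K * exp ((cmod z)\<^sup>2 / 2 - B (cmod z))"
proof -
  obtain k K where k: "0 < k" and K: "0 < K"
    and lower: "\<And>z. k * cmod (z - near z) * exp ((cmod z)\<^sup>2 / 2) \<le> cmod (wsigma z)"
    and upper: "\<And>z. cmod (wsigma z) \<le> K * cmod (z - near z) * exp ((cmod z)\<^sup>2 / 2)"
    by (rule sigma_bounds) (rule that, assumption+)
  define M where "M = 48 * C + 64 * (C / \<delta>)"
  define c where "c = (\<Prod>l\<in>A - {0}. 1 / (2 * cmod l))"
  have c: "c > 0" unfolding c_def by (intro prod_pos) auto
  \<comment> \<open>Large enough for the lattice point nearest to \<open>z\<close> to be unexceptional, and for \<open>A_poly_ge\<close>.\<close>
  define R where "R = 3 + 2 * (\<Sum>a\<in>A. cmod a)"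
  have R: "R \<ge> 3" unfolding R_def by (simp add: sum_nonneg)
  \<comment> \<open>The constants come from the nearest label, the upper bound for \<open>\<sigma>\<close>, the term of the nearest label
      in \<open>B\<close>, the two error sums and the exceptional labels.\<close>
  define K0 where "K0 = (C + 2) / \<delta> * K * (1 + C) * exp M / c"
  have "K0 > 0" unfolding K0_def using C \<delta>(1) K c by simp
  moreover have "cmod (F z) * cmod z ^ card A \<le> K0 * exp ((cmod z)\<^sup>2 / 2 - B (cmod z))"
    if z: "z \<notin> sq_lattice" and zR: "R \<le> cmod z" for z
  proof -
    let ?r = "cmod z" and ?B = "B (cmod z)"
    define p where "p = near z"
    have pA: "p \<in> sq_lattice - A"
    proof -
      have "cmod z - 2 \<le> cmod p" using cmod_diff_near_le[of z] norm_triangle_ineq2[of z p] by (simp add: p_def)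
      moreover have "cmod p \<le> (\<Sum>a\<in>A. cmod a)" if "p \<in> A" using that A(1) by (intro member_le_sum) auto
      moreover have "0 \<le> (\<Sum>a\<in>A. cmod a)" by (rule sum_nonneg) auto
      ultimately show ?thesis using zR unfolding R_def by (auto simp: p_def)
    qed
    have p0: "cmod p > 0" using lattice_nonzero[OF pA] by simp
    have zp: "cmod (z - p) > 0" using pA z by auto
    have z0: "?r > 0" using zR R by linarith
    have Ap: "A_poly z > 0"
    proof -
      have "z \<noteq> l" if "l \<in> A" for l using that z A by auto
      thus ?thesis unfolding A_poly_def using z0 by (intro mult_pos_pos prod_pos) auto
    qed
    define T where "T N = lat_box N - A - {p}" for N
    define P where "P N = (\<Prod>l\<in>T N. cmod (1 - z / l))" for N
    have fp: "cmod (1 - z / \<mu> p) \<le> (C + 2) / (\<delta> * cmod p)"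
    proof -
      have "cmod (\<mu> p - z) \<le> cmod (\<mu> p - p) + cmod (z - p)" by norm
      also have "\<dots> \<le> C + 2" using close'(1)[OF pA] cmod_diff_near_le[of z] by (simp add: p_def)
      finally have 1: "cmod (\<mu> p - z) \<le> C + 2" .
      have "cmod (1 - z / \<mu> p) = cmod (\<mu> p - z) / cmod (\<mu> p)"
        using nonzero[OF pA] by (simp add: norm_divide[symmetric] diff_divide_distrib)
      also have "\<dots> \<le> (C + 2) / (\<delta> * cmod p)"
        using 1 \<delta>(1) \<delta>(2)[OF pA] p0 C by (intro frac_le) auto
      finally show ?thesis .
    qed
    have ev: "eventually (\<lambda>N. A \<union> {p} \<union> {l\<in>sq_lattice. cmod l \<le> ?r} \<subseteq> lat_box N) sequentially"
      using A pA finite_lattice_disc by (intro eventually_in_lat_box) auto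
    have bound: "eventually (\<lambda>N. cmod (\<Prod>l\<in>lat_box N - A. 1 - z / \<mu> l) \<le> (C + 2) / (\<delta> * cmod p) * (P N * ((1 + C) * exp (- ?B) * exp M))) sequentially"
      using ev
    proof eventually_elim
      case (elim N)
      have TN: "finite (T N)" "T N \<subseteq> sq_lattice - A - {near z}"
        using lat_box_subset by (auto simp: T_def p_def)
      have "cmod (\<Prod>l\<in>lat_box N - A. 1 - z / \<mu> l) = (\<Prod>l\<in>lat_box N - A. cmod (1 - z / \<mu> l))"
        by (rule prod_norm[symmetric])
      also have "\<dots> = cmod (1 - z / \<mu> p) * (\<Prod>l\<in>T N. cmod (1 - z / \<mu> l))"
        unfolding T_def using elim pA by (intro prod.remove) auto
      also have "\<dots> \<le> (C + 2) / (\<delta> * cmod p) * (P N * exp (- (\<Sum>l\<in>{l\<in>T N. cmod l \<le> ?r}. ln (cmod (\<mu> l / l)))) * exp M)"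
        unfolding P_def M_def using fp zR R z C \<delta>(1)
        by (intro mult_mono finite_prod_le TN prod_nonneg) auto
      also have "\<dots> \<le> (C + 2) / (\<delta> * cmod p) * (P N * ((1 + C) * exp (- ?B)) * exp M)"
      proof (intro mult_left_mono mult_right_mono)
        have eq: "{l\<in>T N. cmod l \<le> ?r} = {l\<in>sq_lattice - A. cmod l \<le> ?r} - {p}"
          using elim lat_box_subset by (auto simp: T_def)
        have fin: "finite {l\<in>sq_lattice - A. cmod l \<le> ?r}"
          by (rule finite_subset[OF _ finite_lattice_disc[of ?r]]) auto
        have "?B - ln (1 + C) \<le> (\<Sum>l\<in>{l\<in>T N. cmod l \<le> ?r}. ln (cmod (\<mu> l / l)))"
        proof (cases "cmod p \<le> ?r")
          case True
          hence "?B = ln (cmod (\<mu> p / p)) + (\<Sum>l\<in>{l\<in>T N. cmod l \<le> ?r}. ln (cmod (\<mu> l / l)))"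
            unfolding eq log_displacement_def using pA fin by (intro sum.remove) auto
          thus ?thesis using ln_ratio_le[OF pA] by simp
        next
          case False
          hence "?B = (\<Sum>l\<in>{l\<in>T N. cmod l \<le> ?r}. ln (cmod (\<mu> l / l)))"
            unfolding eq log_displacement_def by (intro sum.cong) auto
          thus ?thesis using C by simp
        qed
        hence "exp (- (\<Sum>l\<in>{l\<in>T N. cmod l \<le> ?r}. ln (cmod (\<mu> l / l)))) \<le> exp (ln (1 + C) + - ?B)" by simp
        also have "\<dots> = (1 + C) * exp (- ?B)" using C by (subst exp_add) simp
        finally show "exp (- (\<Sum>l\<in>{l\<in>T N. cmod l \<le> ?r}. ln (cmod (\<mu> l / l)))) \<le> (1 + C) * exp (- ?B)" .
      qed (use C \<delta>(1) in \<open>auto simp: P_def intro!: prod_nonneg divide_nonneg_nonneg mult_nonneg_nonneg\<close>)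
      finally show ?case by (simp only: mult.assoc)
    qed
    have Plim: "P \<longlonglongrightarrow> cmod (wsigma z) / (A_poly z * cmod (1 - z / p))"
    proof (rule Lim_transform_eventually)
      show "(\<lambda>N. cmod (z * (\<Prod>l\<in>lat_box N - {0}. 1 - z / l)) / (A_poly z * cmod (1 - z / p))) \<longlonglongrightarrow> cmod (wsigma z) / (A_poly z * cmod (1 - z / p))"
        using Ap zp p0 by (intro tendsto_intros sigma_lim) (auto simp: field_simps)
      show "eventually (\<lambda>N. cmod (z * (\<Prod>l\<in>lat_box N - {0}. 1 - z / l)) / (A_poly z * cmod (1 - z / p)) = P N) sequentially"
        using ev
      proof eventually_elim
        case (elim N)
        have "lat_box N - {0} = (A - {0}) \<union> (lat_box N - A)" using elim A(3) by auto
        hence "(\<Prod>l\<in>lat_box N - {0}. cmod (1 - z / l)) = (\<Prod>l\<in>A - {0}. cmod (1 - z / l)) * (\<Prod>l\<in>lat_box N - A. cmod (1 - z / l))"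
          using A(1) by (simp only:) (intro prod.union_disjoint; auto)
        also have "(\<Prod>l\<in>lat_box N - A. cmod (1 - z / l)) = cmod (1 - z / p) * P N"
          unfolding P_def T_def using elim pA by (intro prod.remove) auto
        finally have "cmod (z * (\<Prod>l\<in>lat_box N - {0}. 1 - z / l)) = (A_poly z * cmod (1 - z / p)) * P N"
          by (simp add: A_poly_def norm_mult prod_norm[symmetric] mult_ac)
        moreover have "A_poly z * cmod (1 - z / p) \<noteq> 0" using Ap zp p0 by (auto simp: field_simps)
        ultimately show ?case by simp
      qed
    qed
    have "cmod (F z) \<le> (C + 2) / (\<delta> * cmod p) * (cmod (wsigma z) / (A_poly z * cmod (1 - z / p)) * ((1 + C) * exp (- ?B) * exp M))"
      by (rule tendsto_le[OF sequentially_bot _ _ bound]) (intro tendsto_intros Plim F)+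
    also have "\<dots> \<le> (C + 2) / (\<delta> * cmod p) * ((K * cmod (z - p) * exp (?r\<^sup>2 / 2)) / (A_poly z * cmod (1 - z / p)) * ((1 + C) * exp (- ?B) * exp M))"
      using upper[of z] C \<delta>(1) Ap unfolding p_def
      by (intro mult_left_mono mult_right_mono divide_right_mono) auto
    also have "cmod (1 - z / p) = cmod (z - p) / cmod p"
      using p0 by (simp add: norm_divide[symmetric] diff_divide_distrib norm_minus_commute)
    also have "(C + 2) / (\<delta> * cmod p) * ((K * cmod (z - p) * exp (?r\<^sup>2 / 2)) / (A_poly z * (cmod (z - p) / cmod p)) * ((1 + C) * exp (- ?B) * exp M))
       = ((C + 2) / \<delta> * K * (1 + C) * exp M) * (exp (?r\<^sup>2 / 2) * exp (- ?B)) / A_poly z"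
      using p0 zp Ap \<delta>(1) by (simp add: field_simps)
    also have "exp (?r\<^sup>2 / 2) * exp (- ?B) = exp (?r\<^sup>2 / 2 - ?B)" by (simp flip: exp_add)
    finally have "cmod (F z) * A_poly z \<le> ((C + 2) / \<delta> * K * (1 + C) * exp M) * exp (?r\<^sup>2 / 2 - ?B)"
      using Ap by (simp only: pos_le_divide_eq)
    moreover have "cmod (F z) * (cmod z ^ card A * c) \<le> cmod (F z) * A_poly z"
      unfolding c_def using zR by (intro mult_left_mono A_poly_ge) (auto simp: R_def)
    ultimately have "(cmod (F z) * cmod z ^ card A) * c \<le> ((C + 2) / \<delta> * K * (1 + C) * exp M) * exp (?r\<^sup>2 / 2 - ?B)"
      by (simp add: mult.assoc)
    hence "cmod (F z) * cmod z ^ card A \<le> (((C + 2) / \<delta> * K * (1 + C) * exp M) * exp (?r\<^sup>2 / 2 - ?B)) / c"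
      using c by (simp only: pos_le_divide_eq)
    thus ?thesis by (simp add: K0_def)
  qed
  ultimately show ?thesis using R by (intro exI[of _ K0] exI[of _ R] conjI allI impI) auto
qed

end

section \<open>Counting lattice points with logarithmic weight\<close>

text \<open>
  With \<open>inverse 0 = \<infinity>\<close> in the extended nonnegative reals, the value at the zeros of the sine is infinite
  and inequalities hold everywhere.
\<close>

definition isqrt_sin :: "real \<Rightarrow> ennreal" where
  "isqrt_sin u = inverse (ennreal (sqrt \<bar>sin u\<bar>))"

lemma isqrt_sin_measurable [measurable]: "isqrt_sin \<in> borel_measurable borel"
  unfolding isqrt_sin_def [abs_def] by measurable

abbreviation isqrt_dist :: "complex \<Rightarrow> ennreal" where
  "isqrt_dist z \<equiv> inverse (ennreal (sqrt (cmod (z - near z))))"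

lemma inverse_ennreal_le:
  assumes "0 < c" "0 \<le> y" "c * y \<le> x"
  shows "inverse (ennreal x) \<le> ennreal (1 / c) * inverse (ennreal y)"
proof (cases "y = 0")
  case True
  thus ?thesis using assms by (simp add: ennreal_mult_top)
next
  case False
  hence y: "0 < y" using assms by simp
  hence "0 < c * y" using assms by simp
  moreover from this have "0 < x" using assms by linarith
  ultimately have "inverse x \<le> inverse (c * y)" using assms(3) by (intro le_imp_inverse_le) auto
  thus ?thesis using assms y \<open>0 < x\<close>
    by (simp add: inverse_ennreal ennreal_mult[symmetric] ennreal_leI divide_inverse)
qed

lemma sin_ge_half:
  assumes "0 \<le> u" "u \<le> pi / 2" shows "u / 2 \<le> sin u"
proof -
  have *: "5/6 * x \<le> sin x" if "0 \<le> x" "x \<le> 1" for x :: real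
  proof -
    have "\<bar>sin x - (\<Sum>m<3. sin_coeff m * x ^ m)\<bar> \<le> inverse (fact 3) * \<bar>x\<bar> ^ 3"
      by (rule Maclaurin_sin_bound)
    moreover have "(\<Sum>m<3. sin_coeff m * x ^ m) = x"
      by (simp add: numeral_3_eq_3 sin_coeff_def)
    moreover have "inverse (fact 3) = (1/6 :: real)" by (simp add: fact_numeral)
    ultimately have "\<bar>sin x - x\<bar> \<le> x ^ 3 / 6" using that by simp
    moreover have "x ^ 3 \<le> x" using power_decreasing[of 1 3 x] that by simp
    ultimately show ?thesis by linarith
  qed
  show ?thesis
  proof (cases "u \<le> 1")
    case True
    thus ?thesis using *[of u] assms by linarith
  next
    case False
    have "sin 1 \<le> sin u" by (rule sin_monotone_2pi_le) (use assms False pi_gt3 in auto)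
    moreover have "5/6 \<le> sin (1::real)" using *[of 1] by simp
    moreover have "pi < 10/3" using pi_approx(2) by simp
    hence "u / 2 \<le> 5/6" using assms(2) by linarith
    ultimately show ?thesis by linarith
  qed
qed

lemma isqrt_sin_period_finite: "(\<integral>\<^sup>+u\<in>{0..pi}. isqrt_sin u \<partial>lborel) < \<infinity>"
proof -
  let ?g = "\<lambda>u::real. inverse (ennreal (sqrt u))"
  have fin: "(\<integral>\<^sup>+u\<in>{0..pi}. ?g u \<partial>lborel) < \<infinity>"
  proof -
    have "(\<integral>\<^sup>+u\<in>{0..pi}. ?g u \<partial>lborel) = (\<integral>\<^sup>+u\<in>{0..pi}. ennreal (u powr (-1/2)) \<partial>lborel)"
    proof (rule nn_integral_cong_AE)
      show "AE u in lborel. ?g u * indicator {0..pi} u = ennreal (u powr (-1/2)) * indicator {0..pi} u"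
        using AE_lborel_singleton[of "0::real"]
        by eventually_elim (auto simp: indicator_def inverse_ennreal powr_minus powr_half_sqrt)
    qed
    also have "\<dots> = ennreal (pi powr (-1/2 + 1) / (-1/2 + 1))"
      by (rule nn_integral_has_integral_lebesgue'[OF _ has_integral_powr_from_0]) auto
    finally show ?thesis by simp
  qed
  have "(\<integral>\<^sup>+u\<in>{0..pi}. isqrt_sin u \<partial>lborel) \<le> (\<integral>\<^sup>+u. 2 * (?g u * indicator {0..pi} u) + 2 * (?g (pi - u) * indicator {0..pi} u) \<partial>lborel)"
  proof (intro nn_integral_mono)
    fix u :: real
    have half: "isqrt_sin v \<le> 2 * ?g v" if v: "0 \<le> v" "v \<le> pi / 2" for v
    proof -
      have "1/2 * sqrt v = sqrt (v / 4)" by (simp add: real_sqrt_divide)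
      also have "\<dots> \<le> sqrt \<bar>sin v\<bar>" using sin_ge_half[OF v] v by (intro real_sqrt_le_mono) linarith
      finally have "isqrt_sin v \<le> ennreal (1 / (1/2)) * ?g v"
        unfolding isqrt_sin_def using v by (intro inverse_ennreal_le) auto
      thus ?thesis by simp
    qed
    show "isqrt_sin u * indicator {0..pi} u \<le> 2 * (?g u * indicator {0..pi} u) + 2 * (?g (pi - u) * indicator {0..pi} u)"
    proof (cases "u \<in> {0..pi}")
      case True
      have "isqrt_sin u \<le> 2 * ?g u + 2 * ?g (pi - u)"
      proof (cases "u \<le> pi / 2")
        case True
        thus ?thesis using half[of u] \<open>u \<in> {0..pi}\<close> by (auto intro: add_increasing2)
      next
        case False
        have "isqrt_sin u = isqrt_sin (pi - u)" by (simp add: isqrt_sin_def)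
        thus ?thesis using half[of "pi - u"] False \<open>u \<in> {0..pi}\<close> by (auto intro: add_increasing)
      qed
      thus ?thesis using True by simp
    qed auto
  qed
  also have "\<dots> = 2 * (\<integral>\<^sup>+u\<in>{0..pi}. ?g u \<partial>lborel) + 2 * (\<integral>\<^sup>+u\<in>{0..pi}. ?g (pi - u) \<partial>lborel)"
    by (subst nn_integral_add) (auto simp: nn_integral_cmult)
  also have "(\<integral>\<^sup>+u\<in>{0..pi}. ?g (pi - u) \<partial>lborel) = (\<integral>\<^sup>+u\<in>{0..pi}. ?g u \<partial>lborel)"
    by (subst (2) nn_integral_real_affine[where c="-1" and t=pi]) (auto intro!: nn_integral_cong simp: indicator_def)
  finally show ?thesis using fin by (auto simp: ennreal_mult_less_top intro: order_le_less_trans)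
qed

lemma isqrt_sin_integral_le:
  assumes "a > 0"
  shows "(\<integral>\<^sup>+u\<in>{0..a}. isqrt_sin u \<partial>lborel) \<le> ennreal (a / pi + 1) * (\<integral>\<^sup>+u\<in>{0..pi}. isqrt_sin u \<partial>lborel)"
proof -
  let ?I = "\<integral>\<^sup>+u\<in>{0..pi}. isqrt_sin u \<partial>lborel"
  have per: "(\<integral>\<^sup>+u\<in>{0..real n * pi}. isqrt_sin u \<partial>lborel) \<le> of_nat n * ?I" for n
  proof (induction n)
    case 0
    have "(\<integral>\<^sup>+u\<in>{0..(0::real)}. isqrt_sin u \<partial>lborel) = (\<integral>\<^sup>+u. 0 \<partial>(lborel :: real measure))"
      by (rule nn_integral_cong_AE, use AE_lborel_singleton[of "0::real"] in eventually_elim) auto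
    thus ?case by simp
  next
    case (Suc n)
    have "(\<integral>\<^sup>+u\<in>{n*pi+0..n*pi+pi}. isqrt_sin u \<partial>lborel) = (\<integral>\<^sup>+u\<in>{0..pi}. isqrt_sin (n*pi + u) \<partial>lborel)"
      by (rule nn_integral_interval_shift[symmetric]) measurable
    also have "\<dots> = ?I"
    proof -
      have "isqrt_sin (n*pi + u) = isqrt_sin u" for u
        by (simp add: isqrt_sin_def sin_add abs_mult power_abs)
      thus ?thesis by simp
    qed
    finally have q: "(\<integral>\<^sup>+u\<in>{n*pi..Suc n*pi}. isqrt_sin u \<partial>lborel) = ?I" by (simp add: algebra_simps)
    have "(\<integral>\<^sup>+u\<in>{0..Suc n*pi}. isqrt_sin u \<partial>lborel) =
       (\<integral>\<^sup>+u\<in>{0..n*pi}. isqrt_sin u \<partial>lborel) + (\<integral>\<^sup>+u\<in>{n*pi..Suc n*pi}. isqrt_sin u \<partial>lborel)"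
      by (rule nn_integral_interval_concat[symmetric]) (rule isqrt_sin_measurable, auto simp: algebra_simps)
    also have "\<dots> \<le> of_nat n * ?I + ?I" using Suc unfolding q by (rule add_right_mono)
    also have "\<dots> = of_nat (Suc n) * ?I" by (simp add: distrib_right add.commute)
    finally show ?case .
  qed
  define n where "n = nat \<lceil>a / pi\<rceil>"
  have n: "a / pi \<le> real n" "real n \<le> a / pi + 1"
  proof -
    have "0 \<le> a / pi" using assms by simp
    thus "a / pi \<le> real n" "real n \<le> a / pi + 1" unfolding n_def by linarith+
  qed
  have "a \<le> real n * pi" using n(1) by (simp add: field_simps)
  hence "(\<integral>\<^sup>+u\<in>{0..a}. isqrt_sin u \<partial>lborel) \<le> (\<integral>\<^sup>+u\<in>{0..real n * pi}. isqrt_sin u \<partial>lborel)"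
    by (intro nn_integral_mono mult_left_mono indicator_leI) auto
  also have "\<dots> \<le> of_nat n * ?I" by (rule per)
  also have "\<dots> \<le> ennreal (a / pi + 1) * ?I"
    using n(2) by (intro mult_right_mono) (auto simp: ennreal_of_nat_eq_real_of_nat intro: ennreal_leI)
  finally show ?thesis .
qed

lemma quarter_arc_integral:
  assumes a: "a > 0"
  shows "(\<integral>\<^sup>+t\<in>{0..pi/2}. ennreal (cos t) * isqrt_sin (a * sin t) \<partial>lborel) = ennreal (1/a) * (\<integral>\<^sup>+u\<in>{0..a}. isqrt_sin u \<partial>lborel)" (is ?A)
    and "(\<integral>\<^sup>+t\<in>{0..pi/2}. ennreal (sin t) * isqrt_sin (a * cos t) \<partial>lborel) = ennreal (1/a) * (\<integral>\<^sup>+u\<in>{0..a}. isqrt_sin u \<partial>lborel)" (is ?B)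
proof -
  have "(\<integral>\<^sup>+u. isqrt_sin u * indicator {a * sin 0..a * sin (pi/2)} u \<partial>lborel) =
      (\<integral>\<^sup>+t. isqrt_sin (a * sin t) * ennreal (a * cos t) * indicator {0..pi/2} t \<partial>lborel)"
    by (rule nn_integral_substitution_aux)
       (use a in \<open>auto intro!: derivative_eq_intros continuous_intros mult_nonneg_nonneg cos_ge_zero\<close>)
  also have "\<dots> = (\<integral>\<^sup>+t. ennreal a * (ennreal (cos t) * isqrt_sin (a * sin t) * indicator {0..pi/2} t) \<partial>lborel)"
    using a by (intro nn_integral_cong) (auto simp: indicator_def ennreal_mult cos_ge_zero mult_ac)
  also have "\<dots> = ennreal a * (\<integral>\<^sup>+t\<in>{0..pi/2}. ennreal (cos t) * isqrt_sin (a * sin t) \<partial>lborel)"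
    by (rule nn_integral_cmult) measurable
  finally have "ennreal (1/a) * (\<integral>\<^sup>+u\<in>{0..a}. isqrt_sin u \<partial>lborel) =
     (ennreal (1/a) * ennreal a) * (\<integral>\<^sup>+t\<in>{0..pi/2}. ennreal (cos t) * isqrt_sin (a * sin t) \<partial>lborel)"
    by (simp add: mult.assoc)
  also have "ennreal (1/a) * ennreal a = 1" using a by (simp flip: ennreal_mult)
  finally show A: ?A by simp
  have "(\<integral>\<^sup>+t\<in>{0..pi/2}. ennreal (cos t) * isqrt_sin (a * sin t) \<partial>lborel) = (\<integral>\<^sup>+t\<in>{0..pi/2}. ennreal (sin t) * isqrt_sin (a * cos t) \<partial>lborel)"
    by (subst nn_integral_real_affine[where c="-1" and t="pi/2"])
       (auto intro!: nn_integral_cong simp: indicator_def sin_diff cos_diff)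
  with A show ?B by simp
qed

text \<open>
  The sine of \<open>\<surd>\<pi> x\<close> vanishes exactly when \<open>x\<close> is a coordinate of a lattice point, so it is dominated by the
  distance of \<open>z\<close> to the lattice: a two-dimensional singularity is replaced by a one-dimensional
  periodic one.
\<close>

lemma sin_le_dist_lattice:
  "\<bar>sin (sqrt pi * Re z)\<bar> \<le> 2 * cmod (z - near z)" "\<bar>sin (sqrt pi * Im z)\<bar> \<le> 2 * cmod (z - near z)"
proof -
  have *: "\<bar>sin (sqrt pi * x)\<bar> \<le> 2 * \<bar>x - sqrt pi * of_int k\<bar>" for x and k :: int
  proof -
    have "\<bar>sin (sqrt pi * (x - sqrt pi * of_int k))\<bar> = \<bar>sin (sqrt pi * x)\<bar>"
    proof -
      have "sqrt pi * (x - sqrt pi * of_int k) = sqrt pi * x - of_int k * pi"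
        by (simp add: algebra_simps flip: mult.assoc)
      moreover have sk: "sin (of_int k * pi) = 0" by (simp add: sin_times_pi_eq_0)
      moreover have "\<bar>cos (of_int k * pi)\<bar> = 1" by (rule sin_zero_abs_cos_one[OF sk])
      ultimately show ?thesis by (simp only: sin_diff abs_mult mult_zero_right diff_zero mult_1_right)
    qed
    moreover have "\<bar>sin (sqrt pi * (x - sqrt pi * of_int k))\<bar> \<le> \<bar>sqrt pi * (x - sqrt pi * of_int k)\<bar>" by (rule abs_sin_x_le_abs_x)
    moreover have "\<bar>sqrt pi * (x - sqrt pi * of_int k)\<bar> \<le> 2 * \<bar>x - sqrt pi * of_int k\<bar>"
      unfolding abs_mult using sqrt_pi_bounds(2) by (intro mult_right_mono) auto
    ultimately show ?thesis by linarith
  qed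
  show "\<bar>sin (sqrt pi * Re z)\<bar> \<le> 2 * cmod (z - near z)"
    using *[of "Re z" "fst (near_idx z)"] abs_Re_le_cmod[of "z - near z"] by (simp add: near_def Re_gauss_pt)
  show "\<bar>sin (sqrt pi * Im z)\<bar> \<le> 2 * cmod (z - near z)"
    using *[of "Im z" "snd (near_idx z)"] abs_Im_le_cmod[of "z - near z"] by (simp add: near_def Im_gauss_pt)
qed

text \<open>
  At each point of the circle one of the coordinates moves with speed at least a fixed fraction of \<open>r\<close>.
  With that coordinate as variable, the singular integrand becomes \<open>isqrt_sin\<close> over an interval of length
  \<open>O(r)\<close>, whose integral is \<open>O(r)\<close> by periodicity; the speed divides \<open>r\<close> out again.
\<close>

lemma circle_isqrt_dist_bound:
  obtains K where "0 < K" "\<And>r::real. r \<ge> 1 \<Longrightarrow>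
    (\<integral>\<^sup>+t\<in>{0..2*pi}. isqrt_dist (of_real r * cis t) \<partial>lborel) \<le> ennreal K"
proof -
  let ?s = "sqrt pi"
  let ?I = "\<integral>\<^sup>+u\<in>{0..pi}. isqrt_sin u \<partial>lborel"
  obtain I where I: "?I = ennreal I" "I \<ge> 0"
    using isqrt_sin_period_finite by (cases ?I) auto
  define K where "K = 64 * (I + 1)"
  have K0: "0 < K" using I by (simp add: K_def)
  have bnd: "(\<integral>\<^sup>+t\<in>{0..2*pi}. isqrt_dist (of_real r * cis t) \<partial>lborel) \<le> ennreal K"
    if r: "r \<ge> 1" for r :: real
  proof -
    define G where "G z = ennreal (4 * \<bar>Re z\<bar> / r) * isqrt_sin (?s * Im z) + ennreal (4 * \<bar>Im z\<bar> / r) * isqrt_sin (?s * Re z)" for z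
    have [measurable]: "G \<in> borel_measurable borel"
      unfolding G_def [abs_def] by measurable
    have iG: "G (\<i> * z) = G z" for z
      by (simp add: G_def isqrt_sin_def add.commute)
    have iG': "G (\<i> ^ k * z) = G z" for k z
      by (induction k) (simp_all add: iG mult.assoc)
    have ptw: "isqrt_dist z \<le> G z" if z: "cmod z = r" for z
    proof -
      have Re: "isqrt_dist z \<le> ennreal 2 * isqrt_sin u"
        if "\<bar>sin u\<bar> \<le> 2 * cmod (z - near z)" for u
      proof -
        have "1/2 * sqrt \<bar>sin u\<bar> = sqrt (\<bar>sin u\<bar> / 4)" by (simp add: real_sqrt_divide)
        also have "\<dots> \<le> sqrt (cmod (z - near z))" using that by (intro real_sqrt_le_mono) linarith
        finally have "isqrt_dist z \<le> ennreal (1 / (1/2)) * isqrt_sin u"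
          unfolding isqrt_sin_def by (intro inverse_ennreal_le) auto
        thus ?thesis by simp
      qed
      have "r \<le> \<bar>Re z\<bar> + \<bar>Im z\<bar>" using cmod_le[of z] z by simp
      then consider "r \<le> 2 * \<bar>Re z\<bar>" | "r \<le> 2 * \<bar>Im z\<bar>" by linarith
      thus ?thesis
      proof cases
        case 1
        hence "2 \<le> 4 * \<bar>Re z\<bar> / r" using r by (simp add: field_simps)
        hence "ennreal 2 * isqrt_sin (?s * Im z) \<le> ennreal (4 * \<bar>Re z\<bar> / r) * isqrt_sin (?s * Im z)"
          by (intro mult_right_mono ennreal_leI) auto
        also have "\<dots> \<le> G z" unfolding G_def by (simp add: add_increasing2)
        finally show ?thesis using Re[OF sin_le_dist_lattice(2)] order_trans by blast
      next
        case 2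
        hence "2 \<le> 4 * \<bar>Im z\<bar> / r" using r by (simp add: field_simps)
        hence "ennreal 2 * isqrt_sin (?s * Re z) \<le> ennreal (4 * \<bar>Im z\<bar> / r) * isqrt_sin (?s * Re z)"
          by (intro mult_right_mono ennreal_leI) auto
        also have "\<dots> \<le> G z" unfolding G_def by (simp add: add_increasing)
        finally show ?thesis using Re[OF sin_le_dist_lattice(1)] order_trans by blast
      qed
    qed
    have sr: "?s * r > 0" using r by simp
    have quarter: "(\<integral>\<^sup>+t\<in>{0..pi/2}. G (r * cis t) \<partial>lborel) \<le> ennreal (16 * (I + 1))"
    proof -
      have "(\<integral>\<^sup>+t\<in>{0..pi/2}. G (r * cis t) \<partial>lborel) =
         (\<integral>\<^sup>+t. 4 * (ennreal (cos t) * isqrt_sin ((?s * r) * sin t) * indicator {0..pi/2} t) + 4 * (ennreal (sin t) * isqrt_sin ((?s * r) * cos t) * indicator {0..pi/2} t) \<partial>lborel)"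
      proof (intro nn_integral_cong)
        fix t
        show "G (r * cis t) * indicator {0..pi/2} t = 4 * (ennreal (cos t) * isqrt_sin ((?s * r) * sin t) * indicator {0..pi/2} t) + 4 * (ennreal (sin t) * isqrt_sin ((?s * r) * cos t) * indicator {0..pi/2} t)"
        proof (cases "t \<in> {0..pi/2}")
          case True
          have "0 \<le> cos t" "0 \<le> sin t" using True by (auto intro!: cos_ge_zero sin_ge_zero)
          thus ?thesis using True r by (simp add: G_def abs_mult ennreal_mult mult_ac)
        qed auto
      qed
      also have "\<dots> = 4 * (\<integral>\<^sup>+t\<in>{0..pi/2}. ennreal (cos t) * isqrt_sin ((?s * r) * sin t) \<partial>lborel)
          + 4 * (\<integral>\<^sup>+t\<in>{0..pi/2}. ennreal (sin t) * isqrt_sin ((?s * r) * cos t) \<partial>lborel)"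
        by (subst nn_integral_add) (auto simp: nn_integral_cmult)
      also have "\<dots> = 8 * (ennreal (1/(?s * r)) * (\<integral>\<^sup>+u\<in>{0..?s * r}. isqrt_sin u \<partial>lborel))"
        unfolding quarter_arc_integral[OF sr] by (simp add: distrib_right[symmetric])
      also have "\<dots> \<le> 8 * (ennreal (1/(?s * r)) * (ennreal (?s * r / pi + 1) * ennreal I))"
        using isqrt_sin_integral_le[OF sr] unfolding I(1) by (intro mult_left_mono) auto
      also have "\<dots> = ennreal (8 * (1/(?s * r) * ((?s * r / pi + 1) * I)))"
      proof -
        have gen: "8 * (ennreal x * (ennreal y * ennreal I)) = ennreal (8 * (x * (y * I)))" if "0 \<le> x" "0 \<le> y" for x y
          using that I(2) by (simp add: ennreal_mult)
        show ?thesis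
        proof (rule gen)
          show "0 \<le> 1 / (?s * r)" using sr by (intro divide_nonneg_pos) auto
          show "0 \<le> ?s * r / pi + 1" using sr by (intro add_nonneg_nonneg divide_nonneg_pos) auto
        qed
      qed
      also have "\<dots> \<le> ennreal (16 * (I + 1))"
      proof (rule ennreal_leI)
        have "1 * 1 \<le> ?s * r" using sqrt_pi_bounds(1) r by (intro mult_mono; linarith)
        hence "1 / (?s * r) \<le> 1" by simp
        moreover have "1 / pi \<le> 1" using pi_gt3 by simp
        moreover have "1/(?s * r) * (?s * r / pi + 1) = 1 / pi + 1 / (?s * r)"
          using r by (simp add: field_simps)
        ultimately have "1/(?s * r) * (?s * r / pi + 1) \<le> 2" by linarith
        hence "1/(?s * r) * (?s * r / pi + 1) * I \<le> 2 * I" using I(2) by (rule mult_right_mono)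
        thus "8 * (1/(?s * r) * ((?s * r / pi + 1) * I)) \<le> 16 * (I + 1)" by (simp add: mult.assoc)
      qed
      finally show ?thesis .
    qed
    have "(\<integral>\<^sup>+t\<in>{0..2*pi}. isqrt_dist (of_real r * cis t) \<partial>lborel) \<le> (\<integral>\<^sup>+t\<in>{0..2*pi}. G (r * cis t) \<partial>lborel)"
      using r by (intro nn_integral_mono mult_right_mono ptw) (auto simp: norm_mult)
    also have "\<dots> = (\<Sum>k<4. \<integral>\<^sup>+t\<in>{0..pi/2}. G (r * (\<i> ^ k * cis t)) \<partial>lborel)"
      by (rule circle_integral_quadrants) measurable
    also have "\<dots> = (\<Sum>k<4::nat. \<integral>\<^sup>+t\<in>{0..pi/2}. G (r * cis t) \<partial>lborel)"
    proof (intro sum.cong refl nn_integral_cong)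
      fix k :: nat and t
      have "of_real r * (\<i> ^ k * cis t) = \<i> ^ k * (of_real r * cis t)" by (simp add: mult_ac)
      thus "G (r * (\<i> ^ k * cis t)) * indicator {0..pi/2} t = G (r * cis t) * indicator {0..pi/2} t"
        by (simp only: iG')
    qed
    also have "\<dots> \<le> (\<Sum>k<4::nat. ennreal (16 * (I + 1)))" by (intro sum_mono quarter)
    also have "\<dots> = ennreal (4 * (16 * (I + 1)))"
    proof -
      have gen: "(\<Sum>k<4::nat. ennreal x) = ennreal (4 * x)" if "0 \<le> x" for x
        using that by (simp add: ennreal_mult)
      show ?thesis by (rule gen) (use I(2) in simp)
    qed
    also have "4 * (16 * (I + 1)) = K" by (simp add: K_def)
    finally show ?thesis .
  qed
  show ?thesis by (rule that[of K]) (rule K0, rule bnd)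
qed

definition lattice_J :: "real \<Rightarrow> real" where
  "lattice_J r = ln r + (\<Sum>l\<in>{l\<in>sq_lattice - {0}. cmod l \<le> r}. ln (r / cmod l))"

text \<open>
  The reverse of Jensen's inequality.  After reflecting the zeros of \<open>\<sigma>(z) / z\<close> the function has no zeros in
  the closed disc, so it has a holomorphic inverse square root.  The mean value inequality for that root
  bounds \<open>exp (- J\<^sub>L(r) / 2)\<close> by the circle mean of \<open>\<bar>\<sigma>\<bar>\<close> to the power \<open>-1/2\<close>.  Radii of lattice points are
  excluded because there the reflected factors vanish on the circle.
\<close>

theorem lattice_J_lower_bound:
  "\<exists>c. \<forall>r\<ge>1. (\<forall>l\<in>sq_lattice. cmod l \<noteq> r) \<longrightarrow> r\<^sup>2 / 2 - c \<le> lattice_J r"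
proof -
  obtain k K where k: "0 < k" and "0 < K"
    and lower: "\<And>z. k * cmod (z - near z) * exp ((cmod z)\<^sup>2 / 2) \<le> cmod (wsigma z)"
    and "\<And>z. cmod (wsigma z) \<le> K * cmod (z - near z) * exp ((cmod z)\<^sup>2 / 2)"
    by (rule sigma_bounds) (rule that, assumption+)
  obtain M where M: "0 < M" "\<And>r::real. r \<ge> 1 \<Longrightarrow>
    (\<integral>\<^sup>+t\<in>{0..2*pi}. isqrt_dist (of_real r * cis t) \<partial>lborel) \<le> ennreal M"
    by (rule circle_isqrt_dist_bound) (rule that, assumption+)
  define c where "c = 2 * ln M - ln k - 2 * ln (2 * pi)"
  have "r\<^sup>2 / 2 - c \<le> lattice_J r" if r: "r \<ge> 1" and off: "\<forall>l\<in>sq_lattice. cmod l \<noteq> r" for r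
  proof -
    define Z where "Z = {l\<in>sq_lattice - {0}. cmod l \<le> r}"
    define m where "m = (\<lambda>_::complex. 1 :: nat)"
    define E where "E = (\<Sum>l\<in>Z. ln (r / cmod l))"
    have Z: "finite Z" "0 \<notin> Z"
      unfolding Z_def by (auto intro: finite_subset[OF _ finite_lattice_disc[of r]])
    have nz0: "\<exists>z. sigma0 z \<noteq> 0" using sigma0_0 by (intro exI[of _ 0]) simp
    obtain h where h: "h holomorphic_on UNIV" "\<exists>z. h z \<noteq> 0" "\<And>w. sigma0 w = zpoly Z m w * h w"
      "\<And>z. zorder h z = zorder sigma0 z - (if z \<in> Z then int (m z) else 0)"
    proof (rule entire_divide_zeros[OF sigma0_holomorphic nz0 Z(1), of m])
      show "int (m x) \<le> zorder sigma0 x" if "x \<in> Z" for x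
        using that by (simp add: m_def zorder_sigma0 Z_def)
    qed (rule that, assumption+)
    define H where "H w = h w * blaschke Z m r w" for w
    have H: "H holomorphic_on X" for X
      unfolding H_def [abs_def] using r h by (intro holomorphic_intros holomorphic_on_subset[OF h(1)]) auto
    have Hnz: "H w \<noteq> 0" if w: "cmod w \<le> r" for w
    proof -
      have "zorder h w = 0" using w by (auto simp: h(4) zorder_sigma0 m_def Z_def)
      hence "h w \<noteq> 0"
        using zorder_pos_iff[OF h(1) open_UNIV, of w] entire_eventually_nonzero[OF h(1,2), of w]
        by (simp add: eventually_frequently)
      moreover have "of_real (r\<^sup>2) - cnj l * w \<noteq> 0" if "l \<in> Z" for l
      proof
        assume "of_real (r\<^sup>2) - cnj l * w = 0"
        hence "cmod (cnj l * w) = cmod (of_real (r\<^sup>2))" by simp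
        hence "cmod l * cmod w = r\<^sup>2" by (simp add: norm_mult norm_power)
        moreover have "cmod l < r" using that off by (auto simp: Z_def order_less_le)
        hence "cmod l * r < r * r" using r by (intro mult_strict_right_mono) auto
        moreover have "cmod l * cmod w \<le> cmod l * r" using w by (rule mult_left_mono) simp
        ultimately show False unfolding power2_eq_square by linarith
      qed
      hence "blaschke Z m r w \<noteq> 0" using Z(1) r by (simp add: blaschke_def)
      ultimately show ?thesis by (simp add: H_def)
    qed
    have op: "open {w. H w \<noteq> 0}"
      using continuous_open_preimage[OF holomorphic_on_imp_continuous_on[OF H[of UNIV]] open_UNIV, of "- {0}"]
      by (simp add: vimage_def open_Compl)
    have sub: "cball 0 r \<subseteq> {w. H w \<noteq> 0}" using Hnz by auto
    obtain e where e: "e > 0" "(\<Union>x\<in>cball 0 r. ball x e) \<subseteq> {w. H w \<noteq> 0}"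
      by (rule compact_subset_open_imp_ball_epsilon_subset[OF compact_cball op sub])
    have ballnz: "H w \<noteq> 0" if "w \<in> ball 0 (r + e)" for w
    proof (cases "cmod w \<le> r")
      case True thus ?thesis by (rule Hnz)
    next
      case False
      \<comment> \<open>The radial projection of \<open>w\<close> to the circle lies within \<open>e\<close> of \<open>w\<close>.\<close>
      define x where "x = of_real (r / cmod w) * w"
      have w0: "cmod w > 0" using False r by linarith
      have xr: "cmod x = r" using w0 r by (simp add: x_def norm_mult norm_divide)
      have "x - w = of_real (r / cmod w - 1) * w" by (simp add: x_def algebra_simps)
      hence "cmod (x - w) = \<bar>r / cmod w - 1\<bar> * cmod w" by (simp only: norm_mult norm_of_real)
      also have "\<dots> = cmod w - r" using False w0 by (simp add: abs_if field_simps)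
      finally have "cmod (x - w) < e" using that by simp
      hence "w \<in> ball x e" by (simp add: dist_norm)
      moreover have "x \<in> cball 0 r" using xr by simp
      ultimately have "w \<in> (\<Union>x\<in>cball 0 r. ball x e)" by blast
      thus ?thesis using e(2) by blast
    qed
    obtain g where g: "g holomorphic_on ball 0 (r + e)" "\<And>w. w \<in> ball 0 (r + e) \<Longrightarrow> exp (g w) = H w"
      by (rule holomorphic_logarithm_exists[of "ball 0 (r + e)" H 0]) (use H ballnz r e in auto)
    define G where "G w = exp (- (g w / 2))" for w
    have G: "G holomorphic_on ball 0 (r + e)" unfolding G_def [abs_def] by (intro holomorphic_intros g) auto
    have cG: "cmod (G w) = 1 / sqrt (cmod (H w))" if "w \<in> ball 0 (r + e)" for w
    proof -
      have "(cmod (G w))\<^sup>2 = cmod (exp (- g w))"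
        by (simp add: G_def flip: norm_power exp_double)
      also have "\<dots> = 1 / cmod (H w)" using g(2)[OF that] by (simp add: exp_minus norm_divide inverse_eq_divide)
      finally have "cmod (G w) = sqrt (1 / cmod (H w))" by (simp add: real_sqrt_unique)
      thus ?thesis by (simp add: real_sqrt_divide)
    qed
    have H0: "cmod (H 0) = exp E"
    proof -
      have "cmod (H 0) = cmod (sigma0 0) * exp (\<Sum>x\<in>Z. real (m x) * ln (r / cmod x))"
        unfolding H_def h(3) norm_mult using Z r by (subst blaschke_ratio_at_0) auto
      thus ?thesis by (simp add: sigma0_0 E_def m_def)
    qed
    \<comment> \<open>The square root of the lower bound for \<open>\<bar>\<sigma>(z) / z\<bar>\<close> on the circle, without the distance factor.\<close>
    define q where "q = sqrt (k * exp (r\<^sup>2 / 2) / r)"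
    have q: "q > 0" using k r by (simp add: q_def)
    have "ennreal (2 * pi * cmod (G 0)) \<le> (\<integral>\<^sup>+t\<in>{0..2*pi}. ennreal (cmod (G (r * cis t))) \<partial>lborel)"
      by (rule circle_mean_ge[OF G]) (use r e in auto)
    also have "\<dots> \<le> (\<integral>\<^sup>+t\<in>{0..2*pi}. ennreal (1 / q) * isqrt_dist (of_real r * cis t) \<partial>lborel)"
    proof (intro nn_integral_mono mult_right_mono)
      fix t
      define z where "z = complex_of_real r * cis t"
      have zr: "cmod z = r" using r by (simp add: z_def norm_mult)
      have "cmod (H z) = cmod (sigma0 z)"
        unfolding H_def h(3) norm_mult using blaschke_on_circle[OF zr] r by simp
      also have "\<dots> = cmod (wsigma z) / r" using zr r by (simp add: wsigma_def norm_mult)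
      also have "\<dots> \<ge> k * cmod (z - near z) * exp (r\<^sup>2 / 2) / r"
        using lower[of z] r unfolding zr by (intro divide_right_mono) auto
      finally have "sqrt (k * cmod (z - near z) * exp (r\<^sup>2 / 2) / r) \<le> sqrt (cmod (H z))" by simp
      hence "q * sqrt (cmod (z - near z)) \<le> sqrt (cmod (H z))"
        unfolding q_def by (simp add: mult_ac flip: real_sqrt_mult)
      hence "inverse (ennreal (sqrt (cmod (H z)))) \<le> ennreal (1 / q) * isqrt_dist z"
        using q by (intro inverse_ennreal_le) auto
      moreover have "cmod (H z) > 0" using Hnz[of z] zr by simp
      ultimately have "ennreal (1 / sqrt (cmod (H z))) \<le> ennreal (1 / q) * isqrt_dist z"
        by (simp add: inverse_ennreal inverse_eq_divide)
      moreover have "cmod (G z) = 1 / sqrt (cmod (H z))" using e zr by (intro cG) auto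
      ultimately show "ennreal (cmod (G (r * cis t))) \<le> ennreal (1 / q) * isqrt_dist (of_real r * cis t)"
        unfolding z_def by simp
    qed auto
    also have "\<dots> = (\<integral>\<^sup>+t. ennreal (1 / q) * (isqrt_dist (of_real r * cis t) * indicator {0..2*pi} t) \<partial>lborel)"
      by (simp only: mult.assoc)
    also have "\<dots> \<le> ennreal (1 / q) * ennreal M"
    proof -
      have [measurable]: "(\<lambda>t. r * cis t) \<in> borel_measurable borel"
        by (intro borel_measurable_continuous_onI continuous_intros)
      have "(\<integral>\<^sup>+t. ennreal (1 / q) * (isqrt_dist (of_real r * cis t) * indicator {0..2*pi} t) \<partial>lborel)
         = ennreal (1 / q) * (\<integral>\<^sup>+t\<in>{0..2*pi}. isqrt_dist (of_real r * cis t) \<partial>lborel)"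
        unfolding near_def near_idx_def gauss_pt_def round_def by (rule nn_integral_cmult) measurable
      thus ?thesis using M(2)[OF r] by (simp add: mult_left_mono)
    qed
    also have "\<dots> = ennreal (M / q)" using q M(1) by (simp flip: ennreal_mult)
    finally have "2 * pi * cmod (G 0) \<le> M / q" using q M(1) by simp
    moreover have "cmod (G 0) = exp (- E / 2)"
    proof -
      have "cmod (G 0) = 1 / sqrt (exp E)" using r e by (subst cG) (auto simp: H0)
      also have "sqrt (exp E) = exp (E / 2)" by (rule real_sqrt_unique) (simp_all flip: exp_double)
      finally show ?thesis by (simp add: exp_minus inverse_eq_divide)
    qed
    ultimately have le: "2 * pi * exp (- E / 2) \<le> M / q" by simp
    have "ln (2 * pi * exp (- E / 2)) \<le> ln (M / q)" using le by (intro ln_mono) auto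
    moreover have "ln (2 * pi * exp (- E / 2)) = ln (2 * pi) - E / 2" by (subst ln_mult) auto
    moreover have "ln (M / q) = ln M - (ln k + r\<^sup>2 / 2 - ln r) / 2"
    proof -
      have "ln q = ln (k * exp (r\<^sup>2 / 2) / r) / 2" unfolding q_def using k r by (intro ln_sqrt) auto
      also have "ln (k * exp (r\<^sup>2 / 2) / r) = ln k + r\<^sup>2 / 2 - ln r" using k r by (simp add: ln_div ln_mult)
      finally show ?thesis using M(1) q by (simp add: ln_div)
    qed
    ultimately have "ln (2 * pi) - E / 2 \<le> ln M - (ln k + r\<^sup>2 / 2 - ln r) / 2" by simp
    hence "r\<^sup>2 / 2 - c \<le> ln r + E" unfolding c_def by (simp add: field_simps)
    thus ?thesis by (simp add: lattice_J_def E_def Z_def)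
  qed
  thus ?thesis by blast
qed

section \<open>Comparing the counting functions\<close>

text \<open>
  The contribution of one point of a multiset to its counting function \<open>J\<close>.
\<close>

definition log_plus :: "real \<Rightarrow> complex \<Rightarrow> real" where
  "log_plus r z = (if z = 0 then ln r else if cmod z \<le> r then ln (r / cmod z) else 0)"

lemma log_plus_le: "r \<ge> 1 \<Longrightarrow> log_plus r z \<le> ln r + \<bar>ln (cmod z)\<bar>"
  by (auto simp: log_plus_def ln_div)

lemma log_plus_ge: "r \<ge> 1 \<Longrightarrow> cmod z \<le> r \<Longrightarrow> ln r - \<bar>ln (cmod z)\<bar> \<le> log_plus r z"
  by (auto simp: log_plus_def ln_div)

lemma jensen_J_eq_sum:
  assumes "finite W" "\<And>z. cmod z \<le> r \<Longrightarrow> m z > 0 \<Longrightarrow> z \<in> W" "r \<ge> 1"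
  shows "jensen_J m r = (\<Sum>z\<in>W. real (m z) * log_plus r z)"
proof -
  define S where "S = {z. 0 < cmod z \<and> cmod z \<le> r \<and> m z > 0}"
  have fS: "finite S" by (rule finite_subset[OF _ assms(1)]) (use assms(2) in \<open>auto simp: S_def\<close>)
  have 0: "0 \<notin> S" by (simp add: S_def)
  have "(\<Sum>z\<in>S. real (m z) * ln (r / cmod z)) = (\<Sum>z\<in>S. real (m z) * log_plus r z)"
    by (intro sum.cong) (auto simp: S_def log_plus_def)
  moreover have "jensen_J m r = real (m 0) * ln r + (\<Sum>z\<in>S. real (m z) * ln (r / cmod z))"
    by (simp add: jensen_J_def S_def)
  moreover have "log_plus r 0 = ln r" by (simp add: log_plus_def)
  ultimately have "jensen_J m r = (\<Sum>z\<in>insert 0 S. real (m z) * log_plus r z)"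
    using fS 0 by simp
  also have "\<dots> = (\<Sum>z\<in>insert 0 W. real (m z) * log_plus r z)"
    by (rule sum.mono_neutral_left) (use assms fS in \<open>auto simp: S_def log_plus_def\<close>)
  also have "\<dots> = (\<Sum>z\<in>W. real (m z) * log_plus r z)"
    by (rule sum.mono_neutral_right) (use assms(1) assms(2)[of 0] assms(3) in auto)
  finally show ?thesis .
qed

lemma zpoly_upper:
  assumes "finite S" "\<And>x. x \<in> S \<Longrightarrow> cmod x \<le> cmod w"
  shows "cmod (zpoly S n w) \<le> (2 * cmod w) ^ (\<Sum>x\<in>S. n x)"
proof -
  have "cmod (zpoly S n w) = (\<Prod>x\<in>S. cmod (w - x) ^ n x)" by (simp add: zpoly_def norm_power flip: prod_norm)
  also have "\<dots> \<le> (\<Prod>x\<in>S. (2 * cmod w) ^ n x)"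
  proof (intro prod_mono conjI power_mono)
    fix x assume "x \<in> S"
    thus "cmod (w - x) \<le> 2 * cmod w" using assms(2)[of x] norm_triangle_ineq4[of w x] by linarith
  qed auto
  finally show ?thesis by (simp add: power_sum)
qed

lemma zpoly_lower:
  assumes "finite S" "\<And>x. x \<in> S \<Longrightarrow> 2 * cmod x \<le> cmod w"
  shows "(cmod w / 2) ^ (\<Sum>x\<in>S. n x) \<le> cmod (zpoly S n w)"
proof -
  have "(cmod w / 2) ^ (\<Sum>x\<in>S. n x) = (\<Prod>x\<in>S. (cmod w / 2) ^ n x)" by (simp add: power_sum)
  also have "\<dots> \<le> (\<Prod>x\<in>S. cmod (w - x) ^ n x)"
  proof (intro prod_mono conjI power_mono)
    fix x assume "x \<in> S"
    thus "cmod w / 2 \<le> cmod (w - x)" using assms(2)[of x] norm_triangle_ineq2[of w x] by linarith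
  qed auto
  finally show ?thesis by (simp add: zpoly_def norm_power flip: prod_norm)
qed

context perturbed_lattice
begin

lemma finite_labels_disc: "finite {l\<in>sq_lattice. cmod (\<mu> l) \<le> R}"
proof (rule finite_subset)
  show "{l\<in>sq_lattice. cmod (\<mu> l) \<le> R} \<subseteq> A \<union> {l\<in>sq_lattice. cmod l \<le> R + C}"
  proof
    fix l assume l: "l \<in> {l\<in>sq_lattice. cmod (\<mu> l) \<le> R}"
    show "l \<in> A \<union> {l\<in>sq_lattice. cmod l \<le> R + C}"
    proof (cases "l \<in> A")
      case False
      hence "cmod (\<mu> l - l) \<le> C" using l by (intro close') auto
      moreover have "cmod l \<le> cmod (\<mu> l) + cmod (\<mu> l - l)" by norm
      ultimately show ?thesis using l by simp
    qed auto
  qed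
qed (use A finite_lattice_disc in auto)

abbreviation \<Gamma> :: mult where "\<Gamma> \<equiv> labelled_multiset sq_lattice \<mu>"

lemma finite_labels_at: "finite {l\<in>sq_lattice. \<mu> l = z}"
  by (rule finite_subset[OF _ finite_labels_disc[of "cmod z"]]) auto

lemma labelled_split: "\<Gamma> z = card {l\<in>A. \<mu> l = z} + card {l\<in>sq_lattice - A. \<mu> l = z}"
proof -
  have "\<Gamma> z = card ({l\<in>A. \<mu> l = z} \<union> {l\<in>sq_lattice - A. \<mu> l = z})"
    unfolding labelled_multiset_def using A by (intro arg_cong[of _ _ card]) auto
  also have "\<dots> = card {l\<in>A. \<mu> l = z} + card {l\<in>sq_lattice - A. \<mu> l = z}"
    by (rule card_Un_disjoint) (auto intro: finite_subset[OF _ A(1)] finite_subset[OF _ finite_labels_at[of z]])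
  finally show ?thesis .
qed

lemma labelled_sum:
  assumes W: "finite W" "\<And>z. cmod z \<le> r \<Longrightarrow> \<Gamma> z > 0 \<Longrightarrow> z \<in> W" and r: "r \<ge> 1"
  shows "(\<Sum>z\<in>W. real (\<Gamma> z) * log_plus r z) = (\<Sum>l\<in>{l\<in>sq_lattice. cmod (\<mu> l) \<le> r}. log_plus r (\<mu> l))"
proof -
  let ?L = "{l\<in>sq_lattice. cmod (\<mu> l) \<le> r}"
  have sub: "\<mu> ` ?L \<subseteq> W"
  proof safe
    fix l assume l: "l \<in> sq_lattice" "cmod (\<mu> l) \<le> r"
    have "\<Gamma> (\<mu> l) > 0" unfolding labelled_multiset_def using l finite_labels_at[of "\<mu> l"] by (subst card_gt_0_iff) auto
    thus "\<mu> l \<in> W" using W(2) l by simp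
  qed
  have "(\<Sum>l\<in>?L. log_plus r (\<mu> l)) = (\<Sum>z\<in>W. \<Sum>l\<in>{l\<in>?L. \<mu> l = z}. log_plus r (\<mu> l))"
    by (rule sum.group[symmetric]) (use finite_labels_disc W sub in auto)
  also have "\<dots> = (\<Sum>z\<in>W. real (\<Gamma> z) * log_plus r z)"
  proof (rule sum.cong)
    fix z assume "z \<in> W"
    have "(\<Sum>l\<in>{l\<in>?L. \<mu> l = z}. log_plus r (\<mu> l)) = real (card {l\<in>?L. \<mu> l = z}) * log_plus r z" by simp
    also have "\<dots> = real (\<Gamma> z) * log_plus r z"
    proof (cases "cmod z \<le> r")
      case True
      hence "{l\<in>?L. \<mu> l = z} = {l\<in>sq_lattice. \<mu> l = z}" by auto
      thus ?thesis by (simp add: labelled_multiset_def)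
    next
      case False
      thus ?thesis using r by (auto simp: log_plus_def)
    qed
    finally show "(\<Sum>l\<in>{l\<in>?L. \<mu> l = z}. log_plus r (\<mu> l)) = real (\<Gamma> z) * log_plus r z" .
  qed auto
  finally show ?thesis ..
qed

text \<open>
  Changing the selection \<open>\<bar>\<mu>\<^sub>l\<bar> \<le> r\<close> into \<open>\<bar>l\<bar> \<le> r\<close> drops nonnegative terms and adds nonpositive ones, so the
  boundary effects have the favourable sign.
\<close>

lemma outer_labels_sum_ge:
  assumes r: "r \<ge> 1"
  shows "(\<Sum>l\<in>{l\<in>sq_lattice - A. cmod l \<le> r}. ln (r / cmod l)) - B r
      \<le> (\<Sum>l\<in>{l\<in>sq_lattice - A. cmod (\<mu> l) \<le> r}. log_plus r (\<mu> l))"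
proof -
  define Y where "Y = {l\<in>sq_lattice - A. cmod l \<le> r}"
  define X where "X = {l\<in>sq_lattice - A. cmod (\<mu> l) \<le> r}"
  have fin: "finite X" "finite Y"
    unfolding X_def Y_def by (auto intro: finite_subset[OF _ finite_labels_disc[of r]] finite_subset[OF _ finite_lattice_disc[of r]])
  have "(\<Sum>l\<in>Y. ln (r / cmod l)) - B r = (\<Sum>l\<in>Y. ln (r / cmod l) - ln (cmod (\<mu> l / l)))"
    by (simp add: log_displacement_def Y_def sum_subtractf)
  also have "\<dots> = (\<Sum>l\<in>Y. ln (r / cmod (\<mu> l)))"
    using nonzero lattice_nonzero r by (intro sum.cong refl) (simp add: Y_def ln_div norm_divide)
  also have "\<dots> = (\<Sum>l\<in>Y \<inter> X. ln (r / cmod (\<mu> l))) + (\<Sum>l\<in>Y - X. ln (r / cmod (\<mu> l)))"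
    by (rule sum.Int_Diff[OF fin(2)])
  also have "(\<Sum>l\<in>Y - X. ln (r / cmod (\<mu> l))) \<le> 0"
  proof (rule sum_nonpos)
    fix l assume l: "l \<in> Y - X"
    hence "r < cmod (\<mu> l)" by (auto simp: X_def Y_def)
    hence "0 < r" "0 < cmod (\<mu> l)" "r \<le> cmod (\<mu> l)" using r by linarith+
    hence "r / cmod (\<mu> l) \<le> 1" "0 < r / cmod (\<mu> l)" by simp_all
    thus "ln (r / cmod (\<mu> l)) \<le> 0" by (simp only: ln_le_zero_iff)
  qed
  also have "(\<Sum>l\<in>Y \<inter> X. ln (r / cmod (\<mu> l))) = (\<Sum>l\<in>Y \<inter> X. log_plus r (\<mu> l))"
    using nonzero by (intro sum.cong refl) (auto simp: X_def log_plus_def)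
  also have "\<dots> \<le> (\<Sum>l\<in>X. log_plus r (\<mu> l))"
  proof (rule sum_mono2[OF fin(1)])
    fix l assume "l \<in> X - Y \<inter> X"
    hence l: "cmod (\<mu> l) \<le> r" by (auto simp: X_def)
    show "0 \<le> log_plus r (\<mu> l)" using r l by (auto simp: log_plus_def)
  qed auto
  finally show ?thesis unfolding X_def Y_def by simp
qed

text \<open>
  Once \<open>r\<close> exceeds all exceptional points, each of them contributes \<open>log r + O(1)\<close>.  The exceptional labels
  in \<open>A\<close> cancel against the corresponding lattice points, and the net multiplicity \<open>q\<close> remains.
\<close>

lemma finite_modification_jensen_ge:
  assumes N: "\<And>z. count N z \<le> \<Gamma> z" and Xi: "\<And>z. \<Xi> z = \<Gamma> z - count N z + count P z"
    and q: "q = int (size P) - int (size N)"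
  shows "\<exists>c. \<exists>R\<ge>1. \<forall>r\<ge>R. lattice_J r - B r + of_int q * ln r - c \<le> jensen_J \<Xi> r"
proof -
  define R where "R = 1 + (\<Sum>x\<in>set_mset P. cmod x) + (\<Sum>l\<in>A. cmod (\<mu> l)) + (\<Sum>l\<in>A. cmod l)"
  define cN where "cN = (\<Sum>x\<in>set_mset N. real (count N x) * \<bar>ln (cmod x)\<bar>)"
  define cP where "cP = (\<Sum>x\<in>set_mset P. real (count P x) * \<bar>ln (cmod x)\<bar>)"
  define cA where "cA = (\<Sum>l\<in>A. \<bar>ln (cmod (\<mu> l))\<bar>)"
  define cL where "cL = (\<Sum>l\<in>A - {0}. \<bar>ln (cmod l)\<bar>)"
  have nn: "0 \<le> (\<Sum>x\<in>set_mset P. cmod x)" "0 \<le> (\<Sum>l\<in>A. cmod (\<mu> l))" "0 \<le> (\<Sum>l\<in>A. cmod l)"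
    by (auto intro: sum_nonneg)
  have "lattice_J r - B r + of_int q * ln r - (cN + cP + cA + cL) \<le> jensen_J \<Xi> r" if rR: "R \<le> r" for r
  proof -
    have r: "r \<ge> 1" using rR nn by (simp add: R_def)
    have xP: "cmod x \<le> r" if "x \<in># P" for x
      using member_le_sum[of x "set_mset P" cmod] that rR nn by (simp add: R_def)
    have mA: "cmod (\<mu> l) \<le> r" if "l \<in> A" for l
      using member_le_sum[of l A "\<lambda>l. cmod (\<mu> l)"] that A(1) rR nn by (simp add: R_def)
    have lA: "cmod l \<le> r" if "l \<in> A" for l
      using member_le_sum[of l A cmod] that A(1) rR nn by (simp add: R_def)
    \<comment> \<open>A finite set on which all the multisets involved can be summed at once.\<close>
    define W where "W = \<mu> ` {l\<in>sq_lattice. cmod (\<mu> l) \<le> r} \<union> set_mset N \<union> set_mset P"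
    have W: "finite W" unfolding W_def using finite_labels_disc by auto
    have WG: "z \<in> W" if "cmod z \<le> r" "\<Gamma> z > 0" for z
    proof -
      have "{l\<in>sq_lattice. \<mu> l = z} \<noteq> {}" using that(2) by (auto simp: labelled_multiset_def card_gt_0_iff)
      thus ?thesis using that(1) by (auto simp: W_def)
    qed
    have WXi: "z \<in> W" if "cmod z \<le> r" "\<Xi> z > 0" for z
    proof (cases "\<Gamma> z > 0")
      case False
      hence "count P z > 0" using that(2) Xi[of z] by simp
      thus ?thesis by (simp add: W_def)
    qed (use WG that in auto)
    have ms: "(\<Sum>z\<in>W. real (count M z) * f z) = (\<Sum>z\<in>set_mset M. real (count M z) * f z)" if "set_mset M \<subseteq> W" for M and f :: "complex \<Rightarrow> real"
      by (rule sum.mono_neutral_right[OF W that]) (auto simp: not_in_iff)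
    have "jensen_J \<Xi> r = (\<Sum>z\<in>W. real (\<Xi> z) * log_plus r z)"
      by (rule jensen_J_eq_sum[OF W WXi r])
    also have "\<dots> = (\<Sum>z\<in>W. real (\<Gamma> z) * log_plus r z - real (count N z) * log_plus r z + real (count P z) * log_plus r z)"
    proof (intro sum.cong refl)
      fix z
      have "real (\<Xi> z) = real (\<Gamma> z) - real (count N z) + real (count P z)"
        using N[of z] by (simp add: Xi of_nat_diff)
      thus "real (\<Xi> z) * log_plus r z = real (\<Gamma> z) * log_plus r z - real (count N z) * log_plus r z + real (count P z) * log_plus r z"
        by (simp only: distrib_right left_diff_distrib)
    qed
    also have "\<dots> = (\<Sum>z\<in>W. real (\<Gamma> z) * log_plus r z) - (\<Sum>z\<in>set_mset N. real (count N z) * log_plus r z) + (\<Sum>z\<in>set_mset P. real (count P z) * log_plus r z)"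
    proof -
      have "set_mset N \<subseteq> W" "set_mset P \<subseteq> W" by (auto simp: W_def)
      thus ?thesis by (simp add: sum.distrib sum_subtractf ms)
    qed
    finally have J: "jensen_J \<Xi> r = \<dots>" .
    have "(\<Sum>z\<in>set_mset N. real (count N z) * log_plus r z) \<le> (\<Sum>z\<in>set_mset N. real (count N z) * (ln r + \<bar>ln (cmod z)\<bar>))"
      using r by (intro sum_mono mult_left_mono log_plus_le) auto
    also have "\<dots> = real (size N) * ln r + cN"
      by (simp add: distrib_left sum.distrib cN_def size_multiset_overloaded_eq sum_distrib_right)
    finally have JN: "(\<Sum>z\<in>set_mset N. real (count N z) * log_plus r z) \<le> real (size N) * ln r + cN" .
    have "real (size P) * ln r - cP = (\<Sum>z\<in>set_mset P. real (count P z) * (ln r - \<bar>ln (cmod z)\<bar>))"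
      by (simp add: right_diff_distrib sum_subtractf cP_def size_multiset_overloaded_eq sum_distrib_right)
    also have "\<dots> \<le> (\<Sum>z\<in>set_mset P. real (count P z) * log_plus r z)"
      using r xP by (intro sum_mono mult_left_mono log_plus_ge) auto
    finally have JP: "real (size P) * ln r - cP \<le> (\<Sum>z\<in>set_mset P. real (count P z) * log_plus r z)" .
    have "{l\<in>sq_lattice. cmod (\<mu> l) \<le> r} = A \<union> {l\<in>sq_lattice - A. cmod (\<mu> l) \<le> r}"
      using A mA by auto
    hence "(\<Sum>z\<in>W. real (\<Gamma> z) * log_plus r z) = (\<Sum>l\<in>A \<union> {l\<in>sq_lattice - A. cmod (\<mu> l) \<le> r}. log_plus r (\<mu> l))"
      using labelled_sum[OF W WG r] by simp
    also have "\<dots> = (\<Sum>l\<in>A. log_plus r (\<mu> l)) + (\<Sum>l\<in>{l\<in>sq_lattice - A. cmod (\<mu> l) \<le> r}. log_plus r (\<mu> l))"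
      by (rule sum.union_disjoint) (auto intro: A finite_subset[OF _ finite_labels_disc[of r]])
    finally have JG: "(\<Sum>z\<in>W. real (\<Gamma> z) * log_plus r z) = \<dots>" .
    have "real (card A) * ln r - cA = (\<Sum>l\<in>A. ln r - \<bar>ln (cmod (\<mu> l))\<bar>)"
      by (simp add: sum_subtractf cA_def)
    also have "\<dots> \<le> (\<Sum>l\<in>A. log_plus r (\<mu> l))"
      using r mA by (intro sum_mono log_plus_ge) auto
    finally have JA: "real (card A) * ln r - cA \<le> (\<Sum>l\<in>A. log_plus r (\<mu> l))" .
    have "{l\<in>sq_lattice - {0}. cmod l \<le> r} = (A - {0}) \<union> {l\<in>sq_lattice - A. cmod l \<le> r}"
      using A lA by auto
    hence "lattice_J r = ln r + (\<Sum>l\<in>(A - {0}) \<union> {l\<in>sq_lattice - A. cmod l \<le> r}. ln (r / cmod l))"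
      by (simp add: lattice_J_def)
    also have "(\<Sum>l\<in>(A - {0}) \<union> {l\<in>sq_lattice - A. cmod l \<le> r}. ln (r / cmod l))
       = (\<Sum>l\<in>A - {0}. ln (r / cmod l)) + (\<Sum>l\<in>{l\<in>sq_lattice - A. cmod l \<le> r}. ln (r / cmod l))"
      by (rule sum.union_disjoint) (auto intro: A finite_subset[OF _ finite_lattice_disc[of r]])
    also have "(\<Sum>l\<in>A - {0}. ln (r / cmod l)) \<le> (\<Sum>l\<in>A - {0}. ln r + \<bar>ln (cmod l)\<bar>)"
      using r by (intro sum_mono) (auto simp: ln_div)
    also have "\<dots> = real (card (A - {0})) * ln r + cL" by (simp add: sum.distrib cL_def)
    finally have "lattice_J r \<le> ln r + (real (card (A - {0})) * ln r + cL + (\<Sum>l\<in>{l\<in>sq_lattice - A. cmod l \<le> r}. ln (r / cmod l)))"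
      by simp
    moreover have "real (card A) * ln r = ln r + real (card (A - {0})) * ln r"
      using card.remove[OF A(1) A(3)] by (simp add: algebra_simps)
    moreover have "of_int q * ln r = real (size P) * ln r - real (size N) * ln r"
      by (simp add: q left_diff_distrib)
    ultimately show ?thesis using outer_labels_sum_ge[OF r] JA JG JP JN J by linarith
  qed
  thus ?thesis using nn by (intro exI[of _ "cN + cP + cA + cL"] exI[of _ R]) (auto simp: R_def)
qed

section \<open>Functions with a prescribed finitely modified zero set\<close>

text \<open>
  Multiply the canonical product by the linear factors of the exceptional labels and of the added points,
  and divide by those of the removed points, which is possible because they are among the zeros.  At
  infinity the exceptional factors compensate the missing ones and \<open>\<bar>z\<bar>\<^sup>q\<close> is left.
\<close>

lemma finite_modification_function:
  assumes N: "\<And>z. count N z \<le> \<Gamma> z" and Xi: "\<And>z. \<Xi> z = \<Gamma> z - count N z + count P z"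
    and q: "q = int (size P) - int (size N)"
  shows "\<exists>f K R. f holomorphic_on UNIV \<and> (\<exists>z. f z \<noteq> 0) \<and> (\<forall>z. zorder f z = int (\<Xi> z)) \<and> 0 < K \<and> 1 \<le> R \<and>
     (\<forall>z. z \<notin> sq_lattice \<longrightarrow> R \<le> cmod z \<longrightarrow>
        cmod (f z) \<le> K * cmod z powi q * exp ((cmod z)\<^sup>2 / 2 - B (cmod z)))"
proof -
  obtain F where F: "F holomorphic_on UNIV" "\<And>z. zorder F z = int (card {l\<in>sq_lattice - A. \<mu> l = z})"
    "\<And>z. (\<lambda>N. \<Prod>l\<in>lat_box N - A. 1 - z / \<mu> l) \<longlonglongrightarrow> F z"
    by (rule canonical_product) (rule that, assumption+)
  obtain K R where KR: "0 < K" "1 \<le> R" and bound: "\<And>z. z \<notin> sq_lattice \<Longrightarrow> R \<le> cmod z \<Longrightarrow>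
      cmod (F z) * cmod z ^ card A \<le> K * exp ((cmod z)\<^sup>2 / 2 - B (cmod z))"
    using canonical_product_bound[OF F(3)] by blast
  have "F 0 = 1" using LIMSEQ_unique[OF F(3)[of 0]] by simp
  hence Fnz: "\<exists>z. F z \<noteq> 0" by (intro exI[of _ 0]) simp
  define S where "S = \<mu> ` A \<union> set_mset P"
  define n where "n x = card {l\<in>A. \<mu> l = x} + count P x" for x
  have S: "finite S" by (simp add: S_def A)
  have nS: "n z = 0" if "z \<notin> S" for z
  proof -
    have "{l\<in>A. \<mu> l = z} = {}" "count P z = 0" using that by (auto simp: S_def not_in_iff)
    thus ?thesis by (simp only: n_def card.empty)
  qed
  have degS: "(\<Sum>x\<in>S. n x) = card A + size P"
  proof -
    have "(\<Sum>x\<in>S. card {l\<in>A. \<mu> l = x}) = (\<Sum>x\<in>S. \<Sum>l\<in>{l\<in>A. \<mu> l = x}. 1)" by simp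
    also have "\<dots> = (\<Sum>l\<in>A. 1)" by (rule sum.group) (auto simp: S_def A)
    finally have "(\<Sum>x\<in>S. card {l\<in>A. \<mu> l = x}) = card A" by simp
    moreover have "(\<Sum>x\<in>S. count P x) = (\<Sum>x\<in>set_mset P. count P x)"
      by (rule sum.mono_neutral_right[OF S]) (auto simp: S_def not_in_iff)
    ultimately show ?thesis by (simp add: n_def sum.distrib size_multiset_overloaded_eq)
  qed
  have Snz: "\<exists>z. zpoly S n z \<noteq> 0"
    using ex_new_if_finite[OF infinite_UNIV_char_0 S] by (auto simp: zpoly_eq_0_iff[OF S])
  define G where "G w = F w * zpoly S n w" for w
  have G: "G holomorphic_on UNIV" unfolding G_def [abs_def] by (intro holomorphic_intros F)
  have ordG: "zorder G z = int (\<Gamma> z + count P z)" for z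
    unfolding G_def [abs_def] zorder_mult_entire[OF F(1) zpoly_holomorphic Fnz Snz]
    using nS[of z] by (simp add: F(2) zorder_zpoly[OF S] labelled_split n_def)
  have Gnz: "\<exists>z. G z \<noteq> 0"
  proof -
    have "eventually (\<lambda>w. F w \<noteq> 0 \<and> zpoly S n w \<noteq> 0) (at 0)"
      using entire_eventually_nonzero[OF F(1) Fnz, of 0] entire_eventually_nonzero[OF zpoly_holomorphic Snz, of 0]
      by eventually_elim auto
    hence "\<exists>w. F w \<noteq> 0 \<and> zpoly S n w \<noteq> 0" by (rule eventually_happens'[rotated]) simp
    thus ?thesis by (auto simp: G_def)
  qed
  obtain f where f: "f holomorphic_on UNIV" "\<exists>z. f z \<noteq> 0" "\<And>w. G w = zpoly (set_mset N) (count N) w * f w"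
    "\<And>z. zorder f z = zorder G z - (if z \<in> set_mset N then int (count N z) else 0)"
  proof (rule entire_divide_zeros[OF G Gnz, of "set_mset N" "count N"])
    show "int (count N x) \<le> zorder G x" for x using N[of x] by (simp add: ordG)
  qed (simp, rule that, assumption+)
  have ord: "zorder f z = int (\<Xi> z)" for z
    using N[of z] by (auto simp: f(4) ordG Xi not_in_iff)
  define R' where "R' = R + (\<Sum>x\<in>S. cmod x) + 2 * (\<Sum>x\<in>set_mset N. cmod x)"
  \<comment> \<open>Far out, \<open>\<bar>z\<bar> / 2 \<le> \<bar>z - x\<bar> \<le> 2 \<bar>z\<bar>\<close> for each of the finitely many points \<open>x\<close> involved.\<close>
  define K' where "K' = K * 2 ^ (card A + size P + size N)"
  have nn: "0 \<le> (\<Sum>x\<in>S. cmod x)" "0 \<le> (\<Sum>x\<in>set_mset N. cmod x)" by (auto intro: sum_nonneg)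
  have "cmod (f z) \<le> K' * cmod z powi q * exp ((cmod z)\<^sup>2 / 2 - B (cmod z))"
    if z: "z \<notin> sq_lattice" and zR: "R' \<le> cmod z" for z
  proof -
    let ?r = "cmod z"
    let ?E = "exp (?r\<^sup>2 / 2 - B ?r)"
    have r: "R \<le> ?r" "0 < ?r" using zR nn KR by (auto simp: R'_def)
    have up: "cmod (zpoly S n z) \<le> (2 * ?r) ^ (card A + size P)"
    proof (rule order_trans[OF zpoly_upper[OF S]])
      show "cmod x \<le> ?r" if "x \<in> S" for x
        using member_le_sum[of x S cmod] that S zR nn KR by (simp add: R'_def)
    qed (simp add: degS)
    have low: "(?r / 2) ^ size N \<le> cmod (zpoly (set_mset N) (count N) z)"
    proof -
      have "(?r / 2) ^ (\<Sum>x\<in>set_mset N. count N x) \<le> cmod (zpoly (set_mset N) (count N) z)"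
      proof (rule zpoly_lower)
        show "2 * cmod x \<le> ?r" if "x \<in> set_mset N" for x
          using member_le_sum[of x "set_mset N" cmod] that zR nn KR by (simp add: R'_def)
      qed simp
      thus ?thesis by (simp add: size_multiset_overloaded_eq)
    qed
    have "(?r / 2) ^ size N * cmod (f z) \<le> cmod (zpoly (set_mset N) (count N) z) * cmod (f z)"
      using low by (rule mult_right_mono) simp
    also have "\<dots> = cmod (F z) * cmod (zpoly S n z)" using f(3)[of z] by (simp add: G_def flip: norm_mult)
    also have "\<dots> \<le> cmod (F z) * (2 * ?r) ^ (card A + size P)" using up by (rule mult_left_mono) simp
    also have "\<dots> = (cmod (F z) * ?r ^ card A) * (2 ^ (card A + size P) * ?r ^ size P)"
      by (simp add: power_mult_distrib power_add)
    also have "\<dots> \<le> (K * ?E) * (2 ^ (card A + size P) * ?r ^ size P)"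
      by (intro mult_right_mono bound z r) auto
    finally have "(?r / 2) ^ size N * cmod (f z) \<le> (K * ?E) * (2 ^ (card A + size P) * ?r ^ size P)" .
    hence "cmod (f z) * ?r ^ size N \<le> (K * ?E) * (2 ^ (card A + size P) * ?r ^ size P) * 2 ^ size N"
      by (simp add: power_divide pos_divide_le_eq mult_ac)
    hence "cmod (f z) \<le> (K * ?E) * (2 ^ (card A + size P) * ?r ^ size P) * 2 ^ size N / ?r ^ size N"
      using r by (simp add: pos_le_divide_eq)
    also have "\<dots> = K' * (?r ^ size P / ?r ^ size N) * ?E"
      by (simp add: K'_def power_add)
    also have "?r ^ size P / ?r ^ size N = ?r powi q"
      using r by (simp add: q power_int_diff)
    finally show ?thesis .
  qed
  moreover have "0 < K'" using KR by (simp add: K'_def)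
  moreover have "1 \<le> R'" using KR nn by (simp add: R'_def)
  ultimately show ?thesis using f(1,2) ord by blast
qed

lemma log_displacement_measurable [measurable]: "B \<in> borel_measurable borel"
proof (rule borel_measurable_LIMSEQ_real)
  define g where "g N r = (\<Sum>l\<in>lat_box N - A. ln (cmod (\<mu> l / l)) * indicator {cmod l..} r)" for N and r :: real
  show "g N \<in> borel_measurable borel" for N unfolding g_def [abs_def] by measurable
  show "(\<lambda>N. g N r) \<longlonglongrightarrow> B r" for r
  proof (rule tendsto_eventually)
    have "eventually (\<lambda>N. {l\<in>sq_lattice. cmod l \<le> r} \<subseteq> lat_box N) sequentially"
      by (intro eventually_in_lat_box finite_lattice_disc) auto
    thus "eventually (\<lambda>N. g N r = B r) sequentially"
    proof eventually_elim
      case (elim N)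
      show ?case unfolding g_def log_displacement_def
        by (rule sum.mono_neutral_cong_right) (use elim lat_box_subset in \<open>auto simp: indicator_def\<close>)
    qed
  qed
qed

end

section \<open>Integrability in the Bargmann--Fock space\<close>

lemma exp_of_int_ln: "r > 0 \<Longrightarrow> exp (of_int q * ln r) = r powi q" for r :: real
  using powr_real_of_int'[of r q] by (simp add: powr_def)

lemma jensen_integral_finite:
  assumes g: "g \<in> bargmann_fock" "\<exists>z. g z \<noteq> 0" and m: "\<And>z. int (m z) \<le> zorder g z"
  shows "(\<integral>\<^sup>+ r\<in>{1..}. ennreal (r * exp (2 * jensen_D m r)) \<partial>lborel) < \<infinity>"
proof -
  have hol: "g holomorphic_on UNIV" using g by (simp add: bargmann_fock_def)
  let ?\<phi> = "\<lambda>z. ennreal ((cmod (g z))\<^sup>2 * exp (- (cmod z)\<^sup>2))"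
  have "continuous_on UNIV g" using hol by (rule holomorphic_on_imp_continuous_on)
  hence [measurable]: "g \<in> borel_measurable borel" by (rule borel_measurable_continuous_onI)
  have \<phi>: "?\<phi> \<in> borel_measurable borel" by measurable
  have fin: "(\<integral>\<^sup>+z. ?\<phi> z \<partial>lborel) < \<infinity>"
    using g by (auto simp: bargmann_fock_def ennreal_mult_less_top)
  define M where "M r = (\<integral>\<^sup>+t\<in>{0..2*pi}. ?\<phi> (of_real r * cis t) \<partial>lborel)" for r
  have [measurable]: "M \<in> borel_measurable borel"
  proof -
    have [measurable]: "(\<lambda>p. ?\<phi> (complex_of_real (fst p) * cis (snd p))) \<in> borel_measurable (borel \<Otimes>\<^sub>M borel)"
      unfolding borel_prod by (intro measurable_compose[OF _ \<phi>] borel_measurable_continuous_onI) (auto intro!: continuous_intros)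
    show ?thesis unfolding M_def [abs_def] by measurable
  qed
  obtain c where c: "c > 0" and J: "\<And>r. r \<ge> 1 \<Longrightarrow> ennreal (c * exp (2 * jensen_J m r))
           \<le> (\<integral>\<^sup>+t\<in>{0..2*pi}. ennreal ((cmod (g (of_real r * cis t)))\<^sup>2) \<partial>lborel)"
    using jensen_inequality[OF hol g(2) m] by blast
  have "(\<integral>\<^sup>+ r\<in>{1..}. ennreal (r * exp (2 * jensen_D m r)) \<partial>lborel) \<le> (\<integral>\<^sup>+ r. ennreal (1 / c) * (ennreal r * M r * indicator {0<..} r) \<partial>lborel)"
  proof (intro nn_integral_mono)
    fix r :: real
    show "ennreal (r * exp (2 * jensen_D m r)) * indicator {1..} r \<le> ennreal (1 / c) * (ennreal r * M r * indicator {0<..} r)"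
    proof (cases "r \<ge> 1")
      case True
      have "M r = (\<integral>\<^sup>+t. ennreal (exp (- r\<^sup>2)) * (ennreal ((cmod (g (of_real r * cis t)))\<^sup>2) * indicator {0..2*pi} t) \<partial>lborel)"
        unfolding M_def using True
        by (intro nn_integral_cong) (simp add: norm_mult ennreal_mult mult_ac)
      also have "\<dots> = ennreal (exp (- r\<^sup>2)) * (\<integral>\<^sup>+t\<in>{0..2*pi}. ennreal ((cmod (g (of_real r * cis t)))\<^sup>2) \<partial>lborel)"
      proof (rule nn_integral_cmult)
        have [measurable]: "(\<lambda>t. complex_of_real r * cis t) \<in> borel_measurable borel"
          by (intro borel_measurable_continuous_onI continuous_intros)
        show "(\<lambda>t. ennreal ((cmod (g (of_real r * cis t)))\<^sup>2) * indicator {0..2*pi} t) \<in> borel_measurable lborel" by measurable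
      qed
      finally have "ennreal (exp (- r\<^sup>2)) * ennreal (c * exp (2 * jensen_J m r)) \<le> M r"
        using J[OF True] by (simp add: mult_left_mono)
      hence "ennreal (1 / c) * (ennreal r * (ennreal (exp (- r\<^sup>2)) * ennreal (c * exp (2 * jensen_J m r)))) \<le> ennreal (1 / c) * (ennreal r * M r)"
        by (intro mult_left_mono) auto
      also have "ennreal (1 / c) * (ennreal r * (ennreal (exp (- r\<^sup>2)) * ennreal (c * exp (2 * jensen_J m r)))) = ennreal (1 / c * (r * (exp (- r\<^sup>2) * (c * exp (2 * jensen_J m r)))))"
      proof -
        have "ennreal u * (ennreal v * (ennreal w * ennreal x)) = ennreal (u * (v * (w * x)))"
          if "0 \<le> u" "0 \<le> v" "0 \<le> w" "0 \<le> x" for u v w x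
          using that by (simp add: ennreal_mult)
        thus ?thesis using c True by simp
      qed
      also have "1 / c * (r * (exp (- r\<^sup>2) * (c * exp (2 * jensen_J m r)))) = r * exp (2 * jensen_D m r)"
      proof -
        have "exp (- r\<^sup>2) * exp (2 * jensen_J m r) = exp (2 * jensen_D m r)"
          by (simp add: jensen_D_def algebra_simps flip: exp_add)
        moreover have "1 / c * (r * (exp (- r\<^sup>2) * (c * exp (2 * jensen_J m r)))) = r * (exp (- r\<^sup>2) * exp (2 * jensen_J m r))"
          using c by simp
        ultimately show ?thesis by simp
      qed
      finally show ?thesis using True by simp
    qed auto
  qed
  also have "\<dots> = ennreal (1 / c) * (\<integral>\<^sup>+ r. ennreal r * M r * indicator {0<..} r \<partial>lborel)"
    by (rule nn_integral_cmult) measurable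
  also have "(\<integral>\<^sup>+ r. ennreal r * M r * indicator {0<..} r \<partial>lborel) = (\<integral>\<^sup>+z. ?\<phi> z \<partial>lborel)"
    unfolding M_def by (rule nn_integral_polar[OF \<phi>, symmetric])
  also have "ennreal (1 / c) * \<dots> < \<infinity>" using fin by (simp add: ennreal_mult_less_top)
  finally show ?thesis .
qed

lemma nn_integral_radial:
  assumes [measurable]: "g \<in> borel_measurable borel"
  shows "(\<integral>\<^sup>+z. g (cmod z) \<partial>(lborel :: complex measure)) = (\<integral>\<^sup>+r\<in>{0<..}. ennreal (2 * pi * r) * g r \<partial>lborel)"
proof -
  have "(\<integral>\<^sup>+z. g (cmod z) \<partial>(lborel :: complex measure)) =
     (\<integral>\<^sup>+r\<in>{0<..}. ennreal r * (\<integral>\<^sup>+t\<in>{0..2*pi}. g (cmod (of_real r * cis t)) \<partial>lborel) \<partial>lborel)"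
    by (rule nn_integral_polar) measurable
  also have "\<dots> = (\<integral>\<^sup>+r\<in>{0<..}. ennreal (2 * pi * r) * g r \<partial>lborel)"
  proof (rule nn_integral_cong)
    fix r :: real
    show "ennreal r * (\<integral>\<^sup>+t\<in>{0..2*pi}. g (cmod (of_real r * cis t)) \<partial>lborel) * indicator {0<..} r = ennreal (2 * pi * r) * g r * indicator {0<..} r"
    proof (cases "r > 0")
      case True
      have "(\<integral>\<^sup>+t\<in>{0..2*pi}. g (cmod (of_real r * cis t)) \<partial>lborel) = (\<integral>\<^sup>+t. g r * indicator {0..2*pi} t \<partial>lborel)"
        using True by (intro nn_integral_cong) (simp add: norm_mult)
      also have "\<dots> = g r * ennreal (2 * pi)" by (simp add: nn_integral_cmult_indicator)
      finally show ?thesis using True by (simp add: ennreal_mult mult_ac)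
    qed auto
  qed
  finally show ?thesis .
qed

context perturbed_lattice
begin

abbreviation weight :: "int \<Rightarrow> real \<Rightarrow> ennreal" where
  "weight q r \<equiv> ennreal (r powi (2 * q + 1) * exp (- 2 * B r))"

lemma weight_measurable [measurable]:
  "(\<lambda>r. weight q r) \<in> borel_measurable borel"
proof -
  have [measurable]: "(\<lambda>r::real. r powi n) \<in> borel_measurable borel" for n
    by (cases "n \<ge> 0") (auto simp: power_int_def)
  show ?thesis by measurable
qed

lemma fock_membership:
  assumes f: "f holomorphic_on UNIV" and K: "0 < K" "1 \<le> R"
    and bound: "\<And>z. z \<notin> sq_lattice \<Longrightarrow> R \<le> cmod z \<Longrightarrow>
        cmod (f z) \<le> K * cmod z powi q * exp ((cmod z)\<^sup>2 / 2 - B (cmod z))"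
    and fin: "(\<integral>\<^sup>+ r\<in>{1..}. weight q r \<partial>lborel) < \<infinity>"
  shows "f \<in> bargmann_fock"
proof -
  define g where "g r = ennreal (K\<^sup>2 / r) * weight q r * indicator {R..} r" for r
  have [measurable]: "g \<in> borel_measurable borel" unfolding g_def [abs_def] by measurable
  have [measurable]: "cball (0::complex) R \<in> sets borel" by simp
  have [measurable]: "(cmod :: complex \<Rightarrow> real) \<in> borel_measurable borel" by simp
  have cont: "continuous_on UNIV f" using f by (rule holomorphic_on_imp_continuous_on)
  let ?\<phi> = "\<lambda>z. (cmod (f z))\<^sup>2 * exp (- (cmod z)\<^sup>2)"
  have "compact (cball (0::complex) R)" by simp
  moreover have "continuous_on (cball 0 R) ?\<phi>"
    by (intro continuous_intros continuous_on_subset[OF cont]) auto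
  ultimately have "compact (?\<phi> ` cball 0 R)" by (rule compact_continuous_image[rotated])
  then obtain b where b: "\<And>z. z \<in> cball 0 R \<Longrightarrow> ?\<phi> z \<le> b"
    using compact_imp_bounded bounded_real by (metis (no_types, lifting) abs_le_D1 imageI)
  have "(\<integral>\<^sup>+z. ennreal (?\<phi> z) \<partial>lborel) \<le> (\<integral>\<^sup>+z. ennreal b * indicator (cball 0 R) z + g (cmod z) \<partial>lborel)"
  proof (rule nn_integral_mono_AE)
    have "AE z in lborel. z \<notin> sq_lattice"
      by (rule AE_not_in) (rule countable_imp_null_set_lborel[OF countable_sq_lattice])
    thus "AE z in lborel. ennreal (?\<phi> z) \<le> ennreal b * indicator (cball 0 R) z + g (cmod z)"
    proof eventually_elim
      case (elim z)
      show ?case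
      proof (cases "cmod z < R")
        case True
        hence "ennreal (?\<phi> z) \<le> ennreal b" using b[of z] by (intro ennreal_leI) auto
        thus ?thesis using True by (simp add: add_increasing2)
      next
        case False
        let ?r = "cmod z" and ?B = "B (cmod z)"
        have r: "0 < ?r" "R \<le> ?r" using False K by linarith+
        have "?\<phi> z \<le> (K * ?r powi q * exp (?r\<^sup>2 / 2 - ?B))\<^sup>2 * exp (- ?r\<^sup>2)"
          using bound[OF elim r(2)] by (intro mult_right_mono power_mono) auto
        also have "\<dots> = K\<^sup>2 * ((?r powi q)\<^sup>2 * ((exp (?r\<^sup>2 / 2 - ?B))\<^sup>2 * exp (- ?r\<^sup>2)))"
          by (simp add: power_mult_distrib mult_ac)
        also have "(exp (?r\<^sup>2 / 2 - ?B))\<^sup>2 * exp (- ?r\<^sup>2) = exp (- 2 * ?B)"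
          by (simp flip: exp_double exp_add add: algebra_simps)
        also have "(?r powi q)\<^sup>2 = ?r powi (2 * q + 1) / ?r"
          using r by (simp add: power_int_add power_int_mult mult.commute[of 2 q])
        finally have "?\<phi> z \<le> K\<^sup>2 / ?r * (?r powi (2 * q + 1) * exp (- 2 * ?B))" by simp
        hence "ennreal (?\<phi> z) \<le> ennreal (K\<^sup>2 / ?r * (?r powi (2 * q + 1) * exp (- 2 * ?B)))" by (rule ennreal_leI)
        also have "\<dots> = ennreal (K\<^sup>2 / ?r) * ennreal (?r powi (2 * q + 1) * exp (- 2 * ?B))"
          by (rule ennreal_mult) (use r in auto)
        also have "\<dots> = g ?r" using r by (simp add: g_def)
        finally show ?thesis by (simp add: add_increasing)
      qed
    qed
  qed
  also have "\<dots> = (\<integral>\<^sup>+z. ennreal b * indicator (cball 0 R) z \<partial>(lborel :: complex measure)) + (\<integral>\<^sup>+z. g (cmod z) \<partial>(lborel :: complex measure))"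
    by (rule nn_integral_add) measurable
  also have "\<dots> < \<infinity>"
  proof -
    have "(\<integral>\<^sup>+z. ennreal b * indicator (cball 0 R) z \<partial>(lborel :: complex measure)) < \<infinity>"
      using emeasure_lborel_cball_finite[of "0::complex" R] by (simp add: nn_integral_cmult_indicator ennreal_mult_less_top)
    moreover have "(\<integral>\<^sup>+z. g (cmod z) \<partial>(lborel :: complex measure)) < \<infinity>"
    proof -
      have "(\<integral>\<^sup>+z. g (cmod z) \<partial>(lborel :: complex measure)) = (\<integral>\<^sup>+r\<in>{0<..}. ennreal (2 * pi * r) * g r \<partial>lborel)"
        by (rule nn_integral_radial) measurable
      also have "\<dots> \<le> (\<integral>\<^sup>+r. ennreal (2 * pi * K\<^sup>2) * (weight q r * indicator {1..} r) \<partial>lborel)"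
      proof (intro nn_integral_mono)
        fix r :: real
        show "ennreal (2 * pi * r) * g r * indicator {0<..} r \<le> ennreal (2 * pi * K\<^sup>2) * (weight q r * indicator {1..} r)"
        proof (cases "R \<le> r")
          case True
          hence r: "r \<ge> 1" "r > 0" using K by linarith+
          have "ennreal (2 * pi * r) * ennreal (K\<^sup>2 / r) = ennreal (2 * pi * K\<^sup>2)"
            using r by (simp flip: ennreal_mult)
          thus ?thesis using r True by (simp add: g_def mult.assoc[symmetric])
        qed (simp add: g_def)
      qed
      also have "\<dots> = ennreal (2 * pi * K\<^sup>2) * (\<integral>\<^sup>+r\<in>{1..}. weight q r \<partial>lborel)"
        by (rule nn_integral_cmult) measurable
      also have "\<dots> < \<infinity>" using fin by (simp add: ennreal_mult_less_top)
      finally show ?thesis .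
    qed
    ultimately show ?thesis by simp
  qed
  finally have "(\<integral>\<^sup>+z. ennreal (?\<phi> z) \<partial>lborel) < \<infinity>" .
  thus ?thesis using f by (simp add: bargmann_fock_def ennreal_mult_less_top)
qed

lemma weight_integral_initial_finite:
  "(\<integral>\<^sup>+ r\<in>{1..R}. weight q r \<partial>lborel) < \<infinity>"
proof -
  define b where "b = (\<Sum>l\<in>{l\<in>sq_lattice - A. cmod l \<le> R}. \<bar>ln (cmod (\<mu> l / l))\<bar>)"
  define k where "k = R ^ nat \<bar>2 * q + 1\<bar> * exp (2 * b)"
  have fin: "finite {l\<in>sq_lattice - A. cmod l \<le> R}"
    by (rule finite_subset[OF _ finite_lattice_disc[of R]]) auto
  have "(\<integral>\<^sup>+ r\<in>{1..R}. weight q r \<partial>lborel)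
      \<le> (\<integral>\<^sup>+ r. ennreal k * indicator {1..R} r \<partial>lborel)"
  proof (intro nn_integral_mono)
    fix r :: real
    show "weight q r * indicator {1..R} r \<le> ennreal k * indicator {1..R} r"
    proof (cases "r \<in> {1..R}")
      case True
      hence r: "1 \<le> r" "r \<le> R" by auto
      have p1: "r powi n \<le> R ^ nat \<bar>n\<bar>" for n
      proof (cases "n \<ge> 0")
        case True
        hence "r powi n = r ^ nat \<bar>n\<bar>" by (simp add: power_int_def)
        also have "\<dots> \<le> R ^ nat \<bar>n\<bar>" using r by (intro power_mono) auto
        finally show ?thesis .
      next
        case False
        hence "r powi n = inverse r ^ nat \<bar>n\<bar>" by (simp add: power_int_def)
        also have "\<dots> \<le> 1" using r by (intro power_le_one) (auto simp: field_simps)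
        also have "1 \<le> R ^ nat \<bar>n\<bar>" using r by (intro one_le_power) auto
        finally show ?thesis .
      qed
      have "- B r \<le> b"
      proof -
        have "- B r = (\<Sum>l\<in>{l\<in>sq_lattice - A. cmod l \<le> r}. - ln (cmod (\<mu> l / l)))"
          by (simp add: log_displacement_def sum_negf)
        also have "\<dots> \<le> (\<Sum>l\<in>{l\<in>sq_lattice - A. cmod l \<le> r}. \<bar>ln (cmod (\<mu> l / l))\<bar>)"
          by (intro sum_mono) auto
        also have "\<dots> \<le> b" unfolding b_def using r fin by (intro sum_mono2) auto
        finally show ?thesis .
      qed
      hence "exp (- 2 * B r) \<le> exp (2 * b)" by simp
      hence "r powi (2 * q + 1) * exp (- 2 * B r) \<le> k"
        unfolding k_def using p1 r by (intro mult_mono) auto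
      thus ?thesis by (intro mult_right_mono ennreal_leI) auto
    qed auto
  qed
  also have "\<dots> < \<infinity>" by (cases "1 \<le> R") (auto simp: nn_integral_cmult_indicator ennreal_mult_less_top)
  finally show ?thesis .
qed

text \<open>
  The counting estimates bound the weight by a multiple of \<open>r exp (2 D)\<close> for almost every large \<open>r\<close>; on bounded
  intervals the weight is bounded.  The constant is moved to the side of the weight, whose measurability is known.
\<close>

lemma weight_integral_finite:
  assumes J: "\<And>r. r \<ge> R \<Longrightarrow> lattice_J r - B r + of_int q * ln r - c \<le> jensen_J \<Xi> r" and R: "R \<ge> 1"
    and fin: "(\<integral>\<^sup>+ r\<in>{1..}. ennreal (r * exp (2 * jensen_D \<Xi> r)) \<partial>lborel) < \<infinity>"
  shows "(\<integral>\<^sup>+ r\<in>{1..}. weight q r \<partial>lborel) < \<infinity>"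
proof -
  let ?G = "\<lambda>r. ennreal (r * exp (2 * jensen_D \<Xi> r))"
  obtain c' where c': "\<And>r. r \<ge> 1 \<Longrightarrow> \<forall>l\<in>sq_lattice. cmod l \<noteq> r \<Longrightarrow> r\<^sup>2 / 2 - c' \<le> lattice_J r"
    using lattice_J_lower_bound by blast
  define k where "k = exp (- 2 * (c + c'))"
  have k: "k > 0" by (simp add: k_def)
  have "ennreal k * (\<integral>\<^sup>+ r. weight q r * indicator {R..} r \<partial>lborel) = (\<integral>\<^sup>+ r. ennreal k * (weight q r * indicator {R..} r) \<partial>lborel)"
    by (rule nn_integral_cmult[symmetric]) measurable
  also have "\<dots> \<le> (\<integral>\<^sup>+ r\<in>{1..}. ?G r \<partial>lborel)"
  proof (rule nn_integral_mono_AE)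
    have "AE r in lborel. r \<notin> cmod ` sq_lattice"
      by (rule AE_not_in) (intro countable_imp_null_set_lborel countable_image countable_sq_lattice)
    thus "AE r in lborel. ennreal k * (weight q r * indicator {R..} r) \<le> ?G r * indicator {1..} r"
    proof eventually_elim
      case (elim r)
      show ?case
      proof (cases "R \<le> r")
        case True
        hence r: "1 \<le> r" "0 < r" using R by linarith+
        have "r\<^sup>2 / 2 - c' \<le> lattice_J r" using elim r by (intro c') auto
        hence "- B r + of_int q * ln r - (c + c') \<le> jensen_D \<Xi> r"
          using J[OF True] by (simp add: jensen_D_def)
        hence "exp (- 2 * (c + c') + (- 2 * B r + 2 * (of_int q * ln r))) \<le> exp (2 * jensen_D \<Xi> r)"
          by simp
        hence "k * (exp (- 2 * B r) * (r powi q)\<^sup>2) \<le> exp (2 * jensen_D \<Xi> r)"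
          using r by (simp only: exp_add exp_double exp_of_int_ln k_def)
        hence "r * (k * (exp (- 2 * B r) * (r powi q)\<^sup>2)) \<le> r * exp (2 * jensen_D \<Xi> r)"
          using r by (intro mult_left_mono) auto
        also have "r * (k * (exp (- 2 * B r) * (r powi q)\<^sup>2)) = k * (r powi (2 * q + 1) * exp (- 2 * B r))"
          using r by (simp add: power_int_add power_int_mult mult.commute[of 2 q] mult_ac)
        finally have "ennreal (k * (r powi (2 * q + 1) * exp (- 2 * B r))) \<le> ?G r"
          by (rule ennreal_leI)
        thus ?thesis using k r True by (simp add: ennreal_mult)
      qed simp
    qed
  qed
  also have "\<dots> < \<infinity>" by (rule fin)
  finally have tail: "(\<integral>\<^sup>+ r. weight q r * indicator {R..} r \<partial>lborel) < \<infinity>"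
    using k by (auto simp: ennreal_mult_less_top)
  have "(\<integral>\<^sup>+ r\<in>{1..}. weight q r \<partial>lborel) \<le> (\<integral>\<^sup>+ r. weight q r * indicator {1..R} r + weight q r * indicator {R..} r \<partial>lborel)"
    by (intro nn_integral_mono) (auto simp: indicator_def)
  also have "\<dots> = (\<integral>\<^sup>+ r\<in>{1..R}. weight q r \<partial>lborel) + (\<integral>\<^sup>+ r. weight q r * indicator {R..} r \<partial>lborel)"
    by (rule nn_integral_add) measurable
  also have "\<dots> < \<infinity>" using tail weight_integral_initial_finite[where R=R and q=q] by simp
  finally show ?thesis .
qed

end

theorem corollary7p4:
  fixes \<mu> :: "complex \<Rightarrow> complex" and C :: real and A\<^sub>0 A :: "complex set"
    and \<Xi> :: mult and q :: int
  assumes A0: "finite A\<^sub>0" "A\<^sub>0 \<subseteq> sq_lattice"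
    and close: "\<And>l. l \<in> sq_lattice - A\<^sub>0 \<Longrightarrow> cmod (\<mu> l - l) \<le> C / (1 + cmod l)"
    and A: "finite A" "A \<subseteq> sq_lattice" "A\<^sub>0 \<subseteq> A"
    and nonzero: "\<And>l. l \<in> sq_lattice - A \<Longrightarrow> l \<noteq> 0 \<and> \<mu> l \<noteq> 0"
    and modif: "finite_modification (labelled_multiset sq_lattice \<mu>) \<Xi> q"
  shows
    "(fock_zero_set \<Xi> \<longleftrightarrow>
        (\<integral>\<^sup>+ r\<in>{1..}. ennreal (r powi (2 * q + 1) * exp (- 2 * log_displacement A \<mu> r)) \<partial>lborel) < \<infinity>)
     \<and> ((\<integral>\<^sup>+ r\<in>{1..}. ennreal (r powi (2 * q + 1) * exp (- 2 * log_displacement A \<mu> r)) \<partial>lborel) < \<infinity>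
        \<longleftrightarrow> (\<integral>\<^sup>+ r\<in>{1..}. ennreal (r * exp (2 * jensen_D \<Xi> r)) \<partial>lborel) < \<infinity>)
     \<and> ((\<integral>\<^sup>+ r\<in>{1..}. ennreal (r powi (2 * q + 1) * exp (- 2 * log_displacement A \<mu> r)) \<partial>lborel) = \<infinity>
        \<longrightarrow> fock_uniqueness_multiset \<Xi>)"
proof -
  have C0: "0 \<le> C"
  proof -
    have "infinite (sq_lattice - A\<^sub>0)" using infinite_sq_lattice A0(1) by simp
    then obtain l where "l \<in> sq_lattice - A\<^sub>0" using infinite_imp_nonempty by blast
    hence "0 \<le> C / (1 + cmod l)" using close[of l] norm_ge_zero[of "\<mu> l - l"] by linarith
    moreover have "0 < 1 + cmod l" by (rule add_pos_nonneg) auto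
    ultimately show ?thesis by (simp add: zero_le_divide_iff)
  qed
  have "0 \<in> sq_lattice" using gauss_pt_in[of "(0,0)"] by simp
  hence "0 \<in> A" using nonzero by blast
  interpret perturbed_lattice A \<mu> C
    by unfold_locales (use A close nonzero C0 \<open>0 \<in> A\<close> in auto)
  let ?IB = "\<integral>\<^sup>+ r\<in>{1..}. ennreal (r powi (2 * q + 1) * exp (- 2 * log_displacement A \<mu> r)) \<partial>lborel"
  let ?ID = "\<integral>\<^sup>+ r\<in>{1..}. ennreal (r * exp (2 * jensen_D \<Xi> r)) \<partial>lborel"
  obtain N P where N: "\<And>z. count N z \<le> \<Gamma> z" and Xi: "\<And>z. \<Xi> z = \<Gamma> z - count N z + count P z"
    and q: "q = int (size P) - int (size N)"
    using modif unfolding finite_modification_def by blast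
  have zero_set: "fock_zero_set \<Xi>" if fin: "?IB < \<infinity>"
  proof -
    obtain f K R where f: "f holomorphic_on UNIV" "\<exists>z. f z \<noteq> 0" "\<forall>z. zorder f z = int (\<Xi> z)"
      and K: "0 < K" "1 \<le> R"
      and bound: "\<forall>z. z \<notin> sq_lattice \<longrightarrow> R \<le> cmod z \<longrightarrow>
        cmod (f z) \<le> K * cmod z powi q * exp ((cmod z)\<^sup>2 / 2 - log_displacement A \<mu> (cmod z))"
      using finite_modification_function[OF N Xi q] by blast
    have "f \<in> bargmann_fock"
      by (rule fock_membership[OF f(1) K _ fin]) (use bound in blast)
    thus ?thesis unfolding fock_zero_set_def using f by blast
  qed
  have ID_IB: "?IB < \<infinity>" if fin: "?ID < \<infinity>"
  proof -
    obtain c R where "1 \<le> R" "\<And>r. r \<ge> R \<Longrightarrow> lattice_J r - log_displacement A \<mu> r + of_int q * ln r - c \<le> jensen_J \<Xi> r"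
      using finite_modification_jensen_ge[OF N Xi q] by blast
    thus ?thesis using weight_integral_finite[of R q c \<Xi>] fin by blast
  qed
  have vanish: "?ID < \<infinity>" if "g \<in> bargmann_fock" "\<exists>z. g z \<noteq> 0" "\<forall>z. int (\<Xi> z) \<le> zorder g z" for g
    by (rule jensen_integral_finite[OF that(1,2)]) (use that(3) in blast)
  have ID_zero: "?ID < \<infinity>" if "fock_zero_set \<Xi>"
    using that vanish unfolding fock_zero_set_def by (metis order_refl)
  have uniq: "fock_uniqueness_multiset \<Xi>" if "?IB = \<infinity>"
    unfolding fock_uniqueness_multiset_def
  proof (intro ballI impI, rule ccontr)
    fix g assume g: "g \<in> bargmann_fock" "vanishes_on g \<Xi>" "\<not> (\<forall>z. g z = 0)"
    hence "\<forall>z. int (\<Xi> z) \<le> zorder g z" by (auto simp: vanishes_on_def)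
    hence "?ID < \<infinity>" using g by (intro vanish) auto
    hence "?IB < \<infinity>" by (rule ID_IB)
    thus False using that by simp
  qed
  show ?thesis using zero_set ID_IB ID_zero uniq by blast
qed

end
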